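(* Let $V$ be a vertex operator algebra, $G$ a finite group of automorphisms of $V$ of order $T$, and $n\in\frac1T\mathbb Z$ with $n\ge 0$. Let $A_{g,n}(V)=V/O_{g,n}(V)$ with product $*_{g,n}$ be the $g$-twisted Zhu algebra for $g\in G$, and let $A_{G,n}(V)=V/\bigcap_{g\in G}O_{g,n}(V)$ (see context). (1) For $u,v\in V$ there exists a unified product $u*_nv$ for $A_{g,n}(V)$ for any $g\in G$. That is, $$u*_nv\equiv u*_{g,n}v \pmod{O_{g,n}(V)}\qquad\text{for any } g\in G .$$ In particular, $(A_{G,n}(V),*_n)$ is an associative algebra. Moreover, if $V$ is simple, then the injective map $$\varphi_n:A_{G,n}(V)\to\bigoplus_{g\in G}A_{g,n}(V),\qquad \varphi_n\Big(u+\bigcap_{g\in G}O_{g,n}(V)\Big)=\sum_{g\in G}\big(u+O_{g,n}(V)\big)\quad(u\in V),$$ (the $g$-th summand lying in $A_{g,n}(V)$) is a surjective algebra homomorphism; that is, $A_{G,n}(V)\simeq\bigoplus_{g\in G}A_{g,n}(V)$ as algebras. (2) The identity map on $V$ induces a surjective algebra homomorphism from $A_{G,n}(V)$ to $A_{G,n-1/T}(V)$ (here $n\ge 1/T$, so that the target is defined).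
   Context: $V$ is a vertex operator algebra over $\mathbb C$ with vertex operators $Y(u,z)=\sum_{j\in\mathbb Z}u_jz^{-j-1}$, and $\mathrm{wt}(u)$ is the weight of a homogeneous $u$; $L(-1)$ and $L(0)$ are the usual Virasoro operators on $V$. For $g\in G$ and $0\le r\le T-1$ put $V^{(g,r)}=\{u\in V: gu=e^{-2\pi\sqrt{-1}\,r/T}u\}$, so $V=\bigoplus_{r=0}^{T-1}V^{(g,r)}$; $u^{(g,r)}$ denotes the component of $u\in V$ in $V^{(g,r)}$. Write $n=l+i/T$ with $l\in\mathbb Z_{\ge0}$, $0\le i\le T-1$. For $0\le r\le T-1$ let $\delta_i(r)=1$ if $i\ge r$, $\delta_i(r)=0$ if $i<r$, and $\delta_i(T)=1$. For homogeneous $u\in V$ and $v\in V$ set $$u\circ_{g,n}v=\sum_{r=0}^{T-1}\mathrm{Res}_z\,Y(u^{(g,r)},z)v\,\frac{(1+z)^{\mathrm{wt}(u)-1+\delta_i(r)+l+r/T}}{z^{2l+\delta_i(r)+\delta_i(T-r)}},$$ where powers of $1+z$ are expanded in nonnegative powers of $z$. $O_{g,n}(V)$ is the linear span of all $u\circ_{g,n}v$ and all $(L(-1)+L(0))v$. For homogeneous $u\in V$ and $v\in V$ set $$u*_{g,n}v=\sum_{m=0}^{l}(-1)^m\binom{m+l}{l}\mathrm{Res}_z\,Y(u^{(g,0)},z)v\,\frac{(1+z)^{\mathrm{wt}(u)+l}}{z^{l+m+1}},$$ extended linearly to a bilinear product on $V$. It is known (Dong–Li–Mason) that $*_{g,n}$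 makes $A_{g,n}(V)=V/O_{g,n}(V)$ an associative algebra with identity. "Unified" means that one and the same element $u*_nv$ of $V$ satisfies the displayed congruence for all $g\in G$ simultaneously; the product on $A_{G,n}(V)$ is the one induced by $*_n$.
   Formalization: For 0<r<T the exponent of z in u∘_{g,n}v is 2l+δ_i(r)+δ_i(T−r)+1, as in Dong–Li–Mason, one more than printed (for r=0 it is 2l+2, as printed); with the printed exponent (1) fails for V=C[x]/(x²), ω=0, g: x↦−x, T=2, n=0. *)

theory Defs
  imports
    Complex_Main
    "HOL-Library.FuncSet"
    "HOL-Library.Groups_Big_Fun"
    "HOL-Computational_Algebra.Formal_Laurent_Series"
    "HOL-Algebra.Module"
    "HOL-Algebra.Algebraic_Closure_Type"
begin

text \<open>The library locale \<open>algebra\<close> is restricted to commutative algebras, so the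
  noncommutative unital notion is introduced here.  The zero algebra is allowed.\<close>

locale assoc_algebra = module R A + ring A for R (structure) and A (structure) +
  assumes smult_mult_left:
      "\<lbrakk>c \<in> carrier R; x \<in> carrier A; y \<in> carrier A\<rbrakk> \<Longrightarrow>
        (c \<odot>\<^bsub>A\<^esub> x) \<otimes>\<^bsub>A\<^esub> y = c \<odot>\<^bsub>A\<^esub> (x \<otimes>\<^bsub>A\<^esub> y)"
    and smult_mult_right:
      "\<lbrakk>c \<in> carrier R; x \<in> carrier A; y \<in> carrier A\<rbrakk> \<Longrightarrow>
        x \<otimes>\<^bsub>A\<^esub> (c \<odot>\<^bsub>A\<^esub> y) = c \<odot>\<^bsub>A\<^esub> (x \<otimes>\<^bsub>A\<^esub> y)"

abbreviation complex_ring :: "complex ring"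
  where "complex_ring \<equiv> ring_of_type_algebra"

definition algebra_hom ::
    "('k, 'r) ring_scheme \<Rightarrow> ('k, 'a, 'm) module_scheme \<Rightarrow> ('k, 'b, 'n) module_scheme \<Rightarrow> ('a \<Rightarrow> 'b) set"
  where "algebra_hom R A B =
    {h \<in> ring_hom A B. \<forall>c\<in>carrier R. \<forall>x\<in>carrier A. h (c \<odot>\<^bsub>A\<^esub> x) = c \<odot>\<^bsub>B\<^esub> h x}"

text \<open>Direct sum of algebras with componentwise operations.  It is used for finite index sets only,
  where no finite-support condition is needed.\<close>

definition direct_sum_algebra :: "'i set \<Rightarrow> ('i \<Rightarrow> ('k, 'a) module) \<Rightarrow> ('k, 'i \<Rightarrow> 'a) module"
  where "direct_sum_algebra I A =
    \<lparr>carrier = (\<Pi>\<^sub>E i\<in>I. carrier (A i)),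
     monoid.mult = (\<lambda>x y. \<lambda>i\<in>I. x i \<otimes>\<^bsub>A i\<^esub> y i),
     monoid.one = (\<lambda>i\<in>I. \<one>\<^bsub>A i\<^esub>),
     ring.zero = (\<lambda>i\<in>I. \<zero>\<^bsub>A i\<^esub>),
     ring.add = (\<lambda>x y. \<lambda>i\<in>I. x i \<oplus>\<^bsub>A i\<^esub> y i),
     module.smult = (\<lambda>c x. \<lambda>i\<in>I. c \<odot>\<^bsub>A i\<^esub> x i)\<rparr>"

definition is_decomposition :: "('i \<Rightarrow> 'v::ab_group_add set) \<Rightarrow> 'i set \<Rightarrow> 'v \<Rightarrow> ('i \<Rightarrow> 'v) \<Rightarrow> bool"
  where "is_decomposition W I u c \<longleftrightarrow>
    (\<forall>i\<in>I. c i \<in> W i) \<and> (\<forall>i. i \<notin> I \<longrightarrow> c i = 0) \<and> finite {i. c i \<noteq> 0} \<and> u = Sum_any c"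

definition component :: "('i \<Rightarrow> 'v::ab_group_add set) \<Rightarrow> 'i set \<Rightarrow> 'i \<Rightarrow> 'v \<Rightarrow> 'v"
  where "component W I i u = (THE c. is_decomposition W I u c) i"

definition coset :: "'v::ab_group_add set \<Rightarrow> 'v \<Rightarrow> 'v set"
  where "coset W u = (\<lambda>w. u + w) ` W"

text \<open>\<open>Y u j v\<close> is \<open>u\<^sub>j v\<close>, so that \<open>Y(u,z)v\<close> is the sum of the \<open>Y u j v\<close> times \<open>z\<close> to the power
  \<open>-j-1\<close>; \<open>L(m)\<close> is \<open>Y om (m + 1)\<close>.  The axiom \<open>jacobi\<close> is the Jacobi identity in component
  (Borcherds) form; by truncation all its sums have finite support.\<close>

locale vertex_operator_algebra =
  vector_space scale for scale :: "complex \<Rightarrow> 'v::ab_group_add \<Rightarrow> 'v" (infixr "*s" 75) +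
  fixes Y :: "'v \<Rightarrow> int \<Rightarrow> 'v \<Rightarrow> 'v"
    and vac :: 'v
    and om :: 'v
  assumes Y_linear_left: "Vector_Spaces.linear scale scale (\<lambda>u. Y u j v)"
    and Y_linear_right: "Vector_Spaces.linear scale scale (Y u j)"
    and truncation: "\<exists>N. \<forall>j\<ge>N. Y u j v = 0"
    and vacuum: "Y vac j v = (if j = - 1 then v else 0)"
    and creation: "Y u (- 1) vac = u" "j \<ge> 0 \<Longrightarrow> Y u j vac = 0"
    and jacobi:
      "Sum_any (\<lambda>i::nat. ((of_int p :: complex) gchoose i) *s Y (Y u (s + int i) v) (p + q - int i) w) =
       Sum_any (\<lambda>i::nat. ((- 1) ^ i * ((of_int s :: complex) gchoose i)) *s
         (Y u (p + s - int i) (Y v (q + int i) w)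
           - ((- 1) powi s) *s Y v (q + s - int i) (Y u (p + int i) w)))"
    and virasoro:
      "\<exists>c. \<forall>m n v. Y om (m + 1) (Y om (n + 1) v) - Y om (n + 1) (Y om (m + 1) v) =
         of_int (m - n) *s Y om (m + n + 1) v
         + (if m + n = 0 then ((of_int m ^ 3 - of_int m) / 12 * c) *s v else 0)"
    and translation: "Y (Y om 0 u) j v = - (of_int j *s Y u (j - 1) v)"
    and grading: "span (\<Union>k::int. {v. Y om 1 v = of_int k *s v}) = UNIV"
    and finite_dim: "\<exists>B. finite B \<and> span B = {v. Y om 1 v = of_int (k::int) *s v}"
    and bounded_below: "\<exists>N::int. \<forall>k<N. {v. Y om 1 v = of_int k *s v} = {0}"
begin

definition L :: "int \<Rightarrow> 'v \<Rightarrow> 'v"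
  where "L m = Y om (m + 1)"

definition wt_space :: "int \<Rightarrow> 'v set"
  where "wt_space k = {v. L 0 v = of_int k *s v}"

definition simple :: bool
  where "simple \<longleftrightarrow> (\<exists>v::'v. v \<noteq> 0) \<and>
    (\<forall>I. subspace I \<and> (\<forall>u j. \<forall>v\<in>I. Y u j v \<in> I) \<longrightarrow> I = {0} \<or> I = UNIV)"

definition aut_group :: "('v \<Rightarrow> 'v) monoid"
  where "aut_group =
    \<lparr>carrier = {g. Vector_Spaces.linear scale scale g \<and> bij g \<and>
                   (\<forall>u j v. g (Y u j v) = Y (g u) j (g v)) \<and> g vac = vac \<and> g om = om},
     monoid.mult = (\<circ>), one = id\<rparr>"

lemma group_aut_group: "group aut_group"
proof (rule groupI)
  fix g assume g: "g \<in> carrier aut_group"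
  have "bij g" and lin: "Vector_Spaces.linear scale scale g"
    and Y: "\<And>u j v. g (Y u j v) = Y (g u) j (g v)" and "g vac = vac" "g om = om"
    using g by (auto simp: aut_group_def)
  then have i: "\<And>x. inv_into UNIV g (g x) = x" "\<And>x. g (inv_into UNIV g x) = x"
    by (simp_all add: bij_is_inj bij_is_surj surj_f_inv_f)
  interpret g: Vector_Spaces.linear scale scale g by (fact lin)
  have "Vector_Spaces.linear scale scale (inv_into UNIV g)"
  proof (rule Vector_Spaces.linear_iff[THEN iffD2], intro conjI allI)
    show "vector_space scale" "vector_space scale" by unfold_locales
    show "inv_into UNIV g (x + y) = inv_into UNIV g x + inv_into UNIV g y" for x y
      by (metis i g.add)
    show "inv_into UNIV g (c *s x) = c *s inv_into UNIV g x" for c x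
      by (metis i g.scale)
  qed
  moreover have "inv_into UNIV g (Y u j v) = Y (inv_into UNIV g u) j (inv_into UNIV g v)" for u j v
    by (metis i Y)
  moreover have "inv_into UNIV g vac = vac" "inv_into UNIV g om = om"
    using \<open>g vac = vac\<close> \<open>g om = om\<close> i by metis+
  ultimately have "inv_into UNIV g \<in> carrier aut_group"
    using \<open>bij g\<close> by (simp add: aut_group_def bij_imp_bij_inv)
  moreover have "inv_into UNIV g \<otimes>\<^bsub>aut_group\<^esub> g = \<one>\<^bsub>aut_group\<^esub>"
    by (auto simp: aut_group_def i)
  ultimately show "\<exists>h\<in>carrier aut_group. h \<otimes>\<^bsub>aut_group\<^esub> g = \<one>\<^bsub>aut_group\<^esub>"
    by blast
qed (auto simp: aut_group_def comp_assoc bij_comp linear_id Vector_Spaces.linear_iff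
      intro: vector_space_axioms)

text \<open>\<open>residue u v f\<close> is \<open>Res\<^sub>z Y(u,z)v f(z)\<close>: the coefficient of \<open>z\<close> to the power \<open>-1\<close> collects
  \<open>f\<^sub>j u\<^sub>j v\<close> over all integers \<open>j\<close>, and only finitely many of these are nonzero.\<close>

definition residue :: "'v \<Rightarrow> 'v \<Rightarrow> complex fls \<Rightarrow> 'v"
  where "residue u v f = Sum_any (\<lambda>j. fls_nth f j *s Y u j v)"

text \<open>The series \<open>(1+z)\<^sup>a z\<^sup>b\<close>, expanded in nonnegative powers of \<open>z\<close> up to the factor \<open>z\<^sup>b\<close>.\<close>

definition binomial_laurent :: "complex \<Rightarrow> int \<Rightarrow> complex fls"
  where "binomial_laurent a b = fps_to_fls (fps_binomial a) * fls_X_intpow b"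

text \<open>Throughout, \<open>T\<close> is a positive integer with \<open>g\<close> to the power \<open>T\<close> equal to the identity, and
  \<open>n = l + i/T\<close> is a nonnegative element of \<open>(1/T)\<int>\<close>, with \<open>l = level n\<close> and \<open>i = frac_index T n\<close>.\<close>

definition level :: "rat \<Rightarrow> nat"
  where "level n = nat \<lfloor>n\<rfloor>"

definition frac_index :: "nat \<Rightarrow> rat \<Rightarrow> nat"
  where "frac_index T n = nat \<lfloor>of_nat T * frac n\<rfloor>"

definition eigenspace :: "nat \<Rightarrow> ('v \<Rightarrow> 'v) \<Rightarrow> nat \<Rightarrow> 'v set"
  where "eigenspace T g r = {u. g u = exp (- 2 * of_real pi * \<i> * of_nat r / of_nat T) *s u}"

abbreviation eigencomponent :: "nat \<Rightarrow> ('v \<Rightarrow> 'v) \<Rightarrow> nat \<Rightarrow> 'v \<Rightarrow> 'v"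
  where "eigencomponent T g \<equiv> component (eigenspace T g) {..<T}"

definition delta :: "nat \<Rightarrow> nat \<Rightarrow> nat"
  where "delta i r = (if r \<le> i then 1 else 0)"

text \<open>Below, \<open>k\<close> is the weight of \<open>u\<close>.  The exponent of \<open>1/z\<close> is that of Dong, Li and Mason: \<open>2l + 2\<close> for \<open>r = 0\<close>, and
  \<open>2l + \<delta>\<^sub>i(r) + \<delta>\<^sub>i(T-r) + 1\<close> for \<open>0 < r < T\<close>.  Since \<open>i < T\<close>, the function \<open>delta\<close> gives
  \<open>\<delta>\<^sub>i(T) = 0\<close>, and the single formula \<open>2l + \<delta>\<^sub>i(r) + \<delta>\<^sub>i(T-r) + 1\<close> covers both cases.
  The variant with \<open>\<delta>\<^sub>i(T) = 1\<close> and without the summand \<open>1\<close> has the same exponent for \<open>r = 0\<close> but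
  one less for \<open>r > 0\<close>.  It does not give an algebra with identity: take \<open>n = 0\<close>, \<open>T = 2\<close>,
  \<open>Y(u,z)v = uv\<close> on \<open>\<complex>[x]/(x\<^sup>2)\<close> with conformal vector \<open>0\<close>, and \<open>g\<close> sending \<open>x\<close> to \<open>-x\<close>; then
  nothing is factored out, while \<open>x\<close> times the vacuum is \<open>0\<close> in \<open>V\<close>.\<close>

definition zhu_circ :: "nat \<Rightarrow> rat \<Rightarrow> ('v \<Rightarrow> 'v) \<Rightarrow> int \<Rightarrow> 'v \<Rightarrow> 'v \<Rightarrow> 'v"
  where "zhu_circ T n g k u v =
    (let l = level n; i = frac_index T n in
     \<Sum>r<T. residue (eigencomponent T g r u) v
       (binomial_laurent
         (of_int k - 1 + of_nat (delta i r) + of_nat l + of_nat r / of_nat T)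
         (- int (2 * l + delta i r + delta i (T - r) + 1))))"

definition zhu_O :: "nat \<Rightarrow> rat \<Rightarrow> ('v \<Rightarrow> 'v) \<Rightarrow> 'v set"
  where "zhu_O T n g =
    span ({zhu_circ T n g k u v | k u v. u \<in> wt_space k} \<union> range (\<lambda>v. L (- 1) v + L 0 v))"

definition zhu_star_homogeneous :: "nat \<Rightarrow> rat \<Rightarrow> ('v \<Rightarrow> 'v) \<Rightarrow> int \<Rightarrow> 'v \<Rightarrow> 'v \<Rightarrow> 'v"
  where "zhu_star_homogeneous T n g k u v =
    (let l = level n in
     \<Sum>m\<le>l. ((- 1) ^ m * of_nat ((m + l) choose l)) *s
       residue (eigencomponent T g 0 u) v
         (binomial_laurent (of_int k + of_nat l) (- int (l + m + 1))))"

definition zhu_star :: "nat \<Rightarrow> rat \<Rightarrow> ('v \<Rightarrow> 'v) \<Rightarrow> 'v \<Rightarrow> 'v \<Rightarrow> 'v"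
  where "zhu_star T n g u v =
    Sum_any (\<lambda>k. zhu_star_homogeneous T n g k (component wt_space UNIV k u) v)"

text \<open>The quotient of \<open>V\<close> by \<open>W\<close> with the operations induced by a product \<open>m\<close>.  As for the library's
  \<open>rcoset_mult\<close>, operations on cosets are unions over all representatives; such a union is a coset
  only if the result is independent of the representatives.\<close>

definition quotient_algebra :: "'v set \<Rightarrow> ('v \<Rightarrow> 'v \<Rightarrow> 'v) \<Rightarrow> (complex, 'v set) module"
  where "quotient_algebra W m =
    \<lparr>carrier = range (coset W),
     monoid.mult = (\<lambda>A B. \<Union>a\<in>A. \<Union>b\<in>B. coset W (m a b)),
     monoid.one = coset W vac,
     ring.zero = coset W 0,
     ring.add = (\<lambda>A B. \<Union>a\<in>A. \<Union>b\<in>B. coset W (a + b)),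
     module.smult = (\<lambda>c A. \<Union>a\<in>A. coset W (c *s a))\<rparr>"

definition zhu_algebra :: "nat \<Rightarrow> rat \<Rightarrow> ('v \<Rightarrow> 'v) \<Rightarrow> (complex, 'v set) module"
  where "zhu_algebra T n g = quotient_algebra (zhu_O T n g) (zhu_star T n g)"

definition zhu_O_group :: "('v \<Rightarrow> 'v) set \<Rightarrow> rat \<Rightarrow> 'v set"
  where "zhu_O_group G n = (\<Inter>g\<in>G. zhu_O (card G) n g)"

definition unified_product :: "('v \<Rightarrow> 'v) set \<Rightarrow> rat \<Rightarrow> ('v \<Rightarrow> 'v \<Rightarrow> 'v) \<Rightarrow> bool"
  where "unified_product G n m \<longleftrightarrow>
    (\<forall>u v. \<forall>g\<in>G. m u v - zhu_star (card G) n g u v \<in> zhu_O (card G) n g)"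

definition zhu_algebra_group ::
    "('v \<Rightarrow> 'v) set \<Rightarrow> rat \<Rightarrow> ('v \<Rightarrow> 'v \<Rightarrow> 'v) \<Rightarrow> (complex, 'v set) module"
  where "zhu_algebra_group G n m = quotient_algebra (zhu_O_group G n) m"

end

end

(* In the coordinate w = 1 + z, O_{g,n}(V) is spanned, modulo (L(-1) + L(0))V, by the residues at
   w = 1 of Y(u,w-1)v w^{wt(u)-1} F(w), where u has g-eigenvalue exp(-2 pi i r/T) and F lies in
   w^{r/T} C[w,1/w,1/(w-1)] and vanishes to order > n both at w = 0 and at w = infinity.  The
   product uses a function E that vanishes to order l+1 at w = 0 and equals 1 up to order l+1 at
   w = infinity.  All properties of A_{g,n}(V) are then statements about orders of vanishing, once
   the Jacobi identity is known for arbitrary Laurent series; associativity, for instance, compares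
   E(w1)E(w2) with E(w1/w2)E(w2).

   Unified product: for u of weight k, the residue of Y(u,z)v f(z) depends modulo O_{g,n}(V) on the
   component of u in V^{(g,r)} only through finitely many residues of f(z)(1+z)^b, with b in a finite
   set depending on r but not on g.  These sets are disjoint for distinct r, because their elements
   differ by non-integers, and the residues can be prescribed by Lagrange interpolation in b.  So
   there is an f acting on every V^{(g,0)} as the kernel of *_{g,n} and on the other V^{(g,r)} as 0.

   Simple V: choosing f to act as z^j on V^{(g,s)} and as 0 elsewhere shows that a_j v lies in
   O_{g,n}(V) + O_{h,n}(V), where a is the difference of the components of u in V^{(g,s)} and
   V^{(h,s)}.  For g different from h some such a is nonzero, and the vectors a_j v then span V.
   Hence the ideals are pairwise comaximal and the Chinese remainder theorem applies. *)

theory Submission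
  imports Defs
begin

section \<open>Laurent series\<close>

text \<open>The powers (1+z)^a with fractional a are genuine series, while the axiom
  \<open>jacobi\<close> treats monomials. The identity for f1(z1) f2(z2) (z1-z2)^s is therefore
  obtained by z-adic continuity in one variable at a time; the ideal property and associativity are
  instances of it. They fit its shape because of weights: the weight of u_j v drops by one when j
  grows by one, and since the kernel of the product carries (1+z)^wt, this drop turns the
  coefficients of (1+z)^c into Taylor coefficients.

  Uniformity in g rests on the common denominator T, the order of G: the exponents that decide
  membership in O_{g,n}(V) depend on r, T and n, while g enters only through the decomposition of u.
  The unified product is found pair by pair, so it is a mere function on V; bilinearity,
  associativity and the unit laws hold for it modulo the intersection, and the quotient is built
  from congruences alone.

  In the simple case, simplicity speaks of modes acting from the left, which gives the span of the
  v_j a; skew-symmetry is what converts it into the span of the a_j v.\<close>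

lemma fls_truncate_decomp:
  fixes f :: "complex fls"
  obtains t where "f = (\<Sum>j\<in>{fls_subdegree f..<N}. fls_const (fls_nth f j) * fls_X_intpow j) + t"
    and "\<And>j. j < N \<Longrightarrow> fls_nth t j = 0"
proof -
  let ?S = "\<Sum>j\<in>{fls_subdegree f..<N}. fls_const (fls_nth f j) * fls_X_intpow j"
  have "fls_nth (f - ?S) j = 0" if "j < N" for j
  proof (cases "j < fls_subdegree f")
    case True
    then have "fls_nth f j = 0" by simp
    moreover have "(\<Sum>i\<in>{fls_subdegree f..<N}.
        fls_nth (fls_const (fls_nth f i) * fls_X_intpow i) j) = 0"
      using True by (intro sum.neutral) auto
    ultimately show ?thesis by (simp add: fls_nth_sum del: fls_const_mult_const)
  next
    case False
    have "(\<Sum>i\<in>{fls_subdegree f..<N}. fls_nth (fls_const (fls_nth f i) * fls_X_intpow i) j) =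
        (\<Sum>i\<in>{fls_subdegree f..<N}. if i = j then fls_nth f j else 0)"
      by (intro sum.cong) auto
    also have "\<dots> = fls_nth f j" using False that by simp
    finally show ?thesis by (simp add: fls_nth_sum)
  qed
  moreover have "f = ?S + (f - ?S)" by (simp only: add_diff_eq add_diff_cancel_left')
  ultimately show thesis by (intro that[of "f - ?S"])
qed

lemma fls_eqI: "(\<And>j. fls_nth f j = fls_nth g j) \<Longrightarrow> f = g"
  by (simp add: fls_eq_iff)

text \<open>The divided derivative, that is the coefficient of x^i in f(z + x). It enters the Jacobi
  identity when f1(z1) is expanded at z1 = z2 + (z1 - z2).\<close>

definition fls_taylor :: "nat \<Rightarrow> complex fls \<Rightarrow> complex fls"
  where "fls_taylor i f = fls_const (1 / fact i) * (fls_deriv ^^ i) f"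

lemma fls_deriv_funpow_order:
  assumes "\<And>j. j < N \<Longrightarrow> fls_nth f j = 0" "j < N - int i"
  shows "fls_nth ((fls_deriv ^^ i) f) j = 0"
  using assms(2) by (induction i arbitrary: j) (use assms(1) in auto)

lemma fls_taylor_order:
  assumes "\<And>j. j < N \<Longrightarrow> fls_nth f j = 0" "j < N - int i"
  shows "fls_nth (fls_taylor i f) j = 0"
  using fls_deriv_funpow_order[OF assms] by (simp add: fls_taylor_def)

lemma fls_deriv_funpow_add: "(fls_deriv ^^ i) (f + g) = (fls_deriv ^^ i) f + (fls_deriv ^^ i) (g::'a::ring_1 fls)"
  by (induction i) simp_all

lemma fls_deriv_funpow_const_mult:
  "(fls_deriv ^^ i) (fls_const c * f) = fls_const c * (fls_deriv ^^ i) (f::complex fls)"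
  by (induction i) simp_all

lemma fls_taylor_add: "fls_taylor i (f + g) = fls_taylor i f + fls_taylor i g"
  by (simp add: fls_taylor_def fls_deriv_funpow_add algebra_simps)

lemma fls_taylor_const_mult: "fls_taylor i (fls_const c * f) = fls_const c * fls_taylor i f"
  unfolding fls_taylor_def fls_deriv_funpow_const_mult by (simp only: mult_ac)

lemma fls_taylor_0 [simp]: "fls_taylor 0 f = f"
  by (simp add: fls_taylor_def)

text \<open>The derivative sits on the inside, so that an induction on i can replace f by its
  derivative, which for (1+z)^a z^b is a combination of two series of the same kind.\<close>

lemma fls_taylor_Suc: "fls_taylor (Suc i) f = fls_const (1 / of_nat (Suc i)) * fls_taylor i (fls_deriv f)"
proof -
  have "fls_const (1 / fact (Suc i)) = fls_const (1 / of_nat (Suc i)) * fls_const (1 / fact i :: complex)"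
    by (simp add: fls_const_mult_const field_simps)
  then show ?thesis by (simp only: fls_taylor_def funpow_Suc_right o_apply mult.assoc)
qed

lemma fls_mult_order:
  fixes f g :: "complex fls"
  assumes "\<And>j. j < N \<Longrightarrow> fls_nth f j = 0" "\<And>j. j < M \<Longrightarrow> fls_nth g j = 0" "j < N + M"
  shows "fls_nth (f * g) j = 0"
proof (cases "f = 0 \<or> g = 0")
  case False
  then have "N \<le> fls_subdegree f" "M \<le> fls_subdegree g"
    using assms(1,2) by (meson nth_fls_subdegree_nonzero linorder_not_le)+
  then have "j < fls_subdegree (f * g)" using assms(3) False by simp
  then show ?thesis by simp
qed auto

context vertex_operator_algebra
begin

lemma binomial_laurent_nth:
  "fls_nth (binomial_laurent a b) j = (if j < b then 0 else a gchoose nat (j - b))"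
  by (simp add: binomial_laurent_def fls_X_intpow_times_conv_shift)

lemma binomial_laurent_mult:
  "binomial_laurent a b * binomial_laurent a' b' = binomial_laurent (a + a') (b + b')"
proof -
  have "binomial_laurent (a + a') (b + b') =
      fps_to_fls (fps_binomial a) * fps_to_fls (fps_binomial a') * (fls_X_intpow b * fls_X_intpow b')"
    by (simp only: binomial_laurent_def fps_binomial_add_mult fls_times_fps_to_fls
      fls_X_intpow_times_fls_X_intpow)
  then show ?thesis unfolding binomial_laurent_def by (simp only: ac_simps)
qed

lemma binomial_laurent_zero: "binomial_laurent 0 b = fls_X_intpow b"
  by (simp add: binomial_laurent_def)

lemma binomial_laurent_times_X:
  "binomial_laurent a b * fls_X_intpow c = binomial_laurent a (b + c)"
  using binomial_laurent_mult[of a b 0 c] by (simp add: binomial_laurent_zero)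

lemma binomial_laurent_pascal:
  "binomial_laurent (a + 1) b = binomial_laurent a b + binomial_laurent a (b + 1)"
proof (rule fls_eqI)
  fix j
  show "fls_nth (binomial_laurent (a + 1) b) j = fls_nth (binomial_laurent a b + binomial_laurent a (b + 1)) j"
  proof (cases "j \<le> b")
    case False
    define k where "k = nat (j - (b + 1))"
    have "nat (j - b) = Suc k" "nat (j - (b + 1)) = k"
      using False by (auto simp: k_def)
    then show ?thesis using False by (simp add: binomial_laurent_nth gbinomial_Suc_Suc)
  qed (auto simp: binomial_laurent_nth)
qed

lemma binomial_laurent_deriv:
  "fls_deriv (binomial_laurent a b) =
    fls_const a * binomial_laurent (a - 1) b + fls_const (of_int b) * binomial_laurent a (b - 1)"
proof (rule fls_eqI)
  fix j
  show "fls_nth (fls_deriv (binomial_laurent a b)) j = fls_nth (fls_const a * binomial_laurent (a - 1) b +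
      fls_const (of_int b) * binomial_laurent a (b - 1)) j"
  proof (cases "j < b")
    case False
    define k where "k = nat (j - b)"
    have k: "j = b + int k" "nat (b + int k - (b - 1)) = Suc k" "nat (1 + int k) = Suc k"
      using False by (auto simp: k_def)
    show ?thesis
      using gbinomial_absorption[of k a]
      by (simp add: binomial_laurent_nth k algebra_simps)
  next
    case True
    then consider "b = j + 1" | "j + 1 < b" by linarith
    then show ?thesis by cases (auto simp: binomial_laurent_nth)
  qed
qed

lemma fls_taylor_binomial:
  "fls_taylor i (binomial_laurent a 0) = fls_const (a gchoose i) * binomial_laurent (a - of_nat i) 0"
proof (induction i arbitrary: a)
  case (Suc i)
  have eq: "a / (1 + of_nat i) * ((a - 1) gchoose i) = a gchoose Suc i"
    using gbinomial_absorption[of i a] of_nat_neq_0[of i, where 'a=complex]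
    by (simp add: field_simps)
  show ?case
    by (simp add: fls_taylor_Suc binomial_laurent_deriv fls_taylor_const_mult Suc.IH
      fls_const_mult_const eq[symmetric] mult.assoc[symmetric] diff_diff_eq algebra_simps)
qed simp

lemma fls_taylor_X_intpow:
  "fls_taylor i (fls_X_intpow p) = fls_const (of_int p gchoose i) * fls_X_intpow (p - int i)"
proof (induction i arbitrary: p)
  case (Suc i)
  have D: "fls_deriv (fls_X_intpow p :: complex fls) = fls_const (of_int p) * fls_X_intpow (p - 1)"
    using binomial_laurent_deriv[of 0 p] by (simp add: binomial_laurent_zero)
  have eq: "of_int p / (1 + of_nat i) * (of_int (p - 1) gchoose i) = (of_int p :: complex) gchoose Suc i"
    using gbinomial_absorption[of i "of_int p :: complex"] of_nat_neq_0[of i, where 'a=complex]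
    by (simp add: field_simps)
  have "fls_taylor (Suc i) (fls_X_intpow p) = fls_const (1 / of_nat (Suc i)) *
     (fls_const (of_int p) * (fls_const (of_int (p - 1) gchoose i) * fls_X_intpow (p - 1 - int i)))"
    unfolding fls_taylor_Suc D fls_taylor_const_mult Suc.IH ..
  also have "\<dots> = fls_const (of_int p / (1 + of_nat i) * (of_int (p - 1) gchoose i)) * fls_X_intpow (p - 1 - int i)"
    by (simp only: mult.assoc[symmetric] fls_const_mult_const) (simp add: field_simps)
  finally show ?case unfolding eq by (simp add: algebra_simps)
qed simp

end

section \<open>Residues and the Jacobi identity for Laurent series\<close>

context vertex_operator_algebra
begin

lemmas Y_add_left = module_hom.add[OF Y_linear_left[unfolded linear_iff_module_hom]]
  and Y_scale_left = module_hom.scale[OF Y_linear_left[unfolded linear_iff_module_hom]]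
  and Y_zero_left [simp] = module_hom.zero[OF Y_linear_left[unfolded linear_iff_module_hom]]
  and Y_diff_left = module_hom.diff[OF Y_linear_left[unfolded linear_iff_module_hom]]
  and Y_add_right = module_hom.add[OF Y_linear_right[unfolded linear_iff_module_hom]]
  and Y_scale_right = module_hom.scale[OF Y_linear_right[unfolded linear_iff_module_hom]]
  and Y_zero_right [simp] = module_hom.zero[OF Y_linear_right[unfolded linear_iff_module_hom]]

lemma residue_finite: "finite {j. fls_nth f j *s Y u j v \<noteq> 0}"
proof -
  obtain N where "\<forall>j\<ge>N. Y u j v = 0" using truncation by blast
  then have "{j. fls_nth f j *s Y u j v \<noteq> 0} \<subseteq> {fls_subdegree f..<N}"
    using fls_subdegree_leI[of f] by (auto simp: not_le[symmetric])
  then show ?thesis by (rule finite_subset) simp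
qed

lemma residue_eq_sum:
  assumes "\<And>j. j \<ge> N \<Longrightarrow> Y u j v = 0" "\<And>j. j < M \<Longrightarrow> fls_nth f j = 0"
  shows "residue u v f = (\<Sum>j\<in>{M..<N}. fls_nth f j *s Y u j v)"
  unfolding residue_def
  by (rule Sum_any.expand_superset) (use assms in \<open>auto simp: not_le[symmetric]\<close>, meson assms not_le)

lemma residue_order_zero:
  assumes "\<And>j. j \<ge> N \<Longrightarrow> Y u j v = 0" "\<And>j. j < N \<Longrightarrow> fls_nth f j = 0"
  shows "residue u v f = 0"
  using residue_eq_sum[OF assms] by simp

lemma residue_add: "residue u v (f + g) = residue u v f + residue u v g"
  unfolding residue_def
  by (subst Sum_any.distrib[symmetric]) (auto intro: residue_finite[simplified] simp: scale_left_distrib)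

lemma Sum_any_scale: "finite {j. F j \<noteq> 0} \<Longrightarrow> Sum_any (\<lambda>j. c *s F j) = c *s Sum_any F"
  by (subst (1 2) Sum_any.expand_superset[of "{j. F j \<noteq> 0}"]) (auto simp: scale_sum_right)

lemma residue_const_mult: "residue u v (fls_const c * f) = c *s residue u v f"
  unfolding residue_def by (subst Sum_any_scale[symmetric]) (auto intro: residue_finite[simplified])

lemma residue_zero [simp]: "residue u v 0 = 0"
  by (simp add: residue_def)

lemma residue_minus: "residue u v (- f) = - residue u v f"
  using residue_add[of u v f "- f"] by (simp add: eq_neg_iff_add_eq_0 add.commute)

lemma residue_diff: "residue u v (f - g) = residue u v f - residue u v g"
  using residue_add[of u v f "- g"] by (simp add: residue_minus)

lemma residue_sum: "residue u v (\<Sum>x\<in>A. f x) = (\<Sum>x\<in>A. residue u v (f x))"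
  by (induction A rule: infinite_finite_induct) (simp_all add: residue_add)

lemma residue_X_intpow: "residue u v (fls_X_intpow j) = Y u j v"
proof -
  have "residue u v (fls_X_intpow j) = Sum_any (\<lambda>i. if i = j then Y u j v else 0)"
    unfolding residue_def by (rule Sum_any.cong) auto
  then show ?thesis by simp
qed

lemma residue_add_left: "residue (u + u') v f = residue u v f + residue u' v f"
  unfolding residue_def
  by (subst Sum_any.distrib[symmetric]) (auto intro: residue_finite[simplified] simp: Y_add_left scale_right_distrib)

lemma residue_add_right: "residue u (v + v') f = residue u v f + residue u v' f"
  unfolding residue_def
  by (subst Sum_any.distrib[symmetric]) (auto intro: residue_finite[simplified] simp: Y_add_right scale_right_distrib)

lemma residue_scale_left: "residue (c *s u) v f = c *s residue u v f"
  unfolding residue_def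
  by (subst Sum_any_scale[symmetric]) (auto intro: residue_finite[simplified] simp: Y_scale_left mult.commute)

lemma residue_scale_right: "residue u (c *s v) f = c *s residue u v f"
  unfolding residue_def
  by (subst Sum_any_scale[symmetric]) (auto intro: residue_finite[simplified] simp: Y_scale_right mult.commute)

lemma residue_zero_left [simp]: "residue 0 v f = 0" and residue_zero_right [simp]: "residue u 0 f = 0"
  by (simp_all add: residue_def)

lemma linear_residue_left: "Vector_Spaces.linear scale scale (\<lambda>u. residue u v f)"
  by (simp add: Vector_Spaces.linear_iff residue_add_left residue_scale_left vector_space_axioms)

lemma linear_residue_right: "Vector_Spaces.linear scale scale (\<lambda>v. residue u v f)"
  by (simp add: Vector_Spaces.linear_iff residue_add_right residue_scale_right vector_space_axioms)

lemmas residue_sum_left = module_hom.sum[OF linear_residue_left[unfolded linear_iff_module_hom]]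
  and residue_sum_right = module_hom.sum[OF linear_residue_right[unfolded linear_iff_module_hom]]

text \<open>Continuity of the residue in the z-adic topology. Together with
  \<open>fls_truncate_decomp\<close> it reduces statements that are linear in a Laurent series to
  monomials.\<close>

lemma residue_cutoff: "\<exists>N. \<forall>f. (\<forall>j<N. fls_nth f j = 0) \<longrightarrow> residue u v f = 0"
proof -
  obtain N where "\<forall>j\<ge>N. Y u j v = 0" using truncation by blast
  then show ?thesis by (intro exI[of _ N]) (auto intro!: residue_order_zero[of N])
qed

lemma residue_cutoff_family:
  assumes "finite A"
  shows "\<exists>N. \<forall>x\<in>A. \<forall>f. (\<forall>j<N. fls_nth f j = 0) \<longrightarrow> residue (u x) (v x) f = 0"
  using assms
proof induction
  case (insert a A)
  then obtain N1 N2 where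
    "\<forall>x\<in>A. \<forall>f. (\<forall>j<N1. fls_nth f j = 0) \<longrightarrow> residue (u x) (v x) f = 0"
    "\<forall>f. (\<forall>j<N2. fls_nth f j = 0) \<longrightarrow> residue (u a) (v a) f = 0"
    using residue_cutoff[of "u a" "v a"] by blast
  then show ?case by (intro exI[of _ "max N1 N2"]) auto
qed auto

text \<open>The two sides of the Jacobi identity for \<open>f\<^sub>1(z\<^sub>1) f\<^sub>2(z\<^sub>2) (z\<^sub>1 - z\<^sub>2)\<^sup>s\<close> in place of a monomial.\<close>

definition iterate_term :: "'v \<Rightarrow> 'v \<Rightarrow> 'v \<Rightarrow> int \<Rightarrow> complex fls \<Rightarrow> complex fls \<Rightarrow> nat \<Rightarrow> 'v"
  where "iterate_term u v w s f1 f2 i = residue (Y u (s + int i) v) w (fls_taylor i f1 * f2)"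

definition product_term :: "'v \<Rightarrow> 'v \<Rightarrow> 'v \<Rightarrow> int \<Rightarrow> complex fls \<Rightarrow> complex fls \<Rightarrow> nat \<Rightarrow> 'v"
  where "product_term u v w s f1 f2 i = ((- 1) ^ i * (of_int s gchoose i)) *s
    (residue u (residue v w (f2 * fls_X_intpow (int i))) (f1 * fls_X_intpow (s - int i)) -
      ((- 1) powi s) *s
        residue v (residue u w (f1 * fls_X_intpow (int i))) (f2 * fls_X_intpow (s - int i)))"

text \<open>Equality of all late partial sums, rather than of two \<open>Sum_any\<close>, makes
  linearity in f1 and f2 immediate without tracking supports. It also allows the bound to be chosen
  beyond any given index.\<close>

definition jacobi_at :: "'v \<Rightarrow> 'v \<Rightarrow> 'v \<Rightarrow> int \<Rightarrow> complex fls \<Rightarrow> complex fls \<Rightarrow> bool"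
  where "jacobi_at u v w s f1 f2 \<longleftrightarrow>
    (\<forall>\<^sub>F n in sequentially. (\<Sum>i<n. iterate_term u v w s f1 f2 i) = (\<Sum>i<n. product_term u v w s f1 f2 i))"

lemma iterate_term_add:
  "iterate_term u v w s (f1 + f1') f2 i = iterate_term u v w s f1 f2 i + iterate_term u v w s f1' f2 i"
  "iterate_term u v w s f1 (f2 + f2') i = iterate_term u v w s f1 f2 i + iterate_term u v w s f1 f2' i"
  by (simp_all add: iterate_term_def fls_taylor_add algebra_simps residue_add)

lemma iterate_term_const_mult:
  "iterate_term u v w s (fls_const c * f1) f2 i = c *s iterate_term u v w s f1 f2 i"
  "iterate_term u v w s f1 (fls_const c * f2) i = c *s iterate_term u v w s f1 f2 i"
  by (simp_all only: iterate_term_def fls_taylor_const_mult mult.assoc mult.left_commute[of _ "fls_const c"]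
      residue_const_mult)

lemma product_term_add:
  "product_term u v w s (f1 + f1') f2 i = product_term u v w s f1 f2 i + product_term u v w s f1' f2 i"
  "product_term u v w s f1 (f2 + f2') i = product_term u v w s f1 f2 i + product_term u v w s f1 f2' i"
  by (simp_all only: product_term_def distrib_right residue_add residue_add_right scale_right_distrib
      scale_right_diff_distrib) (simp_all only: algebra_simps)

lemma product_term_const_mult:
  "product_term u v w s (fls_const c * f1) f2 i = c *s product_term u v w s f1 f2 i"
  "product_term u v w s f1 (fls_const c * f2) i = c *s product_term u v w s f1 f2 i"
  for f1 f2 :: "complex fls"
  by (simp_all only: product_term_def mult.assoc[of "fls_const c"] residue_const_mult residue_scale_right
    scale_right_diff_distrib scale_scale mult.commute[of c] mult.left_commute[of c]) (simp_all only: mult.assoc)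

lemma jacobi_at_add:
  assumes "jacobi_at u v w s f1 f2" "jacobi_at u v w s f1' f2"
  shows "jacobi_at u v w s (f1 + f1') f2"
  using assms unfolding jacobi_at_def
  by eventually_elim (simp add: iterate_term_add product_term_add sum.distrib)

lemma jacobi_at_add':
  assumes "jacobi_at u v w s f1 f2" "jacobi_at u v w s f1 f2'"
  shows "jacobi_at u v w s f1 (f2 + f2')"
  using assms unfolding jacobi_at_def
  by eventually_elim (simp add: iterate_term_add product_term_add sum.distrib)

lemma jacobi_at_const_mult:
  assumes "jacobi_at u v w s f1 f2"
  shows "jacobi_at u v w s (fls_const c * f1) f2" "jacobi_at u v w s f1 (fls_const c * f2)"
  using assms unfolding jacobi_at_def
  by (eventually_elim, simp add: iterate_term_const_mult product_term_const_mult scale_sum_right[symmetric])+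

lemma jacobi_at_zero: "jacobi_at u v w s 0 f2" "jacobi_at u v w s f1 0"
  using iterate_term_const_mult(1)[where c=0 and ?f1.0=0] iterate_term_const_mult(2)[where c=0 and ?f2.0=0]
    product_term_const_mult(1)[where c=0 and ?f1.0=0] product_term_const_mult(2)[where c=0 and ?f2.0=0]
  by (simp_all add: jacobi_at_def)

lemma jacobi_at_sum:
  "(\<And>x. x \<in> A \<Longrightarrow> jacobi_at u v w s (f x) f2) \<Longrightarrow> jacobi_at u v w s (\<Sum>x\<in>A. f x) f2"
  "(\<And>x. x \<in> A \<Longrightarrow> jacobi_at u v w s f1 (f x)) \<Longrightarrow> jacobi_at u v w s f1 (\<Sum>x\<in>A. f x)"
  by (induction A rule: infinite_finite_induct) (simp_all add: jacobi_at_zero jacobi_at_add jacobi_at_add')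

lemma Sum_any_nat_eventually:
  fixes F :: "nat \<Rightarrow> 'v"
  assumes "finite {i. F i \<noteq> 0}"
  shows "\<forall>\<^sub>F n in sequentially. (\<Sum>i<n. F i) = Sum_any F"
proof -
  obtain n0 where "\<forall>i\<in>{i. F i \<noteq> 0}. i < n0"
    using assms finite_nat_set_iff_bounded by blast
  then have "Sum_any F = (\<Sum>i<n. F i)" if "n \<ge> n0" for n
    using that by (intro Sum_any.expand_superset) force+
  then show ?thesis unfolding eventually_sequentially by metis
qed

lemma eventually_Y_zero: "\<exists>n0. \<forall>i\<ge>n0. Y u (a + int i) v = 0"
proof -
  obtain N where "\<forall>j\<ge>N. Y u j v = 0" using truncation by blast
  then show ?thesis by (intro exI[of _ "nat (N - a)"]) auto
qed

lemma finite_nat_support: "(\<forall>i\<ge>n0. F i = 0) \<Longrightarrow> finite {i::nat. F i \<noteq> 0}"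
  by (rule finite_subset[of _ "{..<n0}"]) (auto simp: not_le[symmetric])

lemma jacobi_at_monomial: "jacobi_at u v w s (fls_X_intpow p) (fls_X_intpow q)"
proof -
  let ?L = "\<lambda>i. (of_int p gchoose i) *s Y (Y u (s + int i) v) (p + q - int i) w"
  let ?R = "\<lambda>i. ((- 1) ^ i * (of_int s gchoose i)) *s
         (Y u (p + s - int i) (Y v (q + int i) w)
           - ((- 1) powi s) *s Y v (q + s - int i) (Y u (p + int i) w))"
  have L: "iterate_term u v w s (fls_X_intpow p) (fls_X_intpow q) = ?L"
    by (rule ext) (simp only: iterate_term_def fls_taylor_X_intpow mult.assoc residue_const_mult
        fls_X_intpow_times_fls_X_intpow residue_X_intpow, simp add: algebra_simps)
  have R: "product_term u v w s (fls_X_intpow p) (fls_X_intpow q) = ?R"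
    by (rule ext) (simp only: product_term_def fls_X_intpow_times_fls_X_intpow residue_X_intpow,
        simp add: algebra_simps)
  obtain n1 n2 n3 where n: "\<forall>i\<ge>n1. Y u (s + int i) v = 0" "\<forall>i\<ge>n2. Y v (q + int i) w = 0"
      "\<forall>i\<ge>n3. Y u (p + int i) w = 0"
    using eventually_Y_zero[of u s v] eventually_Y_zero[of v q w] eventually_Y_zero[of u p w] by blast
  have "finite {i. ?L i \<noteq> 0}" "finite {i. ?R i \<noteq> 0}"
    using n by (intro finite_nat_support[of n1] finite_nat_support[of "max n2 n3"]; simp)+
  from this[THEN Sum_any_nat_eventually] show ?thesis
    unfolding jacobi_at_def L R by eventually_elim (simp only: jacobi)
qed

lemma fls_nth_times_X_intpow: "fls_nth (f * fls_X_intpow c) j = fls_nth (f :: complex fls) (j - c)"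
  by (simp add: fls_X_intpow_times_conv_shift)

text \<open>Both sides vanish termwise once \<open>f\<^sub>1\<close> (or \<open>f\<^sub>2\<close>) has a zero of high order.\<close>

lemma jacobi_at_tail1: "\<exists>N. \<forall>f1. (\<forall>j<N. fls_nth f1 j = 0) \<longrightarrow> jacobi_at u v w s f1 f2"
proof -
  obtain M where M: "\<And>j. j < M \<Longrightarrow> fls_nth f2 j = 0"
    by (meson fls_eq0_below_subdegree)
  obtain n1 where n1: "\<forall>i\<ge>n1. Y u (s + int i) v = 0" using eventually_Y_zero by blast
  obtain N1 where N1: "\<forall>i\<in>{..<n1}. \<forall>f. (\<forall>j<N1. fls_nth f j = 0) \<longrightarrow> residue (Y u (s + int i) v) w f = 0"
    using residue_cutoff_family[of "{..<n1}" "\<lambda>i. Y u (s + int i) v" "\<lambda>_. w"] by auto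
  obtain N2 where N2: "\<forall>f. (\<forall>j<N2. fls_nth f j = 0) \<longrightarrow> residue v w f = 0"
    using residue_cutoff by blast
  define n2 where "n2 = nat (N2 - M)"
  have n2: "residue v w (f2 * fls_X_intpow (int i)) = 0" if "i \<ge> n2" for i
    using N2[rule_format, of "f2 * fls_X_intpow (int i)"] M that
    unfolding fls_nth_times_X_intpow n2_def by auto
  obtain N3 where N3: "\<forall>i\<in>{..<n2}. \<forall>f. (\<forall>j<N3. fls_nth f j = 0) \<longrightarrow>
      residue u (residue v w (f2 * fls_X_intpow (int i))) f = 0"
    using residue_cutoff_family[of "{..<n2}" "\<lambda>_. u" "\<lambda>i. residue v w (f2 * fls_X_intpow (int i))"] by auto
  obtain N4 where N4: "\<forall>f. (\<forall>j<N4. fls_nth f j = 0) \<longrightarrow> residue u w f = 0"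
    using residue_cutoff by blast
  \<comment> \<open>One entry for each place where f1 occurs: fewer than n1 derivatives and the
    factor f2 of order at least M; the factor z^(s-i) with i < n2; and the inner residue of u on
    w.\<close>
  define N where "N = max (max (N1 - M + int n1) (N3 - s + int n2)) N4"
  have "jacobi_at u v w s f1 f2" if f1: "\<forall>j<N. fls_nth f1 j = 0" for f1
  proof -
    have "iterate_term u v w s f1 f2 i = 0" for i
    proof (cases "i < n1")
      case True
      have "fls_nth (fls_taylor i f1 * f2) j = 0" if "j < N1" for j
      proof (rule fls_mult_order[of "N - int i" _ M])
        show "fls_nth (fls_taylor i f1) j = 0" if "j < N - int i" for j
          using that f1 by (intro fls_taylor_order[of N]) auto
        show "j < N - int i + M" using that True by (simp add: N_def)
      qed (use M in auto)
      then show ?thesis using N1 True by (simp add: iterate_term_def)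
    qed (use n1 in \<open>simp add: iterate_term_def\<close>)
    moreover have "product_term u v w s f1 f2 i = 0" for i
    proof -
      have "residue u (residue v w (f2 * fls_X_intpow (int i))) (f1 * fls_X_intpow (s - int i)) = 0"
      proof (cases "i < n2")
        case True
        have "fls_nth (f1 * fls_X_intpow (s - int i)) j = 0" if "j < N3" for j
          using that True f1 unfolding fls_nth_times_X_intpow by (simp add: N_def)
        then show ?thesis using N3 True by blast
      qed (simp add: n2 del: fls_X_intpow_times_conv_shift)
      moreover have "residue u w (f1 * fls_X_intpow (int i)) = 0"
        using N4[rule_format, of "f1 * fls_X_intpow (int i)"] f1
        unfolding fls_nth_times_X_intpow by (simp add: N_def)
      ultimately show ?thesis by (simp only: product_term_def residue_zero_right) simp
    qed
    ultimately show ?thesis by (simp add: jacobi_at_def)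
  qed
  then show ?thesis by blast
qed

lemma jacobi_at_tail2: "\<exists>N. \<forall>f2. (\<forall>j<N. fls_nth f2 j = 0) \<longrightarrow> jacobi_at u v w s f1 f2"
proof -
  obtain M where M: "\<And>j. j < M \<Longrightarrow> fls_nth f1 j = 0"
    by (meson fls_eq0_below_subdegree)
  obtain n1 where n1: "\<forall>i\<ge>n1. Y u (s + int i) v = 0" using eventually_Y_zero by blast
  obtain N1 where N1: "\<forall>i\<in>{..<n1}. \<forall>f. (\<forall>j<N1. fls_nth f j = 0) \<longrightarrow> residue (Y u (s + int i) v) w f = 0"
    using residue_cutoff_family[of "{..<n1}" "\<lambda>i. Y u (s + int i) v" "\<lambda>_. w"] by auto
  obtain N2 where N2: "\<forall>f. (\<forall>j<N2. fls_nth f j = 0) \<longrightarrow> residue u w f = 0"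
    using residue_cutoff by blast
  define n2 where "n2 = nat (N2 - M)"
  have n2: "residue u w (f1 * fls_X_intpow (int i)) = 0" if "i \<ge> n2" for i
    using N2[rule_format, of "f1 * fls_X_intpow (int i)"] M that
    unfolding fls_nth_times_X_intpow n2_def by auto
  obtain N3 where N3: "\<forall>i\<in>{..<n2}. \<forall>f. (\<forall>j<N3. fls_nth f j = 0) \<longrightarrow>
      residue v (residue u w (f1 * fls_X_intpow (int i))) f = 0"
    using residue_cutoff_family[of "{..<n2}" "\<lambda>_. v" "\<lambda>i. residue u w (f1 * fls_X_intpow (int i))"] by auto
  obtain N4 where N4: "\<forall>f. (\<forall>j<N4. fls_nth f j = 0) \<longrightarrow> residue v w f = 0"
    using residue_cutoff by blast
  define N where "N = max (max (N1 - M + int n1) (N3 - s + int n2)) N4"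
  have "jacobi_at u v w s f1 f2" if f2: "\<forall>j<N. fls_nth f2 j = 0" for f2
  proof -
    have "iterate_term u v w s f1 f2 i = 0" for i
    proof (cases "i < n1")
      case True
      have "fls_nth (fls_taylor i f1 * f2) j = 0" if "j < N1" for j
      proof (rule fls_mult_order[of "M - int i" _ N])
        show "fls_nth (fls_taylor i f1) j = 0" if "j < M - int i" for j
          using that M by (intro fls_taylor_order[of M]) auto
        show "j < M - int i + N" using that True by (simp add: N_def)
      qed (use f2 in auto)
      then show ?thesis using N1 True by (simp add: iterate_term_def)
    qed (use n1 in \<open>simp add: iterate_term_def\<close>)
    moreover have "product_term u v w s f1 f2 i = 0" for i
    proof -
      have "residue v (residue u w (f1 * fls_X_intpow (int i))) (f2 * fls_X_intpow (s - int i)) = 0"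
      proof (cases "i < n2")
        case True
        have "fls_nth (f2 * fls_X_intpow (s - int i)) j = 0" if "j < N3" for j
          using that True f2 unfolding fls_nth_times_X_intpow by (simp add: N_def)
        then show ?thesis using N3 True by blast
      qed (simp add: n2 del: fls_X_intpow_times_conv_shift)
      moreover have "residue v w (f2 * fls_X_intpow (int i)) = 0"
        using N4[rule_format, of "f2 * fls_X_intpow (int i)"] f2
        unfolding fls_nth_times_X_intpow by (simp add: N_def)
      ultimately show ?thesis by (simp only: product_term_def residue_zero_right) simp
    qed
    ultimately show ?thesis by (simp add: jacobi_at_def)
  qed
  then show ?thesis by blast
qed

text \<open>The cutoff for f1 depends on f2 and conversely, so the two series cannot be truncated
  together: f1 is made arbitrary against a monomial f2, and only then is f2 decomposed.\<close>

lemma jacobi_at_all: "jacobi_at u v w s f1 f2"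
proof -
  have mono: "jacobi_at u v w s f1 (fls_X_intpow q)" for f1 q
  proof -
    obtain N where N: "\<forall>f1. (\<forall>j<N. fls_nth f1 j = 0) \<longrightarrow> jacobi_at u v w s f1 (fls_X_intpow q)"
      using jacobi_at_tail1 by blast
    obtain t where t: "f1 = (\<Sum>j\<in>{fls_subdegree f1..<N}. fls_const (fls_nth f1 j) * fls_X_intpow j) + t"
      "\<And>j. j < N \<Longrightarrow> fls_nth t j = 0" using fls_truncate_decomp[of f1 N] by blast
    show ?thesis
      by (subst t(1)) (intro jacobi_at_add jacobi_at_sum jacobi_at_const_mult jacobi_at_monomial N[rule_format] t(2))
  qed
  obtain N where N: "\<forall>f2. (\<forall>j<N. fls_nth f2 j = 0) \<longrightarrow> jacobi_at u v w s f1 f2"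
    using jacobi_at_tail2 by blast
  obtain t where t: "f2 = (\<Sum>j\<in>{fls_subdegree f2..<N}. fls_const (fls_nth f2 j) * fls_X_intpow j) + t"
    "\<And>j. j < N \<Longrightarrow> fls_nth t j = 0" using fls_truncate_decomp[of f2 N] by blast
  show ?thesis
    by (subst t(1)) (intro jacobi_at_add' jacobi_at_sum jacobi_at_const_mult mono N[rule_format] t(2))
qed

end

section \<open>Graded decompositions and weights\<close>

context vertex_operator_algebra
begin

definition graded_by :: "('i \<Rightarrow> 'v set) \<Rightarrow> 'i set \<Rightarrow> bool"
  where "graded_by W I \<longleftrightarrow> (\<forall>i\<in>I. subspace (W i)) \<and> (\<forall>u. \<exists>!c. is_decomposition W I u c)"

text \<open>The operator \<open>f\<close> minus \<open>lam a\<close> annihilates the term of a and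
  multiplies the other terms by nonzero scalars, which leaves a shorter relation.\<close>

lemma eigenvectors_independent:
  assumes f: "Vector_Spaces.linear scale scale f" and "finite F" "inj_on lam F"
    and "\<And>i. i \<in> F \<Longrightarrow> f (c i) = scale (lam i) (c i)" "(\<Sum>i\<in>F. c i) = 0" "i \<in> F"
  shows "c i = 0"
  using assms(2-)
proof (induction F arbitrary: c i)
  case (insert a F)
  interpret f: Vector_Spaces.linear scale scale f by (fact f)
  let ?d = "\<lambda>i. scale (lam i - lam a) (c i)"
  have "f (\<Sum>i\<in>insert a F. c i) - scale (lam a) (\<Sum>i\<in>insert a F. c i) = (\<Sum>i\<in>insert a F. ?d i)"
    using insert.prems(2) by (simp add: f.sum scale_sum_right sum_subtractf[symmetric]
        scale_left_diff_distrib del: sum.insert)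
  then have d: "(\<Sum>i\<in>F. ?d i) = 0" using insert.hyps insert.prems(3) by (simp add: f.zero)
  have *: "c i = 0" if "i \<in> F" for i
  proof -
    have "?d i = 0"
      using insert.prems(1,2) d that
      by (intro insert.IH[of ?d]) (auto simp: f.scale scale_left_commute)
    moreover have "lam i \<noteq> lam a" using insert.prems(1) insert.hyps that by (auto simp: inj_on_def)
    ultimately show ?thesis by simp
  qed
  then have "c a = 0" using insert.prems(3) insert.hyps by simp
  then show ?case using * insert.prems(4) by auto
qed simp

lemma is_decomposition_finite_sum:
  "is_decomposition W I u c \<Longrightarrow> finite F \<Longrightarrow> {i. c i \<noteq> 0} \<subseteq> F \<Longrightarrow> u = (\<Sum>i\<in>F. c i)"
  by (simp add: is_decomposition_def Sum_any.expand_superset)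

lemma eigen_decomposition_unique:
  assumes f: "Vector_Spaces.linear scale scale f" and inj: "inj_on lam I"
    and W: "\<And>i v. i \<in> I \<Longrightarrow> v \<in> W i \<Longrightarrow> f v = scale (lam i) v"
    and c: "is_decomposition W I u c" and d: "is_decomposition W I u d"
  shows "c = d"
proof
  fix i
  interpret f: Vector_Spaces.linear scale scale f by (fact f)
  let ?F = "{i. c i \<noteq> 0} \<union> {i. d i \<noteq> 0}"
  have fin: "finite ?F" and sub: "?F \<subseteq> I"
    using c d by (auto simp: is_decomposition_def)
  have "u = (\<Sum>i\<in>?F. c i)" by (rule is_decomposition_finite_sum[OF c fin]) simp
  moreover have "u = (\<Sum>i\<in>?F. d i)" by (rule is_decomposition_finite_sum[OF d fin]) simp
  ultimately have sum0: "(\<Sum>i\<in>?F. c i - d i) = 0" unfolding sum_subtractf by simp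
  have eig: "f (c j - d j) = scale (lam j) (c j - d j)" if "j \<in> ?F" for j
  proof -
    have j: "j \<in> I" using that sub by blast
    then have "c j \<in> W j" "d j \<in> W j"
      using c d by (auto simp: is_decomposition_def)
    then show ?thesis by (simp only: f.diff scale_right_diff_distrib W[OF j])
  qed
  have "c i - d i = 0" if "i \<in> ?F"
    by (rule eigenvectors_independent[OF f fin inj_on_subset[OF inj sub] eig sum0 that])
  moreover have "c i = d i" if "i \<notin> ?F" using that by simp
  ultimately show "c i = d i" by (metis eq_iff_diff_eq_0)
qed

lemma is_decomposition_add:
  assumes W: "\<And>i. i \<in> I \<Longrightarrow> subspace (W i)" and c: "is_decomposition W I u c" and d: "is_decomposition W I v d"
  shows "is_decomposition W I (u + v) (\<lambda>i. c i + d i)"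
proof -
  have "finite {i. c i + d i \<noteq> 0}"
    by (rule finite_subset[of _ "{i. c i \<noteq> 0} \<union> {i. d i \<noteq> 0}"]) (use c d in \<open>auto simp: is_decomposition_def\<close>)
  then show ?thesis
    using c d W by (auto simp: is_decomposition_def Sum_any.distrib subspace_add)
qed

lemma is_decomposition_scale:
  assumes W: "\<And>i. i \<in> I \<Longrightarrow> subspace (W i)" and c: "is_decomposition W I u c"
  shows "is_decomposition W I (scale a u) (\<lambda>i. scale a (c i))"
proof -
  have fin: "finite {i. c i \<noteq> 0}" using c by (simp add: is_decomposition_def)
  then have fin': "finite {i. scale a (c i) \<noteq> 0}" by (rule rev_finite_subset) auto
  have "Sum_any (\<lambda>i. scale a (c i)) = scale a (Sum_any c)"
    using fin by (subst (1 2) Sum_any.expand_superset[of "{i. c i \<noteq> 0}"]) (auto simp: scale_sum_right)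
  then show ?thesis
    using c W fin' unfolding is_decomposition_def by (auto simp: subspace_scale)
qed

lemma is_decomposition_mem:
  assumes "\<And>i. i \<in> I \<Longrightarrow> subspace (W i)" "i \<in> I" "v \<in> W i"
  shows "is_decomposition W I v (\<lambda>j. if j = i then v else 0)"
proof -
  have "finite {j. (if j = i then v else 0) \<noteq> 0}" by (rule finite_subset[of _ "{i}"]) auto
  then show ?thesis using assms by (auto simp: is_decomposition_def subspace_0)
qed

lemma decomposition_exists:
  assumes W: "\<And>i. i \<in> I \<Longrightarrow> subspace (W i)" and sp: "span (\<Union>i\<in>I. W i) = UNIV"
  shows "\<exists>c. is_decomposition W I u c"
proof -
  have "u \<in> span (\<Union>i\<in>I. W i)" using sp by simp
  then show ?thesis
  proof (induction rule: span_induct_alt)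
    case base
    have "is_decomposition W I 0 (\<lambda>_. 0)" using W by (auto simp: is_decomposition_def subspace_0)
    then show ?case by blast
  next
    case (step a x y)
    then obtain i c where "i \<in> I" "x \<in> W i" "is_decomposition W I y c" by blast
    then show ?case
      by (metis is_decomposition_add is_decomposition_scale is_decomposition_mem W)
  qed
qed

text \<open>Serves both gradings: by weight, for \<open>L 0\<close> with integer eigenvalues, and by
  the eigenvalues of an automorphism.\<close>

lemma graded_by_eigen:
  assumes "Vector_Spaces.linear scale scale f" "inj_on lam I"
    "\<And>i v. i \<in> I \<Longrightarrow> v \<in> W i \<longleftrightarrow> f v = scale (lam i) v" "span (\<Union>i\<in>I. W i) = UNIV"
  shows "graded_by W I"
proof -
  interpret f: Vector_Spaces.linear scale scale f by (fact assms)
  have W: "subspace (W i)" if "i \<in> I" for i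
    using assms(3)[OF that] by (auto simp: subspace_def f.add f.scale f.zero scale_right_distrib mult.commute)
  then show ?thesis
    using decomposition_exists[OF W assms(4)] eigen_decomposition_unique[OF assms(1,2), of W] assms(3)
    unfolding graded_by_def by blast
qed

lemma graded_by_decomposition:
  assumes "graded_by W I"
  shows "is_decomposition W I u (\<lambda>i. component W I i u)"
  using assms theI'[of "is_decomposition W I u"] by (simp add: graded_by_def component_def)

lemma component_eqI: "graded_by W I \<Longrightarrow> is_decomposition W I u c \<Longrightarrow> component W I i u = c i"
  unfolding component_def graded_by_def by (metis the1_equality)

lemma component_in: "graded_by W I \<Longrightarrow> i \<in> I \<Longrightarrow> component W I i u \<in> W i"
  using graded_by_decomposition[of W I u] by (simp add: is_decomposition_def)

lemma component_finite: "graded_by W I \<Longrightarrow> finite {i. component W I i u \<noteq> 0}"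
  using graded_by_decomposition[of W I u] by (simp add: is_decomposition_def)

lemma component_add: "graded_by W I \<Longrightarrow> component W I i (u + v) = component W I i u + component W I i v"
  by (rule component_eqI, assumption, rule is_decomposition_add)
     (auto simp: graded_by_decomposition, auto simp: graded_by_def)

lemma component_scale: "graded_by W I \<Longrightarrow> component W I i (scale a u) = scale a (component W I i u)"
  by (rule component_eqI, assumption, rule is_decomposition_scale)
     (auto simp: graded_by_decomposition, auto simp: graded_by_def)

lemma component_mem:
  "graded_by W I \<Longrightarrow> j \<in> I \<Longrightarrow> u \<in> W j \<Longrightarrow> component W I i u = (if i = j then u else 0)"
  by (rule component_eqI, assumption, rule is_decomposition_mem) (auto simp: graded_by_def)

lemma component_zero: "graded_by W I \<Longrightarrow> component W I i 0 = 0"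
  using component_scale[of W I i 0 0] by simp

lemma sum_component: "graded_by W I \<Longrightarrow> finite I \<Longrightarrow> (\<Sum>i\<in>I. component W I i u) = u"
  using is_decomposition_finite_sum[OF graded_by_decomposition[of W I u], of I]
    graded_by_decomposition[of W I u] by (metis (mono_tags, lifting) is_decomposition_def mem_Collect_eq subsetI)

section \<open>Cosets of a subspace\<close>

lemma coset_eq_iff: "subspace W \<Longrightarrow> coset W u = coset W v \<longleftrightarrow> u - v \<in> W"
proof
  assume W: "subspace W" and "coset W u = coset W v"
  then have "u \<in> coset W v" by (force simp: coset_def dest: subspace_0)
  then show "u - v \<in> W" by (auto simp: coset_def)
next
  assume W: "subspace W" and uv: "u - v \<in> W"
  show "coset W u = coset W v"
  proof (auto simp: coset_def)
    fix w assume "w \<in> W"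
    then show "u + w \<in> (+) v ` W"
      using subspace_add[OF W uv] by (intro image_eqI[of _ _ "u - v + w"]) auto
    show "v + w \<in> (+) u ` W"
      using subspace_diff[OF W \<open>w \<in> W\<close> uv] by (intro image_eqI[of _ _ "w - (u - v)"]) auto
  qed
qed

lemma mem_coset: "subspace W \<Longrightarrow> u \<in> coset W u"
  by (force simp: coset_def dest: subspace_0)

lemma mem_coset_iff: "a \<in> coset W u \<longleftrightarrow> a - u \<in> W"
  by (force simp: coset_def)

section \<open>Weight spaces and the operators L(-1) and L(0)\<close>

lemma L_linear: "Vector_Spaces.linear scale scale (L m)"
  unfolding L_def by (rule Y_linear_right)

lemmas L_add = module_hom.add[OF L_linear[unfolded linear_iff_module_hom]]
  and L_scale = module_hom.scale[OF L_linear[unfolded linear_iff_module_hom]]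
  and L_zero [simp] = module_hom.zero[OF L_linear[unfolded linear_iff_module_hom]]
  and L_sum = module_hom.sum[OF L_linear[unfolded linear_iff_module_hom]]

lemma graded_by_wt: "graded_by wt_space UNIV"
proof (rule graded_by_eigen[OF L_linear[of 0], of of_int])
  have "(\<Union>i. wt_space i) = (\<Union>k::int. {v. Y om 1 v = of_int k *s v})"
    by (simp add: wt_space_def L_def)
  then show "span (\<Union>i\<in>UNIV. wt_space i) = UNIV" by (simp add: grading)
qed (auto simp: wt_space_def inj_on_def)

text \<open>The Jacobi identity at s = 0, where the expansion of (z1-z2)^s has a single term. For u
  = \<open>om\<close> the cases p = 0 and p = 1 give the brackets with L(-1) and L(0).\<close>

lemma jacobi_commutator:
  "Sum_any (\<lambda>i::nat. (of_int p gchoose i) *s Y (Y u (int i) v) (p + q - int i) w) =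
    Y u p (Y v q w) - Y v q (Y u p w)"
proof -
  have "Sum_any (\<lambda>i::nat. ((- 1) ^ i * ((of_int 0 :: complex) gchoose i)) *s
         (Y u (p + 0 - int i) (Y v (q + int i) w)
           - ((- 1) powi 0) *s Y v (q + 0 - int i) (Y u (p + int i) w))) =
    Sum_any (\<lambda>i::nat. if i = 0 then Y u p (Y v q w) - Y v q (Y u p w) else 0)"
    by (rule Sum_any.cong) (auto simp: gbinomial_0_left)
  then show ?thesis using jacobi[of p u 0 v q w] by simp
qed

lemma L_minus_1_derivation: "L (- 1) (Y v q w) = Y (L (- 1) v) q w + Y v q (L (- 1) w)"
proof -
  have "Sum_any (\<lambda>i::nat. (of_int 0 gchoose i) *s Y (Y om (int i) v) (0 + q - int i) w) =
      Sum_any (\<lambda>i::nat. if i = 0 then Y (Y om 0 v) q w else 0)"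
    by (rule Sum_any.cong) (auto simp: gbinomial_0_left)
  then show ?thesis using jacobi_commutator[of 0 om v q w] by (simp add: L_def algebra_simps)
qed

lemma Y_L_minus_1: "Y (L (- 1) u) j v = - (of_int j *s Y u (j - 1) v)"
  using translation by (simp add: L_def)

lemma L_0_Y: "L 0 (Y v q w) = Y (L 0 v) q w + Y v q (L 0 w) - of_int (q + 1) *s Y v q w"
proof -
  have "Sum_any (\<lambda>i::nat. (of_int 1 gchoose i) *s Y (Y om (int i) v) (1 + q - int i) w) =
      (\<Sum>i\<in>{0,1}. (of_int 1 gchoose i) *s Y (Y om (int i) v) (1 + q - int i) w)"
  proof (rule Sum_any.expand_superset)
    have *: "(1::complex) gchoose a = 0" if "a \<notin> {0, 1}" for a
      using binomial_gbinomial[of 1 a, where 'a=complex] that by (cases a) (simp_all add: binomial_eq_0)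
    show "{a. (of_int 1 gchoose a) *s Y (Y om (int a) v) (1 + q - int a) w \<noteq> 0} \<subseteq> {0,1}"
    proof
      fix a assume "a \<in> {a. (of_int 1 gchoose a) *s Y (Y om (int a) v) (1 + q - int a) w \<noteq> 0}"
      then show "a \<in> {0,1}" using *[of a] by (cases "a \<in> {0,1}") simp_all
    qed
  qed simp
  then have "Y (Y om 0 v) (1 + q) w + Y (Y om 1 v) q w = Y om 1 (Y v q w) - Y v q (Y om 1 w)"
    using jacobi_commutator[of 1 om v q w] by simp
  then have "Y om 1 (Y v q w) = Y (Y om 0 v) (1 + q) w + Y (Y om 1 v) q w + Y v q (Y om 1 w)"
    by (simp add: algebra_simps)
  moreover have "Y (Y om 0 v) (1 + q) w = - (of_int (q + 1) *s Y v q w)"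
    using Y_L_minus_1[of v "1 + q" w] by (simp add: L_def add.commute)
  ultimately show ?thesis by (simp add: L_def)
qed

lemma wt_Y: "u \<in> wt_space k \<Longrightarrow> v \<in> wt_space k' \<Longrightarrow> Y u j v \<in> wt_space (k + k' - j - 1)"
  by (simp add: wt_space_def L_0_Y Y_scale_left Y_scale_right algebra_simps)

lemma wt_L_minus_1:
  assumes "v \<in> wt_space k"
  shows "L (- 1) v \<in> wt_space (k + 1)"
proof -
  obtain c where "\<forall>m n v. Y om (m + 1) (Y om (n + 1) v) - Y om (n + 1) (Y om (m + 1) v) =
         of_int (m - n) *s Y om (m + n + 1) v
         + (if m + n = 0 then ((of_int m ^ 3 - of_int m) / 12 * c) *s v else 0)"
    using virasoro by blast
  \<comment> \<open>Since 0 + (-1) is not 0, the central term is absent.\<close>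
  from this[rule_format, of 0 "- 1" v] have "L 0 (L (- 1) v) = L (- 1) (L 0 v) + L (- 1) v"
    by (simp add: L_def algebra_simps)
  then show ?thesis using assms by (simp add: wt_space_def L_scale algebra_simps)
qed

text \<open>Integration by parts: Y(L(-1)u,z) is the derivative of Y(u,z).\<close>

lemma residue_L_minus_1: "residue (L (- 1) u) v f = - residue u v (fls_deriv f)"
proof -
  obtain N where N: "\<And>j. j \<ge> N \<Longrightarrow> Y u j v = 0" using truncation by blast
  obtain M where M: "\<And>j. j < M \<Longrightarrow> fls_nth f j = 0" by (meson fls_eq0_below_subdegree)
  have "residue (L (- 1) u) v f = (\<Sum>j\<in>{M..<N + 1}. fls_nth f j *s Y (L (- 1) u) j v)"
    using N M by (intro residue_eq_sum) (auto simp: Y_L_minus_1)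
  also have "\<dots> = - (\<Sum>j\<in>{M..<N + 1}. (of_int j * fls_nth f j) *s Y u (j - 1) v)"
    by (simp add: Y_L_minus_1 sum_negf mult.commute)
  also have "(\<Sum>j\<in>{M..<N + 1}. (of_int j * fls_nth f j) *s Y u (j - 1) v) =
      (\<Sum>j\<in>{M - 1..<N}. fls_nth (fls_deriv f) j *s Y u j v)"
    by (rule sum.reindex_bij_witness[of _ "\<lambda>j. j + 1" "\<lambda>j. j - 1"]) auto
  also have "\<dots> = residue u v (fls_deriv f)"
    using N M by (intro residue_eq_sum[symmetric]) auto
  finally show ?thesis .
qed

lemma residue_binomial:
  "\<forall>\<^sub>F n in sequentially. residue u v (binomial_laurent a b) = (\<Sum>i<n. (a gchoose i) *s Y u (b + int i) v)"
proof -
  obtain n0 where n0: "\<forall>i\<ge>n0. Y u (b + int i) v = 0" using eventually_Y_zero by blast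
  have "residue u v (binomial_laurent a b) = (\<Sum>i<n. (a gchoose i) *s Y u (b + int i) v)" if "n \<ge> n0" for n
  proof -
    have "residue u v (binomial_laurent a b) =
        (\<Sum>j\<in>{b..<b + int n}. fls_nth (binomial_laurent a b) j *s Y u j v)"
    proof (rule residue_eq_sum)
      fix j assume "j \<ge> b + int n"
      then show "Y u j v = 0" using n0[rule_format, of "nat (j - b)"] that by simp
    qed (simp add: binomial_laurent_nth)
    also have "\<dots> = (\<Sum>i<n. (a gchoose i) *s Y u (b + int i) v)"
      by (rule sum.reindex_bij_witness[of _ "\<lambda>i. b + int i" "\<lambda>j. nat (j - b)"])
         (auto simp: binomial_laurent_nth)
    finally show ?thesis .
  qed
  then show ?thesis unfolding eventually_sequentially by blast
qed

end

section \<open>Eigenspaces of an automorphism\<close>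

context vertex_operator_algebra
begin

lemma component_commute:
  assumes W: "graded_by W I" and A: "Vector_Spaces.linear scale scale A"
    and AW: "\<And>i v. i \<in> I \<Longrightarrow> v \<in> W i \<Longrightarrow> A v \<in> W i"
  shows "component W I i (A u) = A (component W I i u)"
proof (rule component_eqI[OF W])
  interpret A: Vector_Spaces.linear scale scale A by (fact A)
  let ?c = "\<lambda>i. component W I i u"
  have fin: "finite {i. ?c i \<noteq> 0}" using W by (rule component_finite)
  have sub: "{i. A (?c i) \<noteq> 0} \<subseteq> {i. ?c i \<noteq> 0}" by (auto simp: A.zero)
  have "A u = A (\<Sum>i\<in>{i. ?c i \<noteq> 0}. ?c i)"
    using is_decomposition_finite_sum[OF graded_by_decomposition[OF W, of u] fin] by simp
  also have "\<dots> = Sum_any (\<lambda>i. A (?c i))"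
    by (simp only: A.sum Sum_any.expand_superset[OF fin sub])
  finally have "A u = Sum_any (\<lambda>i. A (?c i))" .
  moreover have "?c i = 0" if "i \<notin> I" for i
    using graded_by_decomposition[OF W, of u] that by (auto simp: is_decomposition_def)
  ultimately show "is_decomposition W I (A u) (\<lambda>i. A (?c i))"
    using AW component_in[OF W] finite_subset[OF sub fin] by (simp add: is_decomposition_def A.zero)
qed

text \<open>Indexed by rationals instead of residues r < T. The eigenvalue of a mode u_j v is then
  the phase of a sum, with no reduction modulo T, and the same rational can serve as an exponent of
  1+z.\<close>

definition phase :: "rat \<Rightarrow> complex"
  where "phase q = cis (- 2 * pi * of_rat q)"

lemma phase_add: "phase (p + q) = phase p * phase q"
  by (simp add: phase_def cis_mult of_rat_add algebra_simps)

lemma phase_eq_1_iff: "phase q = 1 \<longleftrightarrow> q \<in> \<int>"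
proof
  assume "phase q = 1"
  then obtain m :: int where "(of_rat q :: real) = of_int m"
    by (auto simp: phase_def complex_eq_iff cos_one_2pi_int)
  then have "(of_rat q :: real) = of_rat (of_int m)" by simp
  then have "q = of_int m" by (simp only: of_rat_eq_iff)
  then show "q \<in> \<int>" by (metis Ints_of_int)
next
  assume "q \<in> \<int>"
  then obtain m :: int where "q = of_int m" by (auto elim: Ints_cases)
  then have "- 2 * pi * of_rat q = 2 * pi * of_int (- m)" by simp
  then show "phase q = 1" unfolding phase_def by (simp only: cis_multiple_2pi[OF Ints_of_int])
qed

lemma phase_0 [simp]: "phase 0 = 1"
  by (simp add: phase_def)

lemma phase_nonzero [simp]: "phase q \<noteq> 0"
  by (simp add: phase_def)

lemma phase_cong: "p - q \<in> \<int> \<Longrightarrow> phase p = phase q"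
  using phase_add[of q "p - q"] phase_eq_1_iff[of "p - q"] by simp

lemma phase_of_nat_mult: "phase (of_nat m * q) = phase q ^ m"
  by (induction m) (simp_all add: algebra_simps phase_add)

end

locale zhu_data = vertex_operator_algebra scale Y vac om
  for scale :: "complex \<Rightarrow> 'v::ab_group_add \<Rightarrow> 'v" (infixr "*s" 75) and Y vac om +
  fixes T :: nat and g :: "'v \<Rightarrow> 'v"
  assumes T_pos: "T > 0" and g_aut: "g \<in> carrier aut_group" and g_pow: "g ^^ T = id"
begin

lemma g_linear: "Vector_Spaces.linear scale scale g"
  using g_aut by (simp add: aut_group_def)

sublocale g: Vector_Spaces.linear scale scale g by (fact g_linear)

lemma g_Y: "g (Y u j v) = Y (g u) j (g v)" and g_vac [simp]: "g vac = vac" and g_om [simp]: "g om = om"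
  using g_aut by (auto simp: aut_group_def)

definition eig :: "rat \<Rightarrow> 'v set"
  where "eig q = {u. g u = phase q *s u}"

lemma eigenspace_eq: "eigenspace T g r = eig (of_nat r / of_nat T)"
proof -
  have "exp (- 2 * of_real pi * \<i> * of_nat r / of_nat T) = phase (of_nat r / of_nat T)"
    by (simp add: phase_def cis_conv_exp of_rat_divide field_simps)
  then show ?thesis by (simp add: eigenspace_def eig_def)
qed

lemma eig_cong: "p - q \<in> \<int> \<Longrightarrow> eig p = eig q"
  by (simp add: eig_def phase_cong)

lemma subspace_eig: "subspace (eig q)"
  by (auto simp: eig_def subspace_def g.add g.scale scale_right_distrib mult.commute)

lemma eig_Y: "u \<in> eig p \<Longrightarrow> v \<in> eig q \<Longrightarrow> Y u j v \<in> eig (p + q)"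
  by (simp add: eig_def g_Y Y_scale_left Y_scale_right phase_add mult.commute)

lemma eig_L: "v \<in> eig q \<Longrightarrow> L m v \<in> eig q"
  by (simp add: eig_def L_def g_Y Y_scale_right)

lemma vac_eig: "vac \<in> eig 0"
  by (simp add: eig_def)

lemma residue_index:
  fixes q :: rat
  assumes "of_nat T * q \<in> \<int>"
  obtains r where "r < T" "q - of_nat r / of_nat T \<in> \<int>"
proof -
  obtain m :: int where m: "of_nat T * q = of_int m" using assms by (auto elim: Ints_cases)
  have "q - of_nat (nat (m mod int T)) / of_nat T = of_int (m div int T)"
  proof -
    have "of_int m = (of_int (m div int T) * of_nat T + of_int (m mod int T) :: rat)"
      by (metis div_mult_mod_eq of_int_add of_int_mult of_int_of_nat_eq)
    moreover have "q = of_int m / of_nat T" using m T_pos by (simp add: field_simps)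
    ultimately have "q = of_int (m div int T) + of_int (m mod int T) / of_nat T"
      using T_pos by (simp only: add_divide_distrib) simp
    then show ?thesis using T_pos by simp
  qed
  then show thesis using T_pos by (intro that[of "nat (m mod int T)"]) (auto simp: nat_less_iff)
qed

text \<open>Discrete Fourier transform along the orbit of u. The sums \<open>p r\<close> are
  eigenvectors because applying \<open>g\<close> shifts a cyclic summation, and they add up to T u
  because the geometric sums of nontrivial T-th roots of unity vanish.\<close>

lemma span_eigenspaces: "span (\<Union>r\<in>{..<T}. eigenspace T g r) = UNIV"
proof -
  define w where "w = phase (- 1 / of_nat T)"
  have wT: "w ^ T = 1"
    using T_pos by (simp add: w_def phase_of_nat_mult[symmetric] phase_eq_1_iff)
  have "u \<in> span (\<Union>r\<in>{..<T}. eigenspace T g r)" for u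
  proof -
    define p where "p r = (\<Sum>j<T. w ^ (r * j) *s (g ^^ j) u)" for r
    have "p r \<in> eigenspace T g r" for r
    proof -
      define h where "h j = w ^ (r * j) *s (g ^^ j) u" for j
      have "w ^ (r * T) = 1" by (metis mult.commute power_mult power_one wT)
      then have "h T = h 0" by (simp add: h_def g_pow)
      then have "(\<Sum>j<T. h (Suc j)) = (\<Sum>j<T. h j)"
        using sum.lessThan_Suc_shift[of h T] by simp
      moreover have "h (Suc j) = w ^ r *s g (h j)" for j
        by (simp add: h_def g.scale power_add)
      moreover have "p r = (\<Sum>j<T. h j)" by (simp add: p_def h_def)
      ultimately have "p r = w ^ r *s g (p r)"
        by (simp add: g.sum scale_sum_right)
      moreover have "w ^ r * phase (of_nat r / of_nat T) = 1"
        by (simp add: w_def phase_of_nat_mult[symmetric] phase_add[symmetric])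
      ultimately have "g (p r) = phase (of_nat r / of_nat T) *s p r"
        by (metis mult.commute scale_one scale_scale)
      then show ?thesis by (simp add: eigenspace_eq eig_def)
    qed
    then have "(\<Sum>r<T. p r) \<in> span (\<Union>r\<in>{..<T}. eigenspace T g r)"
      by (intro span_sum) (auto intro: span_base)
    moreover have "(\<Sum>r<T. p r) = of_nat T *s u"
    proof -
      have geo: "(\<Sum>r<T. w ^ (r * j)) = (if j = 0 then of_nat T else 0)" if "j < T" for j
      proof (cases "j = 0")
        case False
        have "of_nat j * (- 1 / of_nat T) \<notin> (\<int> :: rat set)"
        proof
          assume "of_nat j * (- 1 / of_nat T) \<in> (\<int> :: rat set)"
          then obtain m :: int where "of_nat j * (- 1 / of_nat T) = (of_int m :: rat)" by (rule Ints_cases)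
          then have "of_int (int j) = (of_int (- m * int T) :: rat)" using T_pos by (simp add: field_simps)
          then have "int j = - m * int T" by (simp only: of_int_eq_iff)
          then have "T dvd j" by (metis dvd_triv_right int_dvd_int_iff)
          then show False using that False by (auto dest: dvd_imp_le)
        qed
        then have "w ^ j \<noteq> 1" by (simp add: w_def phase_of_nat_mult[symmetric] phase_eq_1_iff)
        moreover have "(w ^ j) ^ T = 1" by (metis mult.commute power_mult power_one wT)
        ultimately show ?thesis
          using False by (simp add: mult.commute[of _ j] power_mult geometric_sum)
      qed simp
      have "(\<Sum>r<T. p r) = (\<Sum>j<T. (\<Sum>r<T. w ^ (r * j)) *s (g ^^ j) u)"
        unfolding p_def by (subst sum.swap) (simp add: scale_sum_left)
      also have "\<dots> = (\<Sum>j<T. if j = 0 then of_nat T *s u else 0)"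
        by (rule sum.cong) (simp_all add: geo)
      also have "\<dots> = of_nat T *s u" using T_pos by simp
      finally show ?thesis .
    qed
    ultimately have "(1 / of_nat T) *s of_nat T *s u \<in> span (\<Union>r\<in>{..<T}. eigenspace T g r)"
      by (simp only: span_scale)
    then show ?thesis using T_pos by simp
  qed
  then show ?thesis by blast
qed

lemma phase_inj: "inj_on (\<lambda>r. phase (of_nat r / of_nat T)) {..<T}"
proof (rule inj_onI)
  fix r s assume rs: "r \<in> {..<T}" "s \<in> {..<T}" and eq: "phase (of_nat r / of_nat T) = phase (of_nat s / of_nat T)"
  then have "phase (of_nat r / of_nat T - of_nat s / of_nat T) = 1"
    using phase_add[of "of_nat r / of_nat T - of_nat s / of_nat T" "of_nat s / of_nat T"] by simp
  then obtain m :: int where "of_nat r / of_nat T - of_nat s / of_nat T = (of_int m :: rat)"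
    unfolding phase_eq_1_iff by (rule Ints_cases)
  then have "of_int (int r - int s) = (of_int (m * int T) :: rat)" using T_pos by (simp add: field_simps)
  then have m: "int r - int s = m * int T" by (simp only: of_int_eq_iff)
  have "m < 1" using m rs T_pos by (smt (verit) lessThan_iff mult_le_cancel_right1 of_nat_0_le_iff of_nat_0_less_iff of_nat_less_iff)
  moreover have "m > - 1"
  proof (rule ccontr)
    assume "\<not> m > - 1"
    then have "m * int T \<le> - 1 * int T" by (intro mult_right_mono) auto
    then show False using m rs by auto
  qed
  ultimately have "m = 0" by simp
  then show "r = s" using m by simp
qed

lemma graded_by_eigenspace: "graded_by (eigenspace T g) {..<T}"
  by (rule graded_by_eigen[OF g_linear phase_inj _ span_eigenspaces]) (simp add: eigenspace_eq eig_def)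

lemma eigencomponent_in_eig: "r < T \<Longrightarrow> eigencomponent T g r u \<in> eig (of_nat r / of_nat T)"
  using component_in[OF graded_by_eigenspace, of r u] by (simp add: eigenspace_eq)

text \<open>As \<open>g\<close> fixes \<open>om\<close>, the operator \<open>L 0\<close> preserves
  the eigenspaces and commutes with the projections onto them.\<close>

lemma eigencomponent_wt: "u \<in> wt_space k \<Longrightarrow> eigencomponent T g r u \<in> wt_space k"
  using component_commute[OF graded_by_eigenspace L_linear, of 0 r u]
    component_scale[OF graded_by_eigenspace, of r "of_int k" u]
  by (simp add: wt_space_def eigenspace_eq eig_L)

lemma eigencomponent_eig:
  "r < T \<Longrightarrow> u \<in> eig (of_nat r / of_nat T) \<Longrightarrow> s < T \<Longrightarrow>
    eigencomponent T g s u = (if s = r then u else 0)"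
  using component_mem[OF graded_by_eigenspace, of r u s] by (simp add: eigenspace_eq)

lemma eigencomponent_0_eig:
  assumes "u \<in> eig q" "of_nat T * q \<in> \<int>"
  shows "eigencomponent T g 0 u = (if q \<in> \<int> then u else 0)"
proof -
  obtain r where r: "r < T" "q - of_nat r / of_nat T \<in> \<int>" using assms(2) by (rule residue_index)
  have "u \<in> eig (of_nat r / of_nat T)" using assms(1) eig_cong[OF r(2)] by simp
  then have "eigencomponent T g 0 u = (if r = 0 then u else 0)"
    using eigencomponent_eig[OF r(1)] T_pos by auto
  moreover have "r = 0 \<longleftrightarrow> q \<in> \<int>"
  proof
    assume "q \<in> \<int>"
    then have "of_nat r / of_nat T \<in> (\<int> :: rat set)"
      using r(2) by (metis Ints_diff diff_diff_eq2 add_diff_cancel_left')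
    then show "r = 0" using inj_onD[OF phase_inj, of r 0] r(1) T_pos phase_eq_1_iff by simp
  qed (use r in simp)
  ultimately show ?thesis by simp
qed

definition homogeneous :: "int \<Rightarrow> rat \<Rightarrow> 'v set"
  where "homogeneous k q = wt_space k \<inter> eig q"

lemma span_homogeneous:
  "u \<in> span (\<Union>k. \<Union>r\<in>{..<T}. homogeneous k (of_nat r / of_nat T))" (is "u \<in> span ?H")
proof -
  have "v \<in> span ?H" if "v \<in> wt_space k" for v k
  proof -
    have "(\<Sum>r<T. eigencomponent T g r v) \<in> span ?H"
      using eigencomponent_in_eig eigencomponent_wt[OF that]
      by (intro span_sum span_base) (auto simp: homogeneous_def)
    then show ?thesis using sum_component[OF graded_by_eigenspace, of v] by simp
  qed
  then have "(\<Union>k. wt_space k) \<subseteq> span ?H" by auto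
  then have "span (\<Union>k. wt_space k) \<subseteq> span ?H" by (rule span_minimal) (rule subspace_span)
  moreover have "span (\<Union>k. wt_space k) = UNIV" using grading by (simp add: wt_space_def L_def)
  ultimately show ?thesis by auto
qed

lemma homogeneous_induct:
  assumes "subspace {u. P u}"
    and "\<And>u k q. u \<in> homogeneous k q \<Longrightarrow> of_nat T * q \<in> \<int> \<Longrightarrow> P u"
  shows "P u"
proof -
  have "span (\<Union>k. \<Union>r\<in>{..<T}. homogeneous k (of_nat r / of_nat T)) \<subseteq> {u. P u}"
    using assms T_pos by (intro span_minimal) auto
  then show ?thesis using span_homogeneous[of u] by blast
qed

lemma homogeneous_Y:
  "u \<in> homogeneous k p \<Longrightarrow> v \<in> homogeneous k' q \<Longrightarrow> Y u j v \<in> homogeneous (k + k' - j - 1) (p + q)"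
  by (simp add: homogeneous_def wt_Y eig_Y)

lemma homogeneous_L_minus_1: "u \<in> homogeneous k q \<Longrightarrow> L (- 1) u \<in> homogeneous (k + 1) q"
  by (simp add: homogeneous_def wt_L_minus_1 eig_L)

end

section \<open>The subspace O and the product\<close>

context vertex_operator_algebra
begin

text \<open>Arranged so that all residues on the right have the same exponent a of 1+z. Read as a
  recursion, it reaches pole order one higher, at the price of replacing u by L(-1)u.\<close>

lemma residue_L_minus_1_binomial:
  "residue (L (- 1) u) v (binomial_laurent (a + 1) b) = - ((a + 1) *s residue u v (binomial_laurent a b) +
    of_int b *s (residue u v (binomial_laurent a b) + residue u v (binomial_laurent a (b - 1))))"
proof -
  have "binomial_laurent (a + 1) (b - 1) = binomial_laurent a b + binomial_laurent a (b - 1)"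
    using binomial_laurent_pascal[of a "b - 1"] by (simp add: add.commute)
  then show ?thesis
    by (simp only: residue_L_minus_1 binomial_laurent_deriv residue_add residue_const_mult add_diff_cancel_right')
qed

end

locale zhu_level = zhu_data scale Y vac om T g
  for scale :: "complex \<Rightarrow> 'v::ab_group_add \<Rightarrow> 'v" (infixr "*s" 75) and Y vac om T g +
  fixes n :: rat
  assumes n_nonneg: "n \<ge> 0" and n_T: "of_nat T * n \<in> \<int>"
begin

lemma level_index: "n = of_nat (level n) + of_nat (frac_index T n) / of_nat T" "frac_index T n < T"
proof -
  have l: "of_nat (level n) = (of_int \<lfloor>n\<rfloor> :: rat)" using n_nonneg by (simp add: level_def)
  have "of_nat T * frac n = of_nat T * n - of_int (int T * \<lfloor>n\<rfloor>)"
    by (simp add: frac_def algebra_simps)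
  then have "of_nat T * frac n \<in> \<int>" using n_T by (metis Ints_diff Ints_of_int)
  then have i: "of_nat (frac_index T n) = of_nat T * frac n"
    by (simp add: frac_index_def frac_ge_0 of_nat_nat)
  then show "n = of_nat (level n) + of_nat (frac_index T n) / of_nat T"
    using T_pos l by (simp add: frac_def)
  have "of_nat T * frac n < of_nat T * (1::rat)"
    using T_pos frac_lt_1 by (intro mult_strict_left_mono) auto
  then have "of_nat (frac_index T n) < (of_nat T :: rat)" using i by simp
  then show "frac_index T n < T" by (simp only: of_nat_less_iff)
qed

text \<open>The exponents of \<open>(1+z)\<close> and \<open>z\<close> in \<open>zhu_circ\<close>: \<open>top_exp r\<close> is the least element of \<open>r/T + \<int>\<close>
  above \<open>n\<close>, and \<open>top_exp r - pole_order r\<close> is the greatest one below \<open>-n\<close>.\<close>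

definition top_exp :: "nat \<Rightarrow> rat"
  where "top_exp r = of_nat (delta (frac_index T n) r) + of_nat (level n) + of_nat r / of_nat T"

definition pole_order :: "nat \<Rightarrow> nat"
  where "pole_order r = 2 * level n + delta (frac_index T n) r + delta (frac_index T n) (T - r) + 1"

lemma top_exp_bounds: 
  assumes "r < T"
  shows "top_exp r > n" "top_exp r \<le> n + 1" "top_exp r - of_nat (pole_order r) < - n"
    "top_exp r - of_nat (pole_order r) \<ge> - n - 1"
proof -
  define i l where "i = frac_index T n" and "l = level n"
  have n: "n = of_nat l + of_nat i / of_nat T" and i: "i < T"
    using level_index by (simp_all add: i_def l_def)
  have T: "(0::rat) < of_nat T" using T_pos by simp
  have r1: "(of_nat r::rat) / of_nat T < 1" and i1: "(of_nat i::rat) / of_nat T < 1"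
    using assms i T by simp_all
  have r0: "(0::rat) \<le> of_nat r / of_nat T" "(0::rat) \<le> of_nat i / of_nat T" by simp_all
  have le: "(of_nat a::rat) / of_nat T \<le> of_nat b / of_nat T \<longleftrightarrow> a \<le> b" for a b
    using T by (simp add: divide_le_cancel)
  have lt: "(of_nat a::rat) / of_nat T < of_nat b / of_nat T \<longleftrightarrow> a < b" for a b
    using T by (simp add: divide_less_cancel)
  have Tr: "(of_nat (T - r)::rat) / of_nat T = 1 - of_nat r / of_nat T"
    using assms T by (simp add: of_nat_diff diff_divide_distrib)
  \<comment> \<open>With x and y the fractional positions of r and i, and d and e the two deltas,
    the comparisons of i with r and with T - r become linear conditions on x and y; each bound is
    then linear arithmetic.\<close>
  define x where "x = (of_nat r::rat) / of_nat T"
  define y where "y = (of_nat i::rat) / of_nat T"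
  define d where "d = (if r \<le> i then 1 else 0 :: rat)"
  define e where "e = (if T - r \<le> i then 1 else 0 :: rat)"
  have a: "top_exp r = d + of_nat l + x"
    by (simp add: top_exp_def delta_def i_def l_def d_def x_def)
  have b: "(of_nat (pole_order r) :: rat) = 2 * of_nat l + d + e + 1"
    by (simp add: pole_order_def delta_def i_def l_def d_def e_def)
  have n': "n = of_nat l + y" using n by (simp add: y_def)
  have d: "d = 1 \<and> x \<le> y \<or> d = 0 \<and> y < x"
    using le[of r i] lt[of i r] by (auto simp: d_def x_def y_def)
  have e: "e = 1 \<and> 1 - x \<le> y \<or> e = 0 \<and> y < 1 - x"
    using le[of "T - r" i] lt[of i "T - r"] unfolding Tr by (auto simp: e_def x_def y_def)
  have xy: "0 \<le> x" "0 \<le> y" "x < 1" "y < 1"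
    using r0 r1 i1 by (simp_all add: x_def y_def)
  show "top_exp r > n" unfolding a using d xy n' by (elim disjE conjE) linarith+
  show "top_exp r \<le> n + 1" unfolding a using d xy n' by (elim disjE conjE) linarith+
  show "top_exp r - of_nat (pole_order r) < - n"
    unfolding a b using e xy n' by (elim disjE conjE) linarith+
  show "top_exp r - of_nat (pole_order r) \<ge> - n - 1"
    unfolding a b using e xy n' by (elim disjE conjE) linarith+
qed

lemma pole_order_pos: "pole_order r > 0"
  by (simp add: pole_order_def)

abbreviation O_n :: "'v set"
  where "O_n \<equiv> zhu_O T n g"

lemma subspace_O: "subspace O_n"
  by (simp add: zhu_O_def)

lemmas O_add = subspace_add[OF subspace_O] and O_scale = subspace_scale[OF subspace_O]
  and O_zero = subspace_0[OF subspace_O] and O_sum = subspace_sum[OF subspace_O]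
  and O_diff = subspace_diff[OF subspace_O] and O_minus = subspace_neg[OF subspace_O]

lemma O_L: "L (- 1) v + L 0 v \<in> O_n"
  unfolding zhu_O_def by (intro span_base) auto

lemma zhu_circ_eq:
  "zhu_circ T n g k u v = (\<Sum>r<T. residue (eigencomponent T g r u) v
    (binomial_laurent (of_int k - 1 + of_rat (top_exp r)) (- int (pole_order r))))"
  by (simp add: zhu_circ_def Let_def top_exp_def pole_order_def of_rat_add of_rat_divide add.assoc)

text \<open>Raises the pole order by induction on t. The vector \<open>L (- 1) u\<close> has weight
  one higher and the same eigenvalue, so the induction hypothesis applies to it; integration by
  parts expresses its residue by the residues of u at pole t, already in O, and at pole t + 1, the
  latter with the nonzero coefficient -(\<open>pole_order r\<close> + t).\<close>

lemma O_base:
  assumes "r < T" "u \<in> homogeneous k (of_nat r / of_nat T)"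
  shows "residue u v (binomial_laurent (of_int k - 1 + of_rat (top_exp r)) (- int (pole_order r) - int t)) \<in> O_n"
  using assms(2)
proof (induction t arbitrary: u k)
  case 0
  have "zhu_circ T n g k u v \<in> O_n"
    unfolding zhu_O_def using 0 by (intro span_base) (auto simp: homogeneous_def)
  moreover have "zhu_circ T n g k u v = (\<Sum>s<T. if s = r then residue u v
      (binomial_laurent (of_int k - 1 + of_rat (top_exp r)) (- int (pole_order r))) else 0)"
    unfolding zhu_circ_eq
    by (rule sum.cong) (use 0 assms(1) in \<open>auto simp: eigencomponent_eig homogeneous_def\<close>)
  ultimately show ?case using assms(1) by simp
next
  case (Suc t)
  let ?a = "of_int k - 1 + of_rat (top_exp r) :: complex" and ?b = "- int (pole_order r) - int t"
  have 1: "residue u v (binomial_laurent ?a ?b) \<in> O_n" by (rule Suc.IH[OF Suc.prems])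
  have "residue (L (- 1) u) v (binomial_laurent (?a + 1) ?b) \<in> O_n"
    using Suc.IH[OF homogeneous_L_minus_1[OF Suc.prems]] by (simp add: algebra_simps)
  moreover have "residue (L (- 1) u) v (binomial_laurent (?a + 1) ?b) = 
     - ((?a + 1) *s residue u v (binomial_laurent ?a ?b) +
      of_int ?b *s (residue u v (binomial_laurent ?a ?b) + residue u v (binomial_laurent ?a (?b - 1))))"
    by (rule residue_L_minus_1_binomial)
  ultimately have "- ((?a + 1) *s residue u v (binomial_laurent ?a ?b) +
      of_int ?b *s (residue u v (binomial_laurent ?a ?b) + residue u v (binomial_laurent ?a (?b - 1)))) \<in> O_n"
    by simp
  from O_minus[OF this]
  have "((?a + 1) + of_int ?b) *s residue u v (binomial_laurent ?a ?b) +
      of_int ?b *s residue u v (binomial_laurent ?a (?b - 1)) \<in> O_n"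
    by (simp only: minus_minus scale_left_distrib scale_right_distrib add.assoc)
  from O_diff[OF this O_scale[OF 1, of "(?a + 1) + of_int ?b"]]
  have "of_int ?b *s residue u v (binomial_laurent ?a (?b - 1)) \<in> O_n"
    by (simp only: add_diff_cancel_left')
  from O_scale[OF this, of "1 / of_int ?b"]
  have "(1 / of_int ?b * of_int ?b) *s residue u v (binomial_laurent ?a (?b - 1)) \<in> O_n"
    by (simp only: scale_scale)
  moreover have "(of_int ?b :: complex) \<noteq> 0"
    using pole_order_pos[of r] by (simp only: of_int_eq_0_iff)
  ultimately have "residue u v (binomial_laurent ?a (?b - 1)) \<in> O_n"
    by (simp only: divide_self_if times_divide_eq_left mult_1 if_False scale_one)
  then show ?case by (simp add: algebra_simps)
qed

text \<open>In terms of \<open>w = 1 + z\<close>: the function \<open>w\<^sup>a (w - 1)\<^sup>b\<close> vanishes to order greater than \<open>n\<close> both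
  at \<open>w = 0\<close> and at \<open>w = \<infinity>\<close>.\<close>

lemma O_mem:
  assumes u: "u \<in> homogeneous k a" and a: "of_nat T * a \<in> \<int>" "a > n" "a + of_int b < - n"
  shows "residue u v (binomial_laurent (of_int k - 1 + of_rat a) b) \<in> O_n"
proof -
  obtain r where r: "r < T" "a - of_nat r / of_nat T \<in> \<int>" using a(1) by (rule residue_index)
  have u: "u \<in> homogeneous k (of_nat r / of_nat T)"
    using u eig_cong[OF r(2)] by (simp add: homogeneous_def)
  \<comment> \<open>Here s measures the additional vanishing at w = 0, and t that at infinity: the
    two exponents add up to a number in which s cancels. Multiplication by 1 + z, in the form of
    Pascal's rule, raises s.\<close>
  have key: "residue u v (binomial_laurent (of_int k - 1 + of_rat (top_exp r) + of_nat s)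
      (- int (pole_order r) - int t - int s)) \<in> O_n" for s t
  proof (induction s arbitrary: t)
    case 0
    then show ?case using O_base[OF r(1) u] by simp
  next
    case (Suc s)
    define c where "c = (of_int k - 1 + of_rat (top_exp r) + of_nat s :: complex)"
    have c: "of_int k - 1 + of_rat (top_exp r) + of_nat (Suc s) = c + 1" by (simp add: c_def)
    have e: "- int (pole_order r) - int t - int (Suc s) = - int (pole_order r) - int (Suc t) - int s"
      "- int (pole_order r) - int (Suc t) - int s + 1 = - int (pole_order r) - int t - int s" by simp_all
    have "residue u v (binomial_laurent (of_int k - 1 + of_rat (top_exp r) + of_nat (Suc s))
      (- int (pole_order r) - int t - int (Suc s))) =
      residue u v (binomial_laurent (of_int k - 1 + of_rat (top_exp r) + of_nat s) (- int (pole_order r) - int (Suc t) - int s))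
     + residue u v (binomial_laurent (of_int k - 1 + of_rat (top_exp r) + of_nat s) (- int (pole_order r) - int t - int s))"
      by (simp only: c c_def[symmetric] e binomial_laurent_pascal residue_add)
    then show ?case using O_add[OF Suc[of "Suc t"] Suc[of t]] by simp
  qed
  have "a - top_exp r = (a - of_nat r / of_nat T) - of_nat (delta (frac_index T n) r + level n)"
    by (simp add: top_exp_def)
  then have "a - top_exp r \<in> \<int>" using r(2) by (metis Ints_diff Ints_of_nat)
  then obtain s' :: int where s': "a - top_exp r = of_int s'" by (rule Ints_cases)
  \<comment> \<open>The bounds on \<open>top_exp\<close> leave a gap of at most 1 to n and to -n.
    The differences s' and t' are integers greater than -1, hence nonnegative.\<close>
  have "of_int s' > (of_int (- 1) :: rat)" using s' top_exp_bounds(2)[OF r(1)] a(2) by simp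
  then have "s' \<ge> 0" by (simp only: of_int_less_iff)
  define t' where "t' = - int (pole_order r) - s' - b"
  have "of_int t' = top_exp r - of_nat (pole_order r) - (a + of_int b)" using s' by (simp add: t'_def)
  then have "of_int t' > (of_int (- 1) :: rat)" using top_exp_bounds(4)[OF r(1)] a(3) by simp
  then have "t' \<ge> 0" by (simp only: of_int_less_iff)
  have "a = top_exp r + of_nat (nat s')" using s' \<open>s' \<ge> 0\<close> by simp
  then have "of_rat a = (of_rat (top_exp r) + of_nat (nat s') :: complex)" by (simp add: of_rat_add)
  moreover have "b = - int (pole_order r) - int (nat t') - int (nat s')"
    using \<open>s' \<ge> 0\<close> \<open>t' \<ge> 0\<close> by (simp add: t'_def)
  ultimately show ?thesis using key[of "nat s'" "nat t'"] by (simp add: add.assoc)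
qed

lemma top_exp_T: "of_nat T * top_exp r \<in> \<int>" "top_exp r - of_nat r / of_nat T \<in> \<int>"
proof -
  have "of_nat T * top_exp r =
      of_nat (T * (delta (frac_index T n) r + level n)) + of_nat T * (of_nat r / of_nat T)"
    unfolding top_exp_def distrib_left[of "of_nat T"] of_nat_mult of_nat_add by (rule refl)
  also have "of_nat T * (of_nat r / of_nat T) = (of_nat r :: rat)" using T_pos by simp
  finally have "of_nat T * top_exp r = of_nat (T * (delta (frac_index T n) r + level n) + r)"
    by (simp only: of_nat_add)
  then show "of_nat T * top_exp r \<in> \<int>" by (metis Ints_of_nat)
  have "top_exp r - of_nat r / of_nat T = of_nat (delta (frac_index T n) r + level n)"
    by (simp add: top_exp_def)
  then show "top_exp r - of_nat r / of_nat T \<in> \<int>" by (metis Ints_of_nat)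
qed

text \<open>The counterpart of \<open>O_mem\<close>: inclusions of O need to be checked only on
  residues whose exponents satisfy the two inequalities. The ideal property and the change of level
  are proved in this form, without the explicit exponents of \<open>zhu_circ\<close>.\<close>

lemma O_subset:
  assumes W: "subspace W" and "\<And>v. L (- 1) v + L 0 v \<in> W"
    and "\<And>u v k a b. u \<in> homogeneous k a \<Longrightarrow> of_nat T * a \<in> \<int> \<Longrightarrow> a > n \<Longrightarrow> a + of_int b < - n \<Longrightarrow>
      residue u v (binomial_laurent (of_int k - 1 + of_rat a) b) \<in> W"
  shows "O_n \<subseteq> W"
proof -
  have "zhu_circ T n g k u v \<in> W" if "u \<in> wt_space k" for k u v
  proof -
    have "eigencomponent T g r u \<in> homogeneous k (top_exp r)" if "r < T" for r
      using eigencomponent_wt[OF \<open>u \<in> wt_space k\<close>] eigencomponent_in_eig[OF that] eig_cong[OF top_exp_T(2)]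
      by (simp add: homogeneous_def)
    then show ?thesis
      unfolding zhu_circ_eq using top_exp_bounds top_exp_T
      by (intro subspace_sum[OF W] assms(3)) auto
  qed
  then show ?thesis
    unfolding zhu_O_def using assms(2) W by (intro span_minimal) auto
qed

text \<open>The coefficients are those of (1+z)^(-l-1) expanded in 1/z, cut off after l + 1 terms.
  Times (1+z)^(l+1), the full expansion would give 1, so the kernel is (1+z)^(c-1) times a function
  that equals 1 up to order l + 1 at infinity. The parameter c is complex because the ideal property
  involves kernels with weights shifted by fractions.\<close>

definition star_kernel :: "complex \<Rightarrow> complex fls"
  where "star_kernel c = (\<Sum>m\<le>level n. fls_const ((- 1) ^ m * of_nat ((m + level n) choose level n)) *
    binomial_laurent (c + of_nat (level n)) (- int (level n + m + 1)))"

abbreviation star :: "'v \<Rightarrow> 'v \<Rightarrow> 'v"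
  where "star \<equiv> zhu_star T n g"

lemma zhu_star_homogeneous_eq:
  "zhu_star_homogeneous T n g k u v = residue (eigencomponent T g 0 u) v (star_kernel (of_int k))"
  by (simp only: zhu_star_homogeneous_def Let_def star_kernel_def residue_sum residue_const_mult)

lemma zhu_star_eq:
  "star u v = Sum_any (\<lambda>k. residue (eigencomponent T g 0 (component wt_space UNIV k u)) v (star_kernel (of_int k)))"
  by (simp add: zhu_star_def zhu_star_homogeneous_eq)

lemma star_support:
  "{k. residue (eigencomponent T g 0 (component wt_space UNIV k u)) v (star_kernel (of_int k)) \<noteq> 0} \<subseteq>
    {k. component wt_space UNIV k u \<noteq> 0}"
  by (auto simp: component_zero[OF graded_by_eigenspace])

lemma star_finite:
  "finite {k. residue (eigencomponent T g 0 (component wt_space UNIV k u)) v (star_kernel (of_int k)) \<noteq> 0}"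
  using finite_subset[OF star_support component_finite[OF graded_by_wt]] .

lemma star_add_left: "star (u + u') v = star u v + star u' v"
  unfolding zhu_star_eq
  by (subst Sum_any.distrib[symmetric])
     (simp_all only: star_finite component_add[OF graded_by_wt] component_add[OF graded_by_eigenspace] residue_add_left)

lemma star_add_right: "star u (v + v') = star u v + star u v'"
  unfolding zhu_star_eq
  by (subst Sum_any.distrib[symmetric]) (simp_all only: star_finite residue_add_right)

lemma star_scale_left: "star (c *s u) v = c *s star u v"
  unfolding zhu_star_eq
  by (subst Sum_any_scale[symmetric])
     (simp_all only: star_finite component_scale[OF graded_by_wt] component_scale[OF graded_by_eigenspace] residue_scale_left)

lemma star_scale_right: "star u (c *s v) = c *s star u v"
  unfolding zhu_star_eq
  by (subst Sum_any_scale[symmetric]) (simp_all only: star_finite residue_scale_right)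

lemma star_linear_left: "Vector_Spaces.linear scale scale (\<lambda>u. star u v)"
  and star_linear_right: "Vector_Spaces.linear scale scale (star u)"
  by (simp_all add: Vector_Spaces.linear_iff star_add_left star_add_right star_scale_left star_scale_right
      vector_space_axioms)

lemmas star_sum_left = module_hom.sum[OF star_linear_left[unfolded linear_iff_module_hom]]
  and star_diff_left = module_hom.diff[OF star_linear_left[unfolded linear_iff_module_hom]]
  and star_zero_left = module_hom.zero[OF star_linear_left[unfolded linear_iff_module_hom]]
  and star_diff_right = module_hom.diff[OF star_linear_right[unfolded linear_iff_module_hom]]
  and star_zero_right = module_hom.zero[OF star_linear_right[unfolded linear_iff_module_hom]]

lemma star_homogeneous:
  assumes "u \<in> homogeneous k q" "of_nat T * q \<in> \<int>"
  shows "star u v = (if q \<in> \<int> then residue u v (star_kernel (of_int k)) else 0)"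
proof -
  have "star u v = Sum_any (\<lambda>j. if j = k then residue (eigencomponent T g 0 u) v (star_kernel (of_int k)) else 0)"
    unfolding zhu_star_eq
    by (rule Sum_any.cong)
       (use assms in \<open>simp add: component_mem[OF graded_by_wt, of k] homogeneous_def component_zero[OF graded_by_eigenspace]\<close>)
  then show ?thesis
    using eigencomponent_0_eig[of u q] assms by (simp add: homogeneous_def)
qed

end

section \<open>The identity element\<close>

lemma gbinomial_nonzero:
  fixes a :: "'a::field_char_0"
  assumes "a \<notin> \<nat>"
  shows "a gchoose k \<noteq> 0"
proof
  assume "a gchoose k = 0"
  then have "(\<Prod>i = 0..<k. a - of_nat i) = 0" using gbinomial_mult_fact[of k a] by simp
  then obtain i where "a = of_nat i" by auto
  then show False using assms by simp
qed

context vertex_operator_algebra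
begin

lemma residue_vac: "residue vac v f = fls_nth f (- 1) *s v"
proof -
  have "residue vac v f = Sum_any (\<lambda>j::int. if j = - 1 then fls_nth f (- 1) *s v else 0)"
    unfolding residue_def by (rule Sum_any.cong) (simp add: vacuum)
  then show ?thesis by simp
qed

lemma wt_vac: "vac \<in> wt_space 0"
  by (simp add: wt_space_def L_def creation)

lemma L_minus_1_residue: "L (- 1) (residue u v f) = residue (L (- 1) u) v f + residue u (L (- 1) v) f"
proof -
  obtain N1 N2 N3 where N: "\<forall>j\<ge>N1. Y u j v = 0" "\<forall>j\<ge>N2. Y (L (- 1) u) j v = 0" "\<forall>j\<ge>N3. Y u j (L (- 1) v) = 0"
    using truncation by meson
  define N where "N = max N1 (max N2 N3)"
  obtain M where M: "\<And>j. j < M \<Longrightarrow> fls_nth f j = 0" by (meson fls_eq0_below_subdegree)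
  have "residue u v f = (\<Sum>j\<in>{M..<N}. fls_nth f j *s Y u j v)"
    "residue (L (- 1) u) v f = (\<Sum>j\<in>{M..<N}. fls_nth f j *s Y (L (- 1) u) j v)"
    "residue u (L (- 1) v) f = (\<Sum>j\<in>{M..<N}. fls_nth f j *s Y u j (L (- 1) v))"
    by (rule residue_eq_sum; use N M in \<open>simp add: N_def\<close>)+
  then show ?thesis
    by (simp add: L_sum L_scale L_minus_1_derivation scale_right_distrib sum.distrib)
qed

text \<open>The bracket of L(0) with Y(u,z) is Y(L(0)u,z) + z Y(L(-1)u,z).\<close>

lemma L_0_residue:
  assumes "u \<in> wt_space k"
  shows "L 0 (residue u v f) =
    residue u (L 0 v) f + of_int k *s residue u v f + residue (L (- 1) u) v (f * fls_X_intpow 1)"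
proof -
  obtain N1 N2 where N: "\<forall>j\<ge>N1. Y u j v = 0" "\<forall>j\<ge>N2. Y u j (L 0 v) = 0"
    using truncation by meson
  define N where "N = max N1 N2"
  obtain M where M: "\<And>j. j < M \<Longrightarrow> fls_nth f j = 0" by (meson fls_eq0_below_subdegree)
  have r: "residue u v f = (\<Sum>j\<in>{M..<N}. fls_nth f j *s Y u j v)"
    "residue u (L 0 v) f = (\<Sum>j\<in>{M..<N}. fls_nth f j *s Y u j (L 0 v))"
    by (rule residue_eq_sum; use N M in \<open>simp add: N_def\<close>)+
  have "residue u v (fls_deriv (f * fls_X_intpow 1)) =
      (\<Sum>j\<in>{M..<N}. fls_nth (fls_deriv (f * fls_X_intpow 1)) j *s Y u j v)"
    by (rule residue_eq_sum) (use N M in \<open>simp_all add: N_def fls_nth_times_X_intpow del: fls_deriv_mult\<close>)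
  also have "\<dots> = (\<Sum>j\<in>{M..<N}. (of_int (j + 1) * fls_nth f j) *s Y u j v)"
    by (simp add: fls_nth_times_X_intpow del: fls_deriv_mult)
  finally have d: "residue (L (- 1) u) v (f * fls_X_intpow 1) = - (\<Sum>j\<in>{M..<N}. (of_int (j + 1) * fls_nth f j) *s Y u j v)"
    by (simp only: residue_L_minus_1)
  have "L 0 (fls_nth f j *s Y u j v) = fls_nth f j *s Y u j (L 0 v) + of_int k *s (fls_nth f j *s Y u j v) -
      (of_int (j + 1) * fls_nth f j) *s Y u j v" for j
    using assms by (simp add: wt_space_def L_scale L_0_Y Y_scale_left scale_right_distrib
        scale_right_diff_distrib mult.commute)
  then show ?thesis
    unfolding d unfolding r by (simp add: L_sum sum.distrib sum_subtractf scale_sum_right)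
qed

end

context zhu_level
begin

abbreviation kernel_coeff :: "nat \<Rightarrow> complex"
  where "kernel_coeff m \<equiv> (- 1) ^ m * of_nat ((m + level n) choose level n)"

lemma level_bounds: "of_nat (level n) \<le> n" "n < of_nat (level n) + 1"
proof -
  have "0 \<le> (of_nat (frac_index T n) / of_nat T :: rat)" "(of_nat (frac_index T n) / of_nat T :: rat) < 1"
    using level_index(2) T_pos by (simp_all add: divide_less_eq)
  then show "of_nat (level n) \<le> n" "n < of_nat (level n) + 1" using level_index(1) by linarith+
qed

lemma residue_star_kernel:
  "residue u v (star_kernel c) = (\<Sum>m\<le>level n. kernel_coeff m *s
    residue u v (binomial_laurent (c + of_nat (level n)) (- int (level n + m + 1))))"
  by (simp only: star_kernel_def residue_sum residue_const_mult)

lemma star_kernel_shift: "binomial_laurent a 0 * star_kernel c = star_kernel (a + c)"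
  unfolding star_kernel_def sum_distrib_left
  by (rule sum.cong) (simp_all only: mult.left_commute[of "binomial_laurent a 0"] binomial_laurent_mult add_0 add.assoc)

lemma residue_star_kernel_X:
  "residue u v (star_kernel c * fls_X_intpow t) = (\<Sum>m\<le>level n. kernel_coeff m *s
    residue u v (binomial_laurent (c + of_nat (level n)) (- int (level n + m + 1) + t)))"
  by (simp only: star_kernel_def residue_sum residue_const_mult sum_distrib_right mult.assoc binomial_laurent_times_X)

lemma homogeneous_cong: "p - q \<in> \<int> \<Longrightarrow> homogeneous k p = homogeneous k q"
  using eig_cong by (simp add: homogeneous_def)

lemma vac_homogeneous: "vac \<in> homogeneous 0 0"
  by (simp add: homogeneous_def wt_vac vac_eig)

text \<open>At c = 0 the numerator is the polynomial (1+z)^l, which has no coefficient at z^(l+m)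
  for m > 0.\<close>

lemma star_kernel_residue: "fls_nth (star_kernel 0) (- 1) = 1"
proof -
  have "fls_nth (star_kernel 0) (- 1) = (\<Sum>m\<le>level n. kernel_coeff m * of_nat (level n choose (level n + m)))"
    by (simp add: star_kernel_def fls_nth_sum binomial_laurent_nth binomial_gbinomial nat_add_distrib)
  also have "\<dots> = (\<Sum>m\<le>level n. if m = 0 then 1 else 0)"
    by (rule sum.cong) (auto simp: binomial_eq_0)
  finally show ?thesis by simp
qed

lemma star_vac_left: "star vac v = v"
  using star_homogeneous[OF vac_homogeneous] by (simp add: residue_vac star_kernel_residue)

text \<open>The vector v_(-1-i) 1 is L(-1)^i v / i!. Modulo O the operator L(-1) acts as -L(0), and
  the weight rises by one at each application, which produces the factors -k, -k-1, ... of the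
  binomial coefficient.\<close>

lemma vac_mode: "v \<in> wt_space k \<Longrightarrow> Y v (- 1 - int i) vac - ((- of_int k) gchoose i) *s v \<in> O_n"
proof (induction i arbitrary: v k)
  case 0
  then show ?case by (simp add: creation O_zero)
next
  case (Suc i)
  let ?c = "((- of_int (k + 1)) gchoose i) :: complex"
  have c: "?c = (- of_int k - 1) gchoose i" by simp
  have nz: "(1 + of_nat i :: complex) \<noteq> 0" by (metis of_nat_Suc of_nat_neq_0)
  have 1: "Y (L (- 1) v) (- 1 - int i) vac - ?c *s L (- 1) v \<in> O_n"
    by (rule Suc.IH[OF wt_L_minus_1[OF Suc.prems]])
  have 2: "L (- 1) v + of_int k *s v \<in> O_n"
    using O_L[of v] Suc.prems by (simp add: wt_space_def)
  have "Y (L (- 1) v) (- 1 - int i) vac - ?c *s L (- 1) v + ?c *s (L (- 1) v + of_int k *s v) \<in> O_n"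
    by (rule O_add[OF 1 O_scale[OF 2]])
  then have "Y (L (- 1) v) (- 1 - int i) vac + (?c * of_int k) *s v \<in> O_n"
    by (simp add: scale_right_distrib)
  moreover have "Y (L (- 1) v) (- 1 - int i) vac = (1 + of_nat i) *s Y v (- 1 - int (Suc i)) vac"
    unfolding Y_L_minus_1 scale_minus_left[symmetric] by (simp add: algebra_simps)
  ultimately have "(1 + of_nat i) *s Y v (- 1 - int (Suc i)) vac + (?c * of_int k) *s v \<in> O_n" by simp
  from O_scale[OF this, of "1 / (1 + of_nat i)"]
  have "Y v (- 1 - int (Suc i)) vac + (?c * of_int k / (1 + of_nat i)) *s v \<in> O_n"
    using nz by (simp add: scale_right_distrib)
  moreover have "?c * of_int k / (1 + of_nat i) = - ((- of_int k) gchoose Suc i)"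
    unfolding c using gbinomial_absorption[of i "- of_int k :: complex"] nz by (simp add: field_simps)
  ultimately show ?case by simp
qed

text \<open>The generating form of \<open>vac_mode\<close>: modulo O, the series Y(v,z)1 = exp(z
  L(-1)) v is (1+z)^(-k) v, so a residue against the vacuum becomes a scalar multiple of v.\<close>

lemma residue_right_vac:
  assumes "v \<in> wt_space k"
  shows "residue v vac f - fls_nth (f * binomial_laurent (- of_int k) 0) (- 1) *s v \<in> O_n"
proof -
  obtain M0 where M0: "\<And>j. j < M0 \<Longrightarrow> fls_nth f j = 0" by (meson fls_eq0_below_subdegree)
  define M where "M = min M0 0"
  have M: "\<And>j. j < M \<Longrightarrow> fls_nth f j = 0" "M \<le> 0" using M0 by (auto simp: M_def)
  have 1: "residue v vac f = (\<Sum>j\<in>{M..<0}. fls_nth f j *s Y v j vac)"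
    by (rule residue_eq_sum) (use M in \<open>auto simp: creation\<close>)
  have "residue vac v' (f * binomial_laurent a 0) = (\<Sum>j\<in>{M..<0}. (fls_nth f j * (a gchoose nat (- 1 - j))) *s v')" for a v'
  proof -
    obtain t where t: "f = (\<Sum>j\<in>{fls_subdegree f..<0}. fls_const (fls_nth f j) * fls_X_intpow j) + t"
      "\<And>j. j < 0 \<Longrightarrow> fls_nth t j = 0" using fls_truncate_decomp[of f 0] by blast
    have "fls_nth (t * binomial_laurent a 0) (- 1) = 0"
      by (rule fls_mult_order[of 0 _ 0]) (use t(2) in \<open>auto simp: binomial_laurent_nth\<close>)
    moreover have "fls_nth (fls_const c * fls_X_intpow j * binomial_laurent a 0) (- 1) = c * (a gchoose nat (- 1 - j))" if "j < 0" for j c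
      using that by (simp only: mult.assoc mult.commute[of "fls_X_intpow j"] binomial_laurent_times_X)
         (simp add: binomial_laurent_nth)
    ultimately have "fls_nth (f * binomial_laurent a 0) (- 1) = (\<Sum>j\<in>{fls_subdegree f..<0}. fls_nth f j * (a gchoose nat (- 1 - j)))"
      by (subst t(1)) (simp add: distrib_right sum_distrib_right fls_nth_sum)
    also have "\<dots> = (\<Sum>j\<in>{min M (fls_subdegree f)..<0}. fls_nth f j * (a gchoose nat (- 1 - j)))"
      by (rule sum.mono_neutral_left) auto
    also have "\<dots> = (\<Sum>j\<in>{M..<0}. fls_nth f j * (a gchoose nat (- 1 - j)))"
      by (rule sum.mono_neutral_right) (use M in auto)
    finally show ?thesis by (simp add: residue_vac scale_sum_left)
  qed
  note 2 = this[of v "- of_int k", unfolded residue_vac]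
  have "fls_nth f j *s Y v j vac - (fls_nth f j * ((- of_int k) gchoose nat (- 1 - j))) *s v \<in> O_n"
    if "j \<in> {M..<0}" for j
    using O_scale[OF vac_mode[OF assms, of "nat (- 1 - j)"], of "fls_nth f j"] that
    by (simp add: scale_right_diff_distrib)
  then have "(\<Sum>j\<in>{M..<0}. fls_nth f j *s Y v j vac - (fls_nth f j * ((- of_int k) gchoose nat (- 1 - j))) *s v) \<in> O_n"
    by (rule O_sum)
  then show ?thesis unfolding 1 2 by (simp add: sum_subtractf)
qed

text \<open>An element of O of the form Res Y(v,z)1 f(z) is, modulo O, the multiple of v by the
  binomial coefficient of a - 1 over -1 - b. Here a is a representative of q modulo integers above
  n, and b is negative and small enough for \<open>O_mem\<close>. As a is not an integer, the
  binomial coefficient is nonzero.\<close>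

lemma eig_nonintegral_in_O:
  assumes v: "v \<in> homogeneous k q" "of_nat T * q \<in> \<int>" "q \<notin> \<int>"
  shows "v \<in> O_n"
proof -
  define s :: int where "s = \<lfloor>n - q\<rfloor> + 1"
  define a where "a = q + of_int s"
  define b :: int where "b = - \<lfloor>n + a\<rfloor> - 2 - \<bar>s\<bar>"
  have a: "a > n" unfolding a_def s_def by linarith
  have b: "a + of_int b < - n" "b < 0" unfolding b_def using a n_nonneg by linarith+
  have aT: "of_nat T * a \<in> \<int>"
  proof -
    have "of_nat T * a = of_nat T * q + of_int (int T * s)" by (simp add: a_def algebra_simps)
    then show ?thesis using v(2) by (metis Ints_add Ints_of_int)
  qed
  have va: "v \<in> homogeneous k a" using v(1) homogeneous_cong[of a q] by (simp add: a_def)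
  define f where "f = binomial_laurent (of_int k - 1 + of_rat a) b"
  have 1: "residue v vac f \<in> O_n"
    unfolding f_def by (rule O_mem[OF va aT a b(1)])
  have "f * binomial_laurent (- of_int k) 0 = binomial_laurent (of_rat (a - 1)) b"
    by (simp add: f_def binomial_laurent_mult of_rat_diff)
  then have c: "fls_nth (f * binomial_laurent (- of_int k) 0) (- 1) = (of_rat (a - 1) gchoose nat (- 1 - b))" (is "_ = ?c")
    using b(2) by (simp add: binomial_laurent_nth)
  have "v \<in> wt_space k" using v(1) by (simp add: homogeneous_def)
  from residue_right_vac[OF this, of f] have "residue v vac f - ?c *s v \<in> O_n" unfolding c .
  from O_diff[OF 1 this] have "?c *s v \<in> O_n" by simp
  moreover have "?c \<noteq> 0"
  proof (rule gbinomial_nonzero)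
    show "(of_rat (a - 1) :: complex) \<notin> \<nat>"
    proof
      assume "(of_rat (a - 1) :: complex) \<in> \<nat>"
      then obtain m where "(of_rat (a - 1) :: complex) = of_rat (of_nat m)" by (auto elim: Nats_cases)
      then have "a - 1 = of_nat m" by (simp only: of_rat_eq_iff)
      then have "q = of_int (int m + 1 - s)" by (simp add: a_def)
      then show False using v(3) by simp
    qed
  qed
  ultimately show ?thesis using O_scale[of "?c *s v" "1 / ?c"] by simp
qed

text \<open>On nonintegral eigenspaces the product vanishes, and the congruence holds because these
  eigenspaces lie in O. On the integral one the factor (1+z)^(-k) from the vacuum cancels the weight
  in the kernel.\<close>

lemma star_vac_right: "star v vac - v \<in> O_n"
proof (rule homogeneous_induct[of "\<lambda>v. star v vac - v \<in> O_n"])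
  have *: "star (x + y) vac - (x + y) = (star x vac - x) + (star y vac - y)"
    "star (c *s x) vac - c *s x = c *s (star x vac - x)" for x y c
    by (simp_all add: star_add_left star_scale_left scale_right_diff_distrib)
  show "subspace {v. star v vac - v \<in> O_n}"
    by (auto simp: subspace_def * O_add O_scale O_zero star_zero_left)
next
  fix v k q assume v: "v \<in> homogeneous k q" "of_nat T * q \<in> \<int>"
  show "star v vac - v \<in> O_n"
  proof (cases "q \<in> \<int>")
    case True
    have "star_kernel (of_int k) * binomial_laurent (- of_int k) 0 = star_kernel 0"
      using star_kernel_shift[of "- of_int k" "of_int k"] by (simp add: mult.commute)
    then show ?thesis
      using residue_right_vac[of v k "star_kernel (of_int k)"] v star_homogeneous[OF v] True
      by (simp add: star_kernel_residue homogeneous_def)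
  next
    case False
    then show ?thesis
      using eig_nonintegral_in_O[OF v False] star_homogeneous[OF v] by (simp add: O_minus)
  qed
qed

text \<open>Each derivative lowers the exponent of 1+z or that of z. In the first case the balance
  of c + c' against i is kept with the same a; in the second a grows by one while b drops by one, so
  the order at infinity is unchanged and the order at w = 0 improves.\<close>

lemma taylor_in_O:
  assumes "x \<in> homogeneous k a" "of_nat T * a \<in> \<int>" "a > n" "a + of_int (b + b') < - n"
    and "c + c' = of_int k - 1 + of_rat a + of_nat i"
  shows "residue x w (fls_taylor i (binomial_laurent c b) * binomial_laurent c' b') \<in> O_n"
  using assms
proof (induction i arbitrary: c b a)
  case 0
  then show ?case by (simp add: binomial_laurent_mult O_mem)
next
  case (Suc i)
  have 1: "residue x w (fls_taylor i (binomial_laurent (c - 1) b) * binomial_laurent c' b') \<in> O_n"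
    by (rule Suc.IH[OF Suc.prems(1-4)]) (use Suc.prems(5) in \<open>simp add: algebra_simps\<close>)
  have 2: "residue x w (fls_taylor i (binomial_laurent c (b - 1)) * binomial_laurent c' b') \<in> O_n"
  proof (rule Suc.IH[of "a + 1"])
    show "x \<in> homogeneous k (a + 1)" using Suc.prems(1) homogeneous_cong[of "a + 1" a] by simp
    have "of_nat T * (a + 1) = of_nat T * a + of_nat T" by (simp add: algebra_simps)
    then show "of_nat T * (a + 1) \<in> \<int>" using Suc.prems(2) by (metis Ints_add Ints_of_nat)
    show "c + c' = of_int k - 1 + of_rat (a + 1) + of_nat i"
      using Suc.prems(5) by (simp add: of_rat_add algebra_simps)
  qed (use Suc.prems in auto)
  have "residue x w (fls_taylor (Suc i) (binomial_laurent c b) * binomial_laurent c' b') =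
     (1 / of_nat (Suc i)) *s (c *s residue x w (fls_taylor i (binomial_laurent (c - 1) b) * binomial_laurent c' b') +
      of_int b *s residue x w (fls_taylor i (binomial_laurent c (b - 1)) * binomial_laurent c' b'))"
    by (simp only: fls_taylor_Suc binomial_laurent_deriv fls_taylor_add fls_taylor_const_mult distrib_right
        mult.assoc residue_add residue_const_mult)
  then show ?case using 1 2 by (simp add: O_add O_scale del: of_nat_Suc)
qed

end

section \<open>Two-sided ideals\<close>

lemma fls_taylor_sum: "fls_taylor i (\<Sum>x\<in>A. f x) = (\<Sum>x\<in>A. fls_taylor i (f x))"
proof -
  have "fls_taylor i 0 = 0" using fls_taylor_const_mult[of i 0 0] by simp
  then show ?thesis
    by (induction A rule: infinite_finite_induct) (simp_all add: fls_taylor_add)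
qed

context zhu_level
begin

lemma eig_T_add: 
  assumes "of_nat T * p \<in> \<int>" "of_nat T * q \<in> \<int>"
  shows "of_nat T * (p + q) \<in> (\<int> :: rat set)"
  using Ints_add[OF assms] by (simp only: distrib_left)

lemma eig_T_Ints: "p \<in> \<int> \<Longrightarrow> of_nat T * p \<in> (\<int> :: rat set)"
  by (rule Ints_mult) simp_all

lemma product_term_0:
  "(\<Sum>i<Suc N. product_term u v w 0 f1 f2 i) = residue u (residue v w f2) f1 - residue v (residue u w f1) f2"
proof -
  have "product_term u v w 0 f1 f2 i = 0" if "i > 0" for i
    using that by (simp add: product_term_def gbinomial_0_left)
  then have "(\<Sum>i<Suc N. product_term u v w 0 f1 f2 i) = (\<Sum>i\<in>{0}. product_term u v w 0 f1 f2 i)"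
    by (intro sum.mono_neutral_right) auto
  then show ?thesis by (simp add: product_term_def)
qed

text \<open>By the commutator formula, the residue in v can be moved to the outside, where it lies
  in O as it stands. The correction terms are residues of the vectors u_i v against derivatives of
  the kernel times the function of v.\<close>

lemma star_left_ideal_generator:
  assumes u: "u \<in> homogeneous k 0" and v: "v \<in> homogeneous k' a"
    and a: "of_nat T * a \<in> \<int>" "a > n" "a + of_int b < - n"
  shows "residue u (residue v w (binomial_laurent (of_int k' - 1 + of_rat a) b)) (star_kernel (of_int k)) \<in> O_n"
proof -
  let ?f1 = "star_kernel (of_int k)" and ?f2 = "binomial_laurent (of_int k' - 1 + of_rat a) b"
  obtain N where "(\<Sum>i<N. iterate_term u v w 0 ?f1 ?f2 i) = (\<Sum>i<N. product_term u v w 0 ?f1 ?f2 i)" "N \<ge> 1"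
    using eventually_conj[OF jacobi_at_all[unfolded jacobi_at_def, of u v w 0 ?f1 ?f2] eventually_ge_at_top[of 1]]
    by (auto dest: eventually_happens)
  moreover obtain N' where "N = Suc N'" using \<open>N \<ge> 1\<close> by (cases N) auto
  ultimately have eq: "residue u (residue v w ?f2) ?f1 = residue v (residue u w ?f1) ?f2 +
      (\<Sum>i<N. iterate_term u v w 0 ?f1 ?f2 i)"
    by (simp add: product_term_0 del: sum.lessThan_Suc)
  have "iterate_term u v w 0 ?f1 ?f2 i \<in> O_n" for i
  proof -
    \<comment> \<open>Relative to its weight factor (1+z)^(k-1), the kernel of u contributes a zero
      of order l + 1 at w = 0.\<close>
    let ?a = "a + (of_nat (level n) + 1)"
    have x: "Y u (0 + int i) v \<in> homogeneous (k + k' - int i - 1) ?a"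
      using homogeneous_Y[OF u v, of "int i"] homogeneous_cong[of ?a a] by simp
    have "residue (Y u (0 + int i) v) w (fls_taylor i (binomial_laurent (of_int k + of_nat (level n)) (- int (level n + m + 1))) * ?f2) \<in> O_n" for m
    proof (rule taylor_in_O[OF x])
      show "of_nat T * ?a \<in> \<int>"
        by (rule eig_T_add[OF a(1) eig_T_Ints]) simp
      show "?a > n" using a(2) by simp
      show "?a + of_int (- int (level n + m + 1) + b) < - n" using a(3) by simp
    qed (simp add: of_rat_add algebra_simps)
    then show ?thesis
      unfolding iterate_term_def star_kernel_def fls_taylor_sum fls_taylor_const_mult sum_distrib_right residue_sum
        mult.assoc residue_const_mult by (intro O_sum O_scale)
  qed
  moreover have "residue v (residue u w ?f1) ?f2 \<in> O_n" by (rule O_mem[OF v a])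
  ultimately show ?thesis unfolding eq by (intro O_add O_sum)
qed

text \<open>Write the kernel as w^(c-1) E(w) with w = 1 + z. By parts the left side is minus the
  residue of Y(u,z)v w^c E'(w), and E' is a multiple of w^l z^(-2l-2): the terms with poles of lower
  order cancel by the absorption identity for the kernel coefficients, which is the telescoping
  sum.\<close>

lemma residue_L_kernel:
  "residue (L (- 1) u) v (star_kernel (c + 1)) + c *s residue u v (star_kernel c) =
    (kernel_coeff (level n) * of_nat (2 * level n + 1)) *s
      residue u v (binomial_laurent (c + of_nat (level n)) (- int (2 * level n + 2)))"
proof -
  define R where "R m = residue u v (binomial_laurent (c + of_nat (level n)) (- int (level n + m + 1)))" for m
  have L: "residue (L (- 1) u) v (binomial_laurent (c + 1 + of_nat (level n)) (- int (level n + m + 1))) =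
      (of_nat m - c) *s R m + of_nat (level n + m + 1) *s R (Suc m)" for m
  proof -
    have "residue (L (- 1) u) v (binomial_laurent (c + of_nat (level n) + 1) (- int (level n + m + 1))) =
      - ((c + of_nat (level n) + 1) *s R m + of_int (- int (level n + m + 1)) *s (R m + R (Suc m)))"
      unfolding residue_L_minus_1_binomial R_def by (simp add: algebra_simps)
    also have "\<dots> = (of_nat (level n + m + 1) - (c + of_nat (level n) + 1)) *s R m + of_nat (level n + m + 1) *s R (Suc m)"
      by (simp add: scale_right_distrib scale_left_distrib scale_left_diff_distrib)
    also have "of_nat (level n + m + 1) - (c + of_nat (level n) + 1) = of_nat m - c" by simp
    finally show ?thesis by (simp only: add_ac)
  qed
  have tele: "(\<Sum>m\<le>M. kernel_coeff m *s (of_nat m *s R m + of_nat (level n + m + 1) *s R (Suc m))) =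
      (kernel_coeff M * of_nat (level n + M + 1)) *s R (Suc M)" for M
  proof (induction M)
    case (Suc M)
    have "Suc M * ((Suc M + level n) choose level n) = (level n + M + 1) * ((M + level n) choose level n)"
      using binomial_absorption[of M "Suc M + level n"] binomial_symmetric[of "level n" "Suc M + level n"]
        binomial_symmetric[of "level n" "M + level n"] by simp
    then have "of_nat (Suc M) * of_nat ((Suc M + level n) choose level n) =
        of_nat (level n + M + 1) * (of_nat ((M + level n) choose level n) :: complex)"
      by (metis of_nat_mult)
    then have "kernel_coeff (Suc M) * of_nat (Suc M) + kernel_coeff M * of_nat (level n + M + 1) = 0"
      by (simp add: algebra_simps del: of_nat_Suc)
    then have z: "(kernel_coeff M * of_nat (level n + M + 1)) *s R (Suc M) + (kernel_coeff (Suc M) * of_nat (Suc M)) *s R (Suc M) = 0"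
      by (simp only: scale_left_distrib[symmetric] add.commute scale_zero_left)
    have "(\<Sum>m\<le>Suc M. kernel_coeff m *s (of_nat m *s R m + of_nat (level n + m + 1) *s R (Suc m))) =
      (kernel_coeff M * of_nat (level n + M + 1)) *s R (Suc M) +
      ((kernel_coeff (Suc M) * of_nat (Suc M)) *s R (Suc M) + (kernel_coeff (Suc M) * of_nat (level n + Suc M + 1)) *s R (Suc (Suc M)))"
      unfolding sum.atMost_Suc Suc.IH by (simp only: scale_right_distrib scale_scale)
    then show ?case unfolding add.assoc[symmetric] z by simp
  qed simp
  have "residue (L (- 1) u) v (star_kernel (c + 1)) + c *s residue u v (star_kernel c) =
     (\<Sum>m\<le>level n. kernel_coeff m *s (of_nat m *s R m + of_nat (level n + m + 1) *s R (Suc m)))"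
    unfolding residue_star_kernel L scale_sum_right sum.distrib[symmetric] R_def[symmetric]
    by (rule sum.cong) (simp_all add: scale_right_distrib scale_left_diff_distrib scale_right_diff_distrib mult.commute)
  note this[unfolded tele]
  moreover have "level n + level n + 1 = 2 * level n + 1" "level n + Suc (level n) + 1 = 2 * level n + 2"
    by simp_all
  ultimately show ?thesis by (simp only: R_def)
qed

lemma residue_L_kernel_in_O:
  assumes u: "u \<in> homogeneous k 0"
  shows "residue (L (- 1) u) v (star_kernel (of_int (k + 1))) + of_int k *s residue u v (star_kernel (of_int k)) \<in> O_n"
proof -
  have "residue u v (binomial_laurent (of_int k - 1 + of_rat (of_nat (level n) + 1)) (- int (2 * level n + 2))) \<in> O_n"
  proof (rule O_mem)
    show "u \<in> homogeneous k (of_nat (level n) + 1)"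
      using u homogeneous_cong[of "of_nat (level n) + 1" 0] by simp
    show "of_nat T * (of_nat (level n) + 1) \<in> (\<int> :: rat set)" by (rule eig_T_Ints) simp
  qed (use level_bounds in auto)
  then have "residue u v (binomial_laurent (of_int k + of_nat (level n)) (- int (2 * level n + 2))) \<in> O_n"
    by (simp add: of_rat_add)
  then show ?thesis
    unfolding of_int_add of_int_1 residue_L_kernel by (rule O_scale)
qed

lemma homogeneous_induct_0:
  assumes "subspace {u. P u}" "\<And>u k. u \<in> homogeneous k 0 \<Longrightarrow> P u"
    "\<And>u k q. u \<in> homogeneous k q \<Longrightarrow> of_nat T * q \<in> \<int> \<Longrightarrow> q \<notin> \<int> \<Longrightarrow> P u"
  shows "P u"
proof (rule homogeneous_induct[OF assms(1)])
  fix u k q assume u: "u \<in> homogeneous k q" "of_nat T * q \<in> \<int>"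
  show "P u"
  proof (cases "q \<in> \<int>")
    case True
    then show ?thesis using u homogeneous_cong[of q 0] assms(2) by simp
  qed (use u assms(3) in blast)
qed

lemma star_0: "u \<in> homogeneous k 0 \<Longrightarrow> star u v = residue u v (star_kernel (of_int k))"
  using star_homogeneous[of u k 0 v] by simp

lemma star_L_left: "star (L (- 1) u + L 0 u) v \<in> O_n"
proof (rule homogeneous_induct_0[of "\<lambda>u. star (L (- 1) u + L 0 u) v \<in> O_n"])
  have *: "star (L (- 1) (x + y) + L 0 (x + y)) v = star (L (- 1) x + L 0 x) v + star (L (- 1) y + L 0 y) v" 
    "star (L (- 1) (c *s x) + L 0 (c *s x)) v = c *s star (L (- 1) x + L 0 x) v" for x y c
    by (simp_all add: L_add L_scale star_add_left star_scale_left scale_right_distrib)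
  show "subspace {u. star (L (- 1) u + L 0 u) v \<in> O_n}"
    by (simp add: subspace_def * O_add O_scale O_zero star_zero_left)
next
  fix u k assume u: "u \<in> homogeneous k 0"
  then have "L 0 u = of_int k *s u" by (simp add: homogeneous_def wt_space_def)
  then show "star (L (- 1) u + L 0 u) v \<in> O_n"
    using residue_L_kernel_in_O[OF u] star_0[OF u] star_0[OF homogeneous_L_minus_1[OF u]]
    by (simp add: star_add_left star_scale_left)
next
  fix u k q assume u: "u \<in> homogeneous k q" and q: "of_nat T * q \<in> \<int>" "q \<notin> \<int>"
  then have "L 0 u = of_int k *s u" by (simp add: homogeneous_def wt_space_def)
  then show "star (L (- 1) u + L 0 u) v \<in> O_n"
    using star_homogeneous[OF u q(1)] star_homogeneous[OF homogeneous_L_minus_1[OF u] q(1)] q(2)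
    by (simp add: star_add_left star_scale_left O_zero)
qed

text \<open>Moving L(-1) + L(0) across Y(u,z) leaves (1+z) Y(L(-1)u,z)v + k Y(u,z)v. The factor 1 +
  z raises the kernel to weight k + 1, the weight of L(-1)u, which is the situation of
  \<open>residue_L_kernel_in_O\<close>.\<close>

lemma star_L_right: "star u (L (- 1) v + L 0 v) \<in> O_n"
proof (rule homogeneous_induct_0[of "\<lambda>u. star u (L (- 1) v + L 0 v) \<in> O_n"])
  show "subspace {u. star u (L (- 1) v + L 0 v) \<in> O_n}"
    by (simp add: subspace_def star_add_left star_scale_left O_add O_scale O_zero star_zero_left)
next
  fix u k assume u: "u \<in> homogeneous k 0"
  let ?E = "star_kernel (of_int k)"
  have "star_kernel (of_int k + 1) = ?E + ?E * fls_X_intpow 1"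
    using star_kernel_shift[of 1 "of_int k"] binomial_laurent_pascal[of 0 0]
    by (simp add: binomial_laurent_zero algebra_simps)
  then have E: "residue (L (- 1) u) v (?E * fls_X_intpow 1) =
      residue (L (- 1) u) v (star_kernel (of_int (k + 1))) - residue (L (- 1) u) v ?E"
    by (simp add: residue_add)
  have "star u (L (- 1) v + L 0 v) = (L (- 1) (residue u v ?E) + L 0 (residue u v ?E)) -
      (residue (L (- 1) u) v (star_kernel (of_int (k + 1))) + of_int k *s residue u v ?E)"
    using L_minus_1_residue[of u v ?E] L_0_residue[of u k v ?E] u
    unfolding star_0[OF u] residue_add_right E by (simp add: homogeneous_def)
  then show "star u (L (- 1) v + L 0 v) \<in> O_n"
    using O_diff[OF O_L residue_L_kernel_in_O[OF u]] by simp
next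
  fix u k q assume u: "u \<in> homogeneous k q" and q: "of_nat T * q \<in> \<int>" "q \<notin> \<int>"
  then show "star u (L (- 1) v + L 0 v) \<in> O_n"
    using star_homogeneous[OF u q(1)] by (simp add: O_zero)
qed

lemma star_left_ideal: "x \<in> O_n \<Longrightarrow> star u x \<in> O_n"
proof -
  assume x: "x \<in> O_n"
  have "O_n \<subseteq> {x. star u x \<in> O_n}"
  proof (rule O_subset)
    show "subspace {x. star u x \<in> O_n}"
      by (simp add: subspace_def star_add_right star_scale_right O_add O_scale O_zero star_zero_right)
    show "L (- 1) v + L 0 v \<in> {x. star u x \<in> O_n}" for v by (simp add: star_L_right)
  next
    fix v w k' a b
    assume v: "v \<in> homogeneous k' a" "of_nat T * a \<in> \<int>" "a > n" "a + of_int b < - n"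
    let ?x = "residue v w (binomial_laurent (of_int k' - 1 + of_rat a) b)"
    have "star u ?x \<in> O_n"
    proof (rule homogeneous_induct_0[of "\<lambda>u. star u ?x \<in> O_n"])
      show "subspace {u. star u ?x \<in> O_n}"
        by (simp add: subspace_def star_add_left star_scale_left O_add O_scale O_zero star_zero_left)
      show "star u ?x \<in> O_n" if "u \<in> homogeneous k 0" for u k
        unfolding star_0[OF that] by (rule star_left_ideal_generator[OF that v])
      show "star u ?x \<in> O_n" if "u \<in> homogeneous k q" "of_nat T * q \<in> \<int>" "q \<notin> \<int>" for u k q
        using star_homogeneous[OF that(1,2)] that(3) by (simp add: O_zero)
    qed
    then show "?x \<in> {x. star u x \<in> O_n}" by simp
  qed
  then show ?thesis using x by blast
qed

lemma residue_homogeneous_class: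
  assumes "u \<in> homogeneous k p" "v \<in> homogeneous k' q"
  shows "residue u v f \<in> eig (p + q)"
proof -
  have fin: "finite {j. fls_nth f j *s Y u j v \<noteq> 0}" by (rule residue_finite)
  show ?thesis
    unfolding residue_def Sum_any.expand_set
    using assms by (intro subspace_sum[OF subspace_eig] subspace_scale[OF subspace_eig] eig_Y) (auto simp: homogeneous_def)
qed

text \<open>Formulated without a weight for x, since a residue against a series mixes weights. The
  weight components of x stay in the eigenspace because \<open>g\<close> fixes
  \<open>om\<close>.\<close>

lemma star_eig_nonintegral:
  assumes "x \<in> eig q" "of_nat T * q \<in> \<int>" "q \<notin> \<int>"
  shows "star x w = 0"
proof -
  have "component wt_space UNIV k x \<in> eig q" for k
    using component_commute[OF graded_by_wt g_linear, of k x] component_scale[OF graded_by_wt, of k "phase q" x] assms(1)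
    by (simp add: eig_def wt_space_def L_def g_Y g.scale)
       (metis g_Y g_om g.scale)
  then have "eigencomponent T g 0 (component wt_space UNIV k x) = 0" for k
    using eigencomponent_0_eig[OF _ assms(2)] assms(3) by simp
  then show ?thesis by (simp add: zhu_star_eq)
qed

text \<open>The weight of u_(b+i) v contains -i, so its kernel is a fixed kernel times (1+z)^(c-i).
  With the coefficient of (1+z)^c this is the i-th divided derivative, and the sum is the iterate
  side of the Jacobi identity with s = b.\<close>

lemma star_residue_binomial:
  assumes u: "u \<in> homogeneous k p" and v: "v \<in> homogeneous k' q" and pq: "p + q \<in> \<int>"
  shows "\<forall>\<^sub>F N in sequentially. star (residue u v (binomial_laurent c b)) w =
    (\<Sum>i<N. iterate_term u v w b (binomial_laurent c 0) (star_kernel (of_int (k + k' - b - 1) - c)) i)"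
  using residue_binomial[of u v c b]
proof eventually_elim
  case (elim N)
  have "(c gchoose i) *s star (Y u (b + int i) v) w =
      iterate_term u v w b (binomial_laurent c 0) (star_kernel (of_int (k + k' - b - 1) - c)) i" for i
  proof -
    have "star (Y u (b + int i) v) w = residue (Y u (b + int i) v) w (star_kernel (of_int (k + k' - (b + int i) - 1)))"
      using star_homogeneous[OF homogeneous_Y[OF u v] eig_T_Ints[OF pq]] pq by simp
    also have "of_int (k + k' - (b + int i) - 1) = (c - of_nat i) + (of_int (k + k' - b - 1) - c)"
      by simp
    finally show ?thesis
      unfolding iterate_term_def fls_taylor_binomial mult.assoc star_kernel_shift residue_const_mult by simp
  qed
  then show ?case unfolding elim star_sum_left star_scale_left by simp
qed

text \<open>If the eigenvalues of u and v do not cancel, the residue lies in a nonintegral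
  eigenspace and the product is 0. Otherwise the product is an iterate side of the Jacobi identity,
  and every term of the other side has an outer residue, in u or in v, that lies in O.\<close>

lemma star_right_ideal_generator:
  assumes u: "u \<in> homogeneous k a" and a: "of_nat T * a \<in> \<int>" "a > n" "a + of_int b < - n"
  shows "star (residue u v (binomial_laurent (of_int k - 1 + of_rat a) b)) w \<in> O_n"
proof -
  let ?c = "of_int k - 1 + of_rat a :: complex"
  show ?thesis
  proof (rule homogeneous_induct[of "\<lambda>v. star (residue u v (binomial_laurent ?c b)) w \<in> O_n"])
    show "subspace {v. star (residue u v (binomial_laurent ?c b)) w \<in> O_n}"
      by (simp add: subspace_def star_add_left star_scale_left O_add O_scale O_zero star_zero_left
          residue_add_right residue_scale_right)
  next
    fix v k' q assume v: "v \<in> homogeneous k' q" and q: "of_nat T * q \<in> \<int>"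
    show "star (residue u v (binomial_laurent ?c b)) w \<in> O_n"
    proof (cases "a + q \<in> \<int>")
      case False
      then show ?thesis
        using star_eig_nonintegral[OF residue_homogeneous_class[OF u v] eig_T_add[OF a(1) q]] by (simp add: O_zero)
    next
      case True
      let ?f1 = "binomial_laurent ?c 0" and ?d = "of_int (k + k' - b - 1) - ?c"
      let ?f2 = "star_kernel ?d"
      obtain N where N: "star (residue u v (binomial_laurent ?c b)) w = (\<Sum>i<N. iterate_term u v w b ?f1 ?f2 i)"
          "(\<Sum>i<N. iterate_term u v w b ?f1 ?f2 i) = (\<Sum>i<N. product_term u v w b ?f1 ?f2 i)"
        using eventually_conj[OF star_residue_binomial[OF u v True, of ?c b w]
            jacobi_at_all[unfolded jacobi_at_def, of u v w b ?f1 ?f2]]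
        by (auto dest: eventually_happens)
      have "product_term u v w b ?f1 ?f2 i \<in> O_n" for i
      proof -
        have 1: "residue u x (?f1 * fls_X_intpow (b - int i)) \<in> O_n" for x
          unfolding binomial_laurent_times_X using u a by (intro O_mem) auto
        \<comment> \<open>The exponent that the residue in v inherits. The two conditions change
          places: a + b < -n makes \<open>?a\<close> exceed n, and a > n gives the required order at
          infinity, where the sum of exponents is -a - m - i.\<close>
        let ?a = "of_nat (level n) + 1 - a - of_int b"
        have "?a - q = of_int (int (level n) + 1 - b) - (a + q)" by simp
        then have aq: "?a - q \<in> \<int>" using True by (metis Ints_diff Ints_of_int)
        have v': "v \<in> homogeneous k' ?a" using v homogeneous_cong[OF aq] by simp
        have "q + (?a - q) = ?a" by simp
        then have aT: "of_nat T * ?a \<in> \<int>" using eig_T_add[OF q eig_T_Ints[OF aq]] by (simp only:)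
        have "residue v x (binomial_laurent (?d + of_nat (level n)) (- int (level n + m + 1) + (b - int i))) \<in> O_n" for x m
        proof -
          have deq: "?d + of_nat (level n) = of_int k' - 1 + of_rat ?a" by (simp add: of_rat_add of_rat_diff)
          show ?thesis
            unfolding deq by (rule O_mem[OF v' aT]) (use a(2,3) in simp_all)
        qed
        then have 2: "residue v x (?f2 * fls_X_intpow (b - int i)) \<in> O_n" for x
          unfolding residue_star_kernel_X by (intro O_sum O_scale)
        show ?thesis unfolding product_term_def by (intro O_scale O_diff 1 2)
      qed
      then show ?thesis unfolding N by (rule O_sum)
    qed
  qed
qed

lemma star_right_ideal: "x \<in> O_n \<Longrightarrow> star x w \<in> O_n"
proof -
  assume x: "x \<in> O_n"
  have "O_n \<subseteq> {x. star x w \<in> O_n}"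
  proof (rule O_subset)
    show "subspace {x. star x w \<in> O_n}"
      by (simp add: subspace_def star_add_left star_scale_left O_add O_scale O_zero star_zero_left)
    show "L (- 1) v + L 0 v \<in> {x. star x w \<in> O_n}" for v by (simp add: star_L_left)
  qed (simp add: star_right_ideal_generator)
  then show ?thesis using x by blast
qed

end

section \<open>Associativity\<close>

text \<open>Trinomial revision, (j choose m)(m choose e) = (j choose e)(j-e choose m-e), reduces the
  sum to an alternating row sum of Pascal's triangle.\<close>

lemma alternating_binomial_orthogonality:
  assumes "e \<le> j"
  shows "(\<Sum>m\<le>j. (- 1) ^ m * of_nat (j choose m) * of_nat (m choose e)) =
    (if e = j then (- 1) ^ j else 0 :: 'a::comm_ring_1)"
proof -
  have "(\<Sum>m\<le>j. (- 1) ^ m * of_nat (j choose m) * of_nat (m choose e)) =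
      (\<Sum>m\<in>{e..j}. (- 1) ^ m * of_nat (j choose m) * of_nat (m choose e) :: 'a)"
    by (rule sum.mono_neutral_right) (auto simp: binomial_eq_0)
  also have "\<dots> = (\<Sum>t\<le>j - e. (- 1) ^ e * of_nat (j choose e) * ((- 1) ^ t * of_nat ((j - e) choose t)))"
  proof (rule sum.reindex_bij_witness[of _ "\<lambda>t. t + e" "\<lambda>m. m - e"])
    fix m assume m: "m \<in> {e..j}"
    then have c: "(j choose m) * (m choose e) = (j choose e) * ((j - e) choose (m - e))"
      using choose_mult[of e m j] by simp
    have "(- 1 :: 'a) ^ m = (- 1) ^ e * (- 1) ^ (m - e)"
      using m by (simp flip: power_add)
    then have "(- 1) ^ m * of_nat (j choose m) * (of_nat (m choose e) :: 'a) =
        (- 1) ^ e * (- 1) ^ (m - e) * of_nat ((j choose m) * (m choose e))"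
      by (simp add: mult.assoc)
    then show "(- 1) ^ e * of_nat (j choose e) * ((- 1) ^ (m - e) * of_nat ((j - e) choose (m - e))) =
      (- 1) ^ m * of_nat (j choose m) * (of_nat (m choose e) :: 'a)"
      unfolding c by (simp add: mult_ac)
  qed (use assms in auto)
  also have "\<dots> = (- 1) ^ e * of_nat (j choose e) * (\<Sum>t\<le>j - e. (- 1) ^ t * of_nat ((j - e) choose t))"
    by (simp add: sum_distrib_left)
  also have "\<dots> = (if e = j then (- 1) ^ j else 0)"
    using assms choose_alternating_sum[of "j - e", where 'a='a] by auto
  finally show ?thesis .
qed

context vertex_operator_algebra
begin

text \<open>The combinatorial core of associativity. Terms are collected by j = m + i; the two outer
  binomials become (l+j choose l)(j choose m), and the alternating sum over m then removes
  everything except e = j.\<close>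

lemma sum_triangle_scale:
  fixes Z :: "nat \<Rightarrow> nat \<Rightarrow> 'v"
  shows "(\<Sum>m\<le>l. ((- 1) ^ m * of_nat ((m + l) choose l)) *s (\<Sum>i\<le>l - m. of_nat ((l + m + i) choose i) *s
      (\<Sum>e\<le>m. of_nat (m choose e) *s Z (i + m - e) (m + i)))) =
    (\<Sum>j\<le>l. ((- 1) ^ j * of_nat ((j + l) choose l)) *s Z 0 j)"
proof -
  define H where "H m j = (\<Sum>e\<le>j. (of_nat ((l + j) choose l) * ((- 1) ^ m * of_nat (j choose m) * of_nat (m choose e))) *s Z (j - e) j)"
    for m j
  have H: "((- 1) ^ m * of_nat ((m + l) choose l)) *s (of_nat ((l + m + i) choose i) *s
      (\<Sum>e\<le>m. of_nat (m choose e) *s Z (i + m - e) (m + i))) = H m (m + i)" for m i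
  proof -
    have "(l + m choose l) * (l + m + i choose i) = (l + (m + i) choose l) * (m + i choose m)"
      using choose_mult[of l "l + m" "l + m + i"] binomial_symmetric[of i "l + m + i"] by (simp add: add.assoc mult.commute)
    then have c: "of_nat (l + m choose l) * of_nat (l + m + i choose i) =
        (of_nat (l + (m + i) choose l) * of_nat (m + i choose m) :: complex)"
      by (metis of_nat_mult)
    have "H m (m + i) = (\<Sum>e\<le>m. (of_nat ((l + (m + i)) choose l) * ((- 1) ^ m * of_nat (m + i choose m) * of_nat (m choose e))) *s Z (m + i - e) (m + i))"
      unfolding H_def by (rule sum.mono_neutral_right) (auto simp: binomial_eq_0)
    also have "\<dots> = (\<Sum>e\<le>m. ((- 1) ^ m * (of_nat (l + m choose l) * of_nat (l + m + i choose i)) * of_nat (m choose e)) *s Z (i + m - e) (m + i))"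
      unfolding c by (rule sum.cong) (simp_all add: mult_ac add.commute)
    finally show ?thesis by (simp add: scale_sum_right mult_ac add.commute[of m l])
  qed
  have "(\<Sum>m\<le>l. ((- 1) ^ m * of_nat ((m + l) choose l)) *s (\<Sum>i\<le>l - m. of_nat ((l + m + i) choose i) *s
      (\<Sum>e\<le>m. of_nat (m choose e) *s Z (i + m - e) (m + i)))) = (\<Sum>m\<le>l. \<Sum>i\<le>l - m. H m (m + i))"
    by (rule sum.cong[OF refl]) (simp only: scale_sum_right[of "_ * _"] H)
  also have "\<dots> = (\<Sum>(m, i)\<in>{(m, i). m + i \<le> l}. H m (m + i))"
    by (subst sum.Sigma) (auto intro!: sum.cong)
  also have "\<dots> = (\<Sum>j\<le>l. \<Sum>m\<le>j. H m (m + (j - m)))"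
    by (rule sum.triangle_reindex_eq)
  also have "\<dots> = (\<Sum>j\<le>l. ((- 1) ^ j * of_nat ((j + l) choose l)) *s Z 0 j)"
  proof (rule sum.cong[OF refl])
    fix j
    have "(\<Sum>m\<le>j. H m (m + (j - m))) = (\<Sum>m\<le>j. H m j)" by (rule sum.cong) auto
    also have "\<dots> = (\<Sum>e\<le>j. (of_nat ((l + j) choose l) * (\<Sum>m\<le>j. (- 1) ^ m * of_nat (j choose m) * of_nat (m choose e))) *s Z (j - e) j)"
      unfolding H_def by (subst sum.swap) (simp add: scale_sum_left sum_distrib_left)
    also have "\<dots> = (\<Sum>e\<le>j. if e = j then (of_nat ((l + j) choose l) * (- 1) ^ j) *s Z 0 j else 0)"
      by (rule sum.cong) (auto simp: alternating_binomial_orthogonality)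
    finally show "(\<Sum>m\<le>j. H m (m + (j - m))) = ((- 1) ^ j * of_nat ((j + l) choose l)) *s Z 0 j"
      by (simp add: mult.commute add.commute)
  qed
  finally show ?thesis .
qed

lemma binomial_laurent_of_nat:
  "binomial_laurent (of_nat m) 0 = (\<Sum>e\<le>m. fls_const (of_nat (m choose e)) * fls_X_intpow (int (m - e)))"
proof (rule fls_eqI)
  fix j
  have "fls_nth (\<Sum>e\<le>m. fls_const (of_nat (m choose e)) * fls_X_intpow (int (m - e))) j =
      (\<Sum>e\<le>m. if j = int (m - e) then of_nat (m choose e) else (0 :: complex))"
    unfolding fls_nth_sum by (rule sum.cong) auto
  also have "\<dots> = (if 0 \<le> j \<and> j \<le> int m then of_nat (m choose (m - nat j)) else 0)"
  proof (cases "0 \<le> j \<and> j \<le> int m")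
    case True
    then have "(\<Sum>e\<le>m. if j = int (m - e) then of_nat (m choose e) else (0 :: complex)) =
        (\<Sum>e\<le>m. if e = m - nat j then of_nat (m choose e) else 0)"
      by (intro sum.cong) auto
    then show ?thesis using True by simp
  qed (auto intro!: sum.neutral)
  also have "\<dots> = fls_nth (binomial_laurent (of_nat m) 0) j"
    by (auto simp: binomial_laurent_nth binomial_gbinomial[symmetric] binomial_symmetric[symmetric] nat_le_iff binomial_eq_0)
  finally show "fls_nth (binomial_laurent (of_nat m) 0) j =
    fls_nth (\<Sum>e\<le>m. fls_const (of_nat (m choose e)) * fls_X_intpow (int (m - e))) j" ..
qed

end

context zhu_level
begin

text \<open>Expanding (z1-z2)^(-l-m-1) in the Jacobi identity yields the terms \<open>Z t j\<close>,
  with t extra factors z2 and a pole of order l + j + 1 in z1. Terms with j beyond the level lie in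
  O, as do all terms in the opposite order; what remains is a finite triangle in m and i.\<close>

lemma star_residue_assoc:
  fixes Z w
  assumes u: "u \<in> homogeneous k 0" and v: "v \<in> homogeneous k' 0" and m: "m \<le> level n"
  defines "Z \<equiv> \<lambda>t j. residue u (residue v w (star_kernel (of_int k') * fls_X_intpow (int t)))
      (binomial_laurent (of_int k + of_nat (level n)) (- int (level n + j + 1)))"
  shows "star (residue u v (binomial_laurent (of_int k + of_nat (level n)) (- int (level n + m + 1)))) w -
    (\<Sum>i\<le>level n - m. of_nat ((level n + m + i) choose i) *s (\<Sum>e\<le>m. of_nat (m choose e) *s Z (i + m - e) (m + i))) \<in> O_n"
proof -
  define c b where "c = (of_int k + of_nat (level n) :: complex)" and "b = - int (level n + m + 1)"
  let ?f1 = "binomial_laurent c 0" and ?f2 = "star_kernel (of_int (k + k' - b - 1) - c)"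
  \<comment> \<open>The second series is thus (1+z2)^m times the kernel of v. Since m is a natural
    number, the first factor is a polynomial; its terms are indexed by e.\<close>
  have d: "of_int (k + k' - b - 1) - c = of_nat m + (of_int k' :: complex)" by (simp add: b_def c_def)
  obtain N where N: "star (residue u v (binomial_laurent c b)) w = (\<Sum>i<N. iterate_term u v w b ?f1 ?f2 i)"
      "(\<Sum>i<N. iterate_term u v w b ?f1 ?f2 i) = (\<Sum>i<N. product_term u v w b ?f1 ?f2 i)" "N \<ge> Suc (level n)"
    using eventually_conj[OF eventually_conj[OF star_residue_binomial[OF u v, of c b w]
        jacobi_at_all[unfolded jacobi_at_def, of u v w b ?f1 ?f2]] eventually_ge_at_top[of "Suc (level n)"]]
    by (auto dest: eventually_happens)
  let ?R = "\<lambda>i. of_nat ((level n + m + i) choose i) *s (\<Sum>e\<le>m. of_nat (m choose e) *s Z (i + m - e) (m + i))"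
  \<comment> \<open>The exponents l + 1 and -(l+j+1) have sum -j, and j >= l + 1 > n.\<close>
  have Z: "Z t j \<in> O_n" if "j > level n" for t j
  proof -
    let ?a = "of_nat (level n) + 1 :: rat"
    have "residue u x (binomial_laurent (of_int k - 1 + of_rat ?a) (- int (level n + j + 1))) \<in> O_n" for x
    proof (rule O_mem)
      show "u \<in> homogeneous k ?a" using u homogeneous_cong[of ?a 0] by simp
      show "of_nat T * ?a \<in> \<int>" by (rule eig_T_Ints) simp
      have "of_nat j \<ge> (of_nat (level n) + 1 :: rat)" using that by (metis Suc_leI of_nat_Suc of_nat_mono add.commute)
      then show "?a + of_int (- int (level n + j + 1)) < - n" using level_bounds(2) by simp
    qed (use level_bounds in simp)
    then show ?thesis by (simp add: Z_def of_rat_add)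
  qed
  have E: "product_term u v w b ?f1 ?f2 i - ?R i \<in> O_n" for i
  proof -
    have coef: "(- 1) ^ i * (of_int b gchoose i) = (of_nat ((level n + m + i) choose i) :: complex)"
    proof -
      have "(of_int b :: complex) = - of_nat (level n + m + 1)" by (simp add: b_def)
      then have "(of_int b gchoose i) = (- 1) ^ i * ((of_nat (level n + m + 1) + of_nat i - 1 :: complex) gchoose i)"
        by (simp only: gbinomial_minus)
      also have "(of_nat (level n + m + 1) + of_nat i - 1 :: complex) = of_nat (level n + m + i)" by simp
      finally show ?thesis by (simp add: binomial_gbinomial flip: power_mult_distrib mult.assoc)
    qed
    have first: "residue u (residue v w (?f2 * fls_X_intpow (int i))) (?f1 * fls_X_intpow (b - int i)) =
        (\<Sum>e\<le>m. of_nat (m choose e) *s Z (i + m - e) (m + i))"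
    proof -
      have "?f2 * fls_X_intpow (int i) = (\<Sum>e\<le>m. fls_const (of_nat (m choose e)) *
          (star_kernel (of_int k') * fls_X_intpow (int (i + m - e))))"
      proof -
        have "?f2 * fls_X_intpow (int i) = (\<Sum>e\<le>m. fls_const (of_nat (m choose e)) *
            (star_kernel (of_int k') * (fls_X_intpow (int (m - e)) * fls_X_intpow (int i))))"
          unfolding d star_kernel_shift[symmetric] binomial_laurent_of_nat sum_distrib_right
          by (rule sum.cong) (simp_all only: mult_ac)
        also have "\<dots> = (\<Sum>e\<le>m. fls_const (of_nat (m choose e)) *
          (star_kernel (of_int k') * fls_X_intpow (int (i + m - e))))"
          unfolding fls_X_intpow_times_fls_X_intpow
        proof (rule sum.cong[OF refl])
          fix e assume "e \<in> {..m}"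
          then have "int (m - e) + int i = int (i + m - e)" by simp
          then show "fls_const (of_nat (m choose e)) * (star_kernel (of_int k') * fls_X_intpow (int (m - e) + int i)) =
            fls_const (of_nat (m choose e)) * (star_kernel (of_int k') * fls_X_intpow (int (i + m - e)))"
            by (simp only:)
        qed
        finally show ?thesis .
      qed
      moreover have "?f1 * fls_X_intpow (b - int i) = binomial_laurent c (- int (level n + (m + i) + 1))"
        unfolding binomial_laurent_times_X by (simp add: b_def algebra_simps)
      ultimately show ?thesis
        by (simp only: residue_sum residue_const_mult residue_sum_right residue_scale_right Z_def c_def)
    qed
    have second: "residue v x (?f2 * fls_X_intpow (b - int i)) \<in> O_n" for x
    proof -
      \<comment> \<open>The factor (1+z2)^m raises the exponent from l + 1 to l + m + 1, and
        z2^(b-i) with b = -(l+m+1) still brings the sum of exponents down to -(l+1) or less.\<close>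
      let ?a = "of_nat (level n) + of_nat m + 1 :: rat"
      have "residue v x (binomial_laurent (of_int k' - 1 + of_rat ?a) (- int (level n + m' + 1) + (b - int i))) \<in> O_n" for m'
      proof (rule O_mem)
        show "v \<in> homogeneous k' ?a" using v homogeneous_cong[of ?a 0] by simp
        show "of_nat T * ?a \<in> \<int>" by (rule eig_T_Ints) simp
        have "(0::rat) \<le> of_nat m" "(0::rat) \<le> of_nat m'" "(0::rat) \<le> of_nat i" by simp_all
        then show "?a > n" "?a + of_int (- int (level n + m' + 1) + (b - int i)) < - n"
          using level_bounds(2) by (simp_all add: b_def)
      qed
      moreover have "of_int k' - 1 + of_rat ?a = of_nat m + of_int k' + (of_nat (level n) :: complex)"
        by (simp add: of_rat_add)
      ultimately show ?thesis unfolding residue_star_kernel_X d by (intro O_sum O_scale) simp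
    qed
    have "product_term u v w b ?f1 ?f2 i = ?R i - (of_nat ((level n + m + i) choose i) * (- 1) powi b) *s
        residue v (residue u w (?f1 * fls_X_intpow (int i))) (?f2 * fls_X_intpow (b - int i))"
      unfolding product_term_def coef first scale_right_diff_distrib scale_scale ..
    then have "product_term u v w b ?f1 ?f2 i - ?R i = - ((of_nat ((level n + m + i) choose i) * (- 1) powi b) *s
        residue v (residue u w (?f1 * fls_X_intpow (int i))) (?f2 * fls_X_intpow (b - int i)))"
      by simp
    also have "\<dots> \<in> O_n" by (intro O_minus O_scale second)
    finally show ?thesis .
  qed
  have "?R i \<in> O_n" if "i \<in> {..<N} - {..level n - m}" for i
    using that m by (intro O_scale O_sum Z) auto
  then have "(\<Sum>i\<in>{..<N} - {..level n - m}. ?R i) \<in> O_n" by (rule O_sum)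
  moreover have "(\<Sum>i<N. ?R i) - (\<Sum>i\<le>level n - m. ?R i) = (\<Sum>i\<in>{..<N} - {..level n - m}. ?R i)"
    by (rule sum_diff[symmetric]) (use N(3) in auto)
  ultimately have "(\<Sum>i<N. ?R i) - (\<Sum>i\<le>level n - m. ?R i) \<in> O_n" by simp
  moreover have "(\<Sum>i<N. product_term u v w b ?f1 ?f2 i - ?R i) \<in> O_n" using E by (rule O_sum)
  ultimately have "(\<Sum>i<N. product_term u v w b ?f1 ?f2 i - ?R i) + ((\<Sum>i<N. ?R i) - (\<Sum>i\<le>level n - m. ?R i)) \<in> O_n"
    by (intro O_add)
  then have "star (residue u v (binomial_laurent c b)) w - (\<Sum>i\<le>level n - m. ?R i) \<in> O_n"
    by (simp only: N(1,2) sum_subtractf diff_add_eq diff_add_cancel add_diff_eq add_diff_cancel_right')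
  then show ?thesis by (simp only: c_def b_def)
qed

lemma star_assoc: "star (star u v) w - star u (star v w) \<in> O_n"
proof (rule homogeneous_induct_0[of "\<lambda>u. star (star u v) w - star u (star v w) \<in> O_n"])
  have *: "star (star (x + y) v) w - star (x + y) (star v w) =
      (star (star x v) w - star x (star v w)) + (star (star y v) w - star y (star v w))"
    "star (star (c *s x) v) w - star (c *s x) (star v w) = c *s (star (star x v) w - star x (star v w))" for x y c
    by (simp_all add: star_add_left star_scale_left scale_right_diff_distrib)
  show "subspace {u. star (star u v) w - star u (star v w) \<in> O_n}"
    by (simp add: subspace_def * O_add O_scale O_zero star_zero_left)
next
  fix u k q assume "u \<in> homogeneous k q" "of_nat T * q \<in> \<int>" "q \<notin> \<int>"
  then show "star (star u v) w - star u (star v w) \<in> O_n"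
    by (simp add: star_homogeneous[of u k q] star_zero_left O_zero)
next
  fix u k assume u: "u \<in> homogeneous k 0"
  show "star (star u v) w - star u (star v w) \<in> O_n"
  proof (rule homogeneous_induct_0[of "\<lambda>v. star (star u v) w - star u (star v w) \<in> O_n"])
    have *: "star (star u (x + y)) w - star u (star (x + y) w) =
        (star (star u x) w - star u (star x w)) + (star (star u y) w - star u (star y w))"
      "star (star u (c *s x)) w - star u (star (c *s x) w) = c *s (star (star u x) w - star u (star x w))" for x y c
      by (simp_all add: star_add_left star_add_right star_scale_left star_scale_right scale_right_diff_distrib)
    show "subspace {v. star (star u v) w - star u (star v w) \<in> O_n}"
      by (simp add: subspace_def * O_add O_scale O_zero star_zero_left star_zero_right)
  next
    fix v k' q assume v: "v \<in> homogeneous k' q" and q: "of_nat T * q \<in> \<int>" "q \<notin> \<int>"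
    have "star (star u v) w = 0"
      unfolding star_0[OF u]
      using star_eig_nonintegral[OF residue_homogeneous_class[OF u v]] q by simp
    then show "star (star u v) w - star u (star v w) \<in> O_n"
      using q by (simp add: star_homogeneous[OF v q(1)] star_zero_right O_zero)
  next
    fix v k' assume v: "v \<in> homogeneous k' 0"
    define Z where "Z t j = residue u (residue v w (star_kernel (of_int k') * fls_X_intpow (int t)))
      (binomial_laurent (of_int k + of_nat (level n)) (- int (level n + j + 1)))" for t j
    let ?S = "\<lambda>m. star (residue u v (binomial_laurent (of_int k + of_nat (level n)) (- int (level n + m + 1)))) w"
    let ?R = "\<lambda>m. \<Sum>i\<le>level n - m. of_nat ((level n + m + i) choose i) *s (\<Sum>e\<le>m. of_nat (m choose e) *s Z (i + m - e) (m + i))"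
    have "star (star u v) w = (\<Sum>m\<le>level n. kernel_coeff m *s ?S m)"
      by (simp only: star_0[OF u] residue_star_kernel star_sum_left star_scale_left)
    moreover have "star u (star v w) = (\<Sum>m\<le>level n. kernel_coeff m *s Z 0 m)"
      by (simp only: star_0[OF u] star_0[OF v] residue_star_kernel[of u] Z_def of_nat_0 fls_shift_0 minus_zero mult_1_right)
    moreover have "(\<Sum>m\<le>level n. kernel_coeff m *s Z 0 m) = (\<Sum>m\<le>level n. kernel_coeff m *s ?R m)"
      by (rule sum_triangle_scale[symmetric])
    ultimately have "star (star u v) w - star u (star v w) = (\<Sum>m\<le>level n. kernel_coeff m *s (?S m - ?R m))"
      by (simp only: sum_subtractf scale_right_diff_distrib)
    also have "\<dots> \<in> O_n"
      using star_residue_assoc[OF u v, of _ w] by (intro O_sum O_scale) (simp add: Z_def)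
    finally show "star (star u v) w - star u (star v w) \<in> O_n" .
  qed
qed

end

section \<open>Interpolation of residues\<close>

context vertex_operator_algebra
begin

text \<open>The operator (1+z) d/dz has (1+z)^b as eigenvector with eigenvalue b. Moved to h by
  parts, it multiplies the pairing by b; \<open>h'\<close> is this adjoint applied to h, minus a
  h.\<close>

lemma residue_pairing_times:
  "\<exists>h'. \<forall>b. fls_nth (h' * binomial_laurent b 0) (- 1) = (b - a) * fls_nth (h * binomial_laurent b 0) (- 1)"
proof -
  define h' where "h' = - fls_deriv (h * binomial_laurent 1 0) - fls_const a * h"
  have "fls_nth (h' * binomial_laurent b 0) (- 1) = (b - a) * fls_nth (h * binomial_laurent b 0) (- 1)" for b
  proof -
    have "binomial_laurent 1 0 * fls_deriv (binomial_laurent b 0) = fls_const b * binomial_laurent b 0"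
    proof -
      have "binomial_laurent 1 0 * fls_deriv (binomial_laurent b 0) =
          fls_const b * (binomial_laurent 1 0 * binomial_laurent (b - 1) 0)"
        by (simp add: binomial_laurent_deriv mult_ac)
      then show ?thesis by (simp add: binomial_laurent_mult)
    qed
    then have e: "h * binomial_laurent 1 0 * fls_deriv (binomial_laurent b 0) = fls_const b * (h * binomial_laurent b 0)"
      by (simp add: mult.assoc mult.left_commute)
    have "fls_deriv (h * binomial_laurent 1 0 * binomial_laurent b 0) =
        fls_const b * (h * binomial_laurent b 0) + fls_deriv (h * binomial_laurent 1 0) * binomial_laurent b 0"
      by (subst fls_deriv_mult) (simp only: e)
    then have "fls_deriv (h * binomial_laurent 1 0) * binomial_laurent b 0 =
        fls_deriv (h * binomial_laurent 1 0 * binomial_laurent b 0) - fls_const b * (h * binomial_laurent b 0)"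
      by simp
    then have "h' * binomial_laurent b 0 = fls_const b * (h * binomial_laurent b 0) - fls_const a * (h * binomial_laurent b 0) -
        fls_deriv (h * binomial_laurent 1 0 * binomial_laurent b 0)"
      unfolding h'_def by (simp only: left_diff_distrib minus_mult_left[symmetric] mult.assoc) simp
    moreover have "fls_nth (fls_deriv (h * binomial_laurent 1 0 * binomial_laurent b 0)) (- 1) = 0"
      by (rule fls_deriv_residue)
    ultimately have "fls_nth (h' * binomial_laurent b 0) (- 1) =
        fls_nth (fls_const b * (h * binomial_laurent b 0)) (- 1) - fls_nth (fls_const a * (h * binomial_laurent b 0)) (- 1)"
      by (simp only: fls_minus_nth diff_zero)
    then show ?thesis by (simp add: left_diff_distrib)
  qed
  then show ?thesis by blast
qed

text \<open>As a function of \<open>b\<close>, the residue of \<open>h(z) (1+z)\<^sup>b\<close> can be any polynomial, so that it can be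
  prescribed by Lagrange interpolation.\<close>

lemma residue_pairing_interpolation:
  fixes t :: "complex \<Rightarrow> complex"
  assumes "finite B"
  shows "\<exists>h. \<forall>b\<in>B. fls_nth (h * binomial_laurent b 0) (- 1) = t b"
  using assms
proof induction
  case (insert a B)
  then obtain h0 where h0: "\<forall>b\<in>B. fls_nth (h0 * binomial_laurent b 0) (- 1) = t b" by blast
  \<comment> \<open>The Newton polynomial of the nodes in B: it corrects the value at the new node a
    without disturbing the old ones. The start 1/z pairs to the constant 1.\<close>
  have "\<exists>q. \<forall>b. fls_nth (q * binomial_laurent b 0) (- 1) = (\<Prod>c\<in>B. b - c)"
    using insert.hyps(1)
  proof induction
    case empty
    have "fls_nth (fls_X_intpow (- 1) * binomial_laurent b 0) (- 1) = 1" for b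
      by (simp only: mult.commute[of "fls_X_intpow _"] binomial_laurent_times_X) (simp add: binomial_laurent_nth)
    then show ?case by (intro exI[of _ "fls_X_intpow (- 1)"]) (simp only: prod.empty simp_thms)
  next
    case (insert c C)
    then obtain q where "\<forall>b. fls_nth (q * binomial_laurent b 0) (- 1) = (\<Prod>c\<in>C. b - c)" by blast
    then show ?case using residue_pairing_times[of c q] insert.hyps by simp
  qed
  then obtain q where q: "\<And>b. fls_nth (q * binomial_laurent b 0) (- 1) = (\<Prod>c\<in>B. b - c)" by blast
  define d where "d = (t a - fls_nth (h0 * binomial_laurent a 0) (- 1)) / (\<Prod>c\<in>B. a - c)"
  have nz: "(\<Prod>c\<in>B. a - c) \<noteq> 0" using insert.hyps by auto
  have z: "(\<Prod>c\<in>B. b - c) = 0" if "b \<in> B" for b using that insert.hyps(1) by auto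
  have "fls_nth ((h0 + fls_const d * q) * binomial_laurent b 0) (- 1) = fls_nth (h0 * binomial_laurent b 0) (- 1) + d * (\<Prod>c\<in>B. b - c)" for b
    by (simp add: distrib_right mult.assoc q)
  then have "\<forall>b\<in>insert a B. fls_nth ((h0 + fls_const d * q) * binomial_laurent b 0) (- 1) = t b"
    using h0 nz z by (simp add: d_def)
  then show ?case by blast
qed simp

lemma fls_nth_pascal:
  "fls_nth (f * binomial_laurent (a + 1) 0) e = fls_nth (f * binomial_laurent a 0) e + fls_nth (f * binomial_laurent a 0) (e - 1)"
proof -
  have "f * binomial_laurent (a + 1) 0 = f * binomial_laurent a 0 + f * binomial_laurent a 0 * fls_X_intpow 1"
    using binomial_laurent_pascal[of a 0] binomial_laurent_times_X[of a 0 1] by (simp add: mult.assoc distrib_left)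
  then show ?thesis by (simp only: fls_plus_nth fls_nth_times_X_intpow)
qed

text \<open>Taking differences in j lowers the index: by Pascal's rule, the coefficient at e - 1 is
  the difference of the coefficients at e for two consecutive exponents. Thus conditions at the
  single index e control a whole range of coefficients.\<close>

lemma coefficients_vanish:
  assumes "\<And>j. j \<le> M \<Longrightarrow> fls_nth (f * binomial_laurent (a + of_nat j) 0) e = 0" "t \<le> M"
  shows "fls_nth (f * binomial_laurent a 0) (e - int t) = 0"
proof -
  have "j + t \<le> M \<Longrightarrow> fls_nth (f * binomial_laurent (a + of_nat j) 0) (e - int t) = 0" for j
  proof (induction t arbitrary: j)
    case 0
    then show ?case using assms(1) by simp
  next
    case (Suc t)
    have "fls_nth (f * binomial_laurent (a + of_nat j + 1) 0) (e - int t) = 0"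
      using Suc.IH[of "Suc j"] Suc.prems by (simp add: algebra_simps)
    moreover have "fls_nth (f * binomial_laurent (a + of_nat j) 0) (e - int t) = 0"
      using Suc.IH[of j] Suc.prems by simp
    ultimately show ?case using fls_nth_pascal[of f "a + of_nat j" "e - int t"] by (simp add: algebra_simps)
  qed
  from this[of 0] assms(2) show ?thesis by simp
qed

text \<open>Expand f = h (1+z)^a by the powers of z in h. Exponents from N on contribute nothing by
  truncation, those up to b contribute elements of W, and in between the coefficients
  vanish.\<close>

lemma residue_in_subspace:
  assumes W: "subspace W" and u: "\<And>j. j \<ge> N \<Longrightarrow> Y u j v = 0"
    and z: "\<And>e. b < e \<Longrightarrow> e < N \<Longrightarrow> fls_nth (f * binomial_laurent (- a) 0) e = 0"
    and O: "\<And>e. e \<le> b \<Longrightarrow> residue u v (binomial_laurent a e) \<in> W"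
  shows "residue u v f \<in> W"
proof -
  define h where "h = f * binomial_laurent (- a) 0"
  have f: "f = h * binomial_laurent a 0"
    by (simp add: h_def mult.assoc binomial_laurent_mult) (simp add: binomial_laurent_zero)
  obtain t where t: "h = (\<Sum>e\<in>{fls_subdegree h..<N}. fls_const (fls_nth h e) * fls_X_intpow e) + t"
    "\<And>e. e < N \<Longrightarrow> fls_nth t e = 0" using fls_truncate_decomp[of h N] by blast
  have "fls_nth (t * binomial_laurent a 0) j = 0" if "j < N" for j
    by (rule fls_mult_order[of N _ 0]) (use t(2) that in \<open>auto simp: binomial_laurent_nth\<close>)
  then have t0: "residue u v (t * binomial_laurent a 0) = 0"
    by (intro residue_order_zero[OF u]) auto
  have "f = (\<Sum>e\<in>{fls_subdegree h..<N}. fls_const (fls_nth h e) * binomial_laurent a e) + t * binomial_laurent a 0"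
    by (subst f, subst t(1))
       (simp only: distrib_right sum_distrib_right mult.assoc mult.commute[of "fls_X_intpow _"] binomial_laurent_times_X add_0)
  then have "residue u v f = (\<Sum>e\<in>{fls_subdegree h..<N}. fls_nth h e *s residue u v (binomial_laurent a e))"
    by (simp only: residue_add residue_sum residue_const_mult t0 add_0_right)
  also have "\<dots> \<in> W"
  proof (rule subspace_sum[OF W])
    fix e assume "e \<in> {fls_subdegree h..<N}"
    then show "fls_nth h e *s residue u v (binomial_laurent a e) \<in> W"
      using z[of e] O[of e] W by (cases "e \<le> b") (auto simp: h_def subspace_scale subspace_0)
  qed
  finally show ?thesis .
qed

end

context zhu_level
begin

text \<open>A finite set of linear conditions on f that involves n, T, the weight k, the index r and
  the truncation bound N, but neither the automorphism nor the vectors. One f can therefore satisfy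
  it for all of G at once.\<close>

definition negligible :: "int \<Rightarrow> int \<Rightarrow> nat \<Rightarrow> complex fls \<Rightarrow> bool"
  where "negligible N k r f \<longleftrightarrow> (\<forall>e. - int (pole_order r) < e \<and> e < N \<longrightarrow>
    fls_nth (f * binomial_laurent (- (of_int k - 1 + of_rat (top_exp r))) 0) e = 0)"

lemma residue_negligible:
  assumes "r < T" "u \<in> homogeneous k (of_nat r / of_nat T)" "\<And>j. j \<ge> N \<Longrightarrow> Y u j v = 0" "negligible N k r f"
  shows "residue u v f \<in> O_n"
proof (rule residue_in_subspace[OF subspace_O assms(3)])
  fix e assume "e \<le> - int (pole_order r)"
  then show "residue u v (binomial_laurent (of_int k - 1 + of_rat (top_exp r)) e) \<in> O_n"
    using O_base[OF assms(1,2), of v "nat (- int (pole_order r) - e)"] by simp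
qed (use assms(4) in \<open>auto simp: negligible_def\<close>)

lemma negligible_interpolation:
  assumes s: "s < T"
  shows "\<exists>f. \<forall>r<T. negligible N k r (f - (if r = s then f0 else 0))"
proof -
  define al where "al r = (of_int k - 1 + of_rat (top_exp r) :: complex)" for r
  define M where "M r = nat (N + int (pole_order r))" for r
  define B where "B r = (\<lambda>j. - al r + of_nat j) ` {..M r}" for r
  have disj: "r = r'" if "r < T" "r' < T" "b \<in> B r" "b \<in> B r'" for r r' b
  proof -
    obtain j j' where "- al r + of_nat j = - al r' + of_nat j'" using \<open>b \<in> B r\<close> \<open>b \<in> B r'\<close> by (auto simp: B_def)
    then have "(of_rat (top_exp r - top_exp r') :: complex) = of_rat (of_int (int j - int j'))"
      by (simp add: al_def of_rat_diff algebra_simps)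
    then have "top_exp r - top_exp r' = of_int (int j - int j')" by (simp only: of_rat_eq_iff)
    then have "top_exp r - top_exp r' \<in> \<int>" by (metis Ints_of_int)
    moreover have "of_nat r / of_nat T - of_nat r' / of_nat T =
        (top_exp r - top_exp r') - (top_exp r - of_nat r / of_nat T) + (top_exp r' - of_nat r' / of_nat T)" by simp
    ultimately have "of_nat r / of_nat T - of_nat r' / of_nat T \<in> (\<int> :: rat set)"
      using top_exp_T(2) by (metis Ints_add Ints_diff)
    then show ?thesis using inj_onD[OF phase_inj phase_cong] that by auto
  qed
  \<comment> \<open>The factor z^(-N) moves the coefficient at N - 1 to the residue, which
    interpolation prescribes; \<open>coefficients_vanish\<close> then descends from N - 1 to the
    pole bound, and \<open>M r\<close> is the number of steps allowed for this.\<close>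
  let ?g = "f0 * fls_X_intpow (- N)"
  obtain h where h: "\<forall>b\<in>(\<Union>r<T. B r). fls_nth (h * binomial_laurent b 0) (- 1) =
      (if b \<in> B s then fls_nth (?g * binomial_laurent b 0) (- 1) else 0)"
    using residue_pairing_interpolation[of "\<Union>r<T. B r" "\<lambda>b. if b \<in> B s then fls_nth (?g * binomial_laurent b 0) (- 1) else 0"]
    by (auto simp: B_def)
  define f where "f = h * fls_X_intpow N"
  have X: "h = f * fls_X_intpow (- N)"
    by (simp only: f_def mult.assoc fls_X_intpow_times_fls_X_intpow) simp
  have "negligible N k r (f - (if r = s then f0 else 0))" if r: "r < T" for r
  proof -
    define F where "F = f - (if r = s then f0 else 0)"
    have shift: "fls_nth (F * fls_X_intpow (- N) * binomial_laurent b 0) e = fls_nth (F * binomial_laurent b 0) (N + e)" for b e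
      by (simp only: mult.assoc mult.commute[of "fls_X_intpow _"]) (simp only: mult.assoc[symmetric] fls_nth_times_X_intpow, simp add: add.commute)
    have "fls_nth (F * binomial_laurent (- al r + of_nat j) 0) (N - 1) = 0" if "j \<le> M r" for j
    proof -
      have b: "- al r + of_nat j \<in> B r" using that by (auto simp: B_def)
      have "fls_nth (h * binomial_laurent (- al r + of_nat j) 0) (- 1) =
          (if r = s then fls_nth (?g * binomial_laurent (- al r + of_nat j) 0) (- 1) else 0)"
        using h b r s disj[OF r s b] by auto
      then have "fls_nth (F * fls_X_intpow (- N) * binomial_laurent (- al r + of_nat j) 0) (- 1) = 0"
        by (cases "r = s") (simp_all only: F_def X left_diff_distrib if_True if_False diff_zero fls_minus_nth, simp_all)
      then show ?thesis unfolding shift by simp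
    qed
    then have "fls_nth (F * binomial_laurent (- al r) 0) (N - 1 - int t) = 0" if "t \<le> M r" for t
      using coefficients_vanish[of "M r" F "- al r" "N - 1" t] that by blast
    note van = this
    have "fls_nth (F * binomial_laurent (- al r) 0) e = 0" if "- int (pole_order r) < e" "e < N" for e
      using van[of "nat (N - 1 - e)"] that by (simp add: M_def)
    then show ?thesis unfolding negligible_def F_def[symmetric] al_def by blast
  qed
  then show ?thesis by blast
qed

lemma residue_eq_eigencomponent:
  assumes u: "u \<in> wt_space k" and s: "s < T"
    and f: "\<And>r. r < T \<Longrightarrow> negligible N k r (f - (if r = s then f0 else 0))"
    and N: "\<And>r j. r < T \<Longrightarrow> j \<ge> N \<Longrightarrow> Y (eigencomponent T g r u) j v = 0"
  shows "residue u v f - residue (eigencomponent T g s u) v f0 \<in> O_n"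
proof -
  have "residue (eigencomponent T g r u) v (f - (if r = s then f0 else 0)) \<in> O_n" if "r < T" for r
    using eigencomponent_in_eig[OF that] eigencomponent_wt[OF u]
    by (intro residue_negligible[OF that _ N[OF that] f[OF that]]) (auto simp: homogeneous_def)
  then have "(\<Sum>r<T. residue (eigencomponent T g r u) v (f - (if r = s then f0 else 0))) \<in> O_n"
    by (intro O_sum) auto
  also have "(\<Sum>r<T. residue (eigencomponent T g r u) v (f - (if r = s then f0 else 0))) =
      residue u v f - (\<Sum>r<T. if r = s then residue (eigencomponent T g s u) v f0 else 0)"
  proof -
    have "residue u v f = (\<Sum>r<T. residue (eigencomponent T g r u) v f)"
      using sum_component[OF graded_by_eigenspace, of u] by (simp flip: residue_sum_left)
    then show ?thesis by (simp only: sum_subtractf[symmetric]) (rule sum.cong, simp_all add: residue_diff)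
  qed
  finally show ?thesis using s by simp
qed

end

section \<open>Group actions and comaximality\<close>

context vertex_operator_algebra
begin

lemma subspace_Sum_any: "subspace W \<Longrightarrow> (\<And>i. F i \<in> W) \<Longrightarrow> Sum_any F \<in> W"
  unfolding Sum_any.expand_set by (rule subspace_sum)

text \<open>Weak associativity. If b_(p+i) a = 0 for all i >= 0, the Jacobi identity with s = k - p
  loses its second product and expresses b_k v_j a by modes of a vector acting on a and by terms
  b_(k-i) v_(j+i) a with i > 0. As v_j a = 0 for large j, downward induction on j applies.\<close>

lemma span_modes_right_closed:
  "Y b k (Y v j a) \<in> span {Y x i a | x i. True}" (is "_ \<in> ?K")
proof -
  obtain N where N: "\<forall>j\<ge>N. Y v j a = 0" using truncation by blast
  obtain p where p: "\<forall>j\<ge>p. Y b j a = 0" using truncation by blast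
  show ?thesis
  proof (induction "nat (N - j)" arbitrary: j k rule: less_induct)
    case less
    show ?case
    proof (cases "j \<ge> N")
      case True
      then show ?thesis using N by (simp add: span_zero)
    next
      case False
      define s where "s = k - p"
      let ?R = "\<lambda>i::nat. ((- 1) ^ i * ((of_int s :: complex) gchoose i)) *s Y b (k - int i) (Y v (j + int i) a)"
      have R: "Sum_any ?R = Sum_any (\<lambda>i::nat. ((- 1) ^ i * ((of_int s :: complex) gchoose i)) *s
         (Y b (p + s - int i) (Y v (j + int i) a) - ((- 1) powi s) *s Y v (j + s - int i) (Y b (p + int i) a)))"
        using p by (intro Sum_any.cong) (simp add: s_def)
      also have "\<dots> = Sum_any (\<lambda>i::nat. ((of_int p :: complex) gchoose i) *s Y (Y b (s + int i) v) (p + j - int i) a)"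
        by (rule jacobi[symmetric])
      also have "\<dots> \<in> ?K"
        by (intro subspace_Sum_any subspace_span span_scale span_base) blast
      finally have K: "Sum_any ?R \<in> ?K" .
      have "finite {i. ?R i \<noteq> 0}"
        by (rule finite_nat_support[of "nat (N - j)"]) (use N in simp)
      from eventually_conj[OF Sum_any_nat_eventually[OF this] eventually_ge_at_top[of 1]]
      obtain m where m: "(\<Sum>i<m. ?R i) = Sum_any ?R" "m \<ge> 1" by (auto dest: eventually_happens)
      obtain m' where m': "m = Suc m'" using m(2) by (cases m) auto
      have "?R (Suc i) \<in> ?K" for i
        by (rule span_scale, rule less) (use False in simp)
      then have "(\<Sum>i<m'. ?R (Suc i)) \<in> ?K" by (rule span_sum)
      moreover have "Y b k (Y v j a) = Sum_any ?R - (\<Sum>i<m'. ?R (Suc i))"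
        unfolding m(1)[symmetric] m' by (subst sum.lessThan_Suc_shift) simp
      ultimately show ?thesis using span_diff[OF K] by simp
    qed
  qed
qed

text \<open>Here \<open>x\<^sub>-\<^sub>1\<^sub>-\<^sub>i 1 = L(-1)\<^sup>i x / i!\<close>, so that \<open>v\<^sub>s a\<close> is a combination of \<open>L(-1)\<close>-derivatives of
  the vectors \<open>a\<^sub>j v\<close>.\<close>

lemma skew_symmetry:
  "Sum_any (\<lambda>i::nat. ((- 1) gchoose i) *s Y (Y a (s + int i) v) (- 1 - int i) vac) = - ((- 1) powi s) *s Y v s a"
proof -
  have "Sum_any (\<lambda>i::nat. (of_int (- 1) gchoose i) *s Y (Y a (s + int i) v) (- 1 + 0 - int i) vac) =
    Sum_any (\<lambda>i::nat. ((- 1) ^ i * ((of_int s :: complex) gchoose i)) *s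
         (Y a (- 1 + s - int i) (Y v (0 + int i) vac) - ((- 1) powi s) *s Y v (0 + s - int i) (Y a (- 1 + int i) vac)))"
    by (rule jacobi)
  also have "\<dots> = Sum_any (\<lambda>i::nat. if i = 0 then - ((- 1) powi s) *s Y v s a else 0)"
    by (rule Sum_any.cong) (auto simp: creation)
  finally show ?thesis by simp
qed

text \<open>The v_j a span an ideal, which contains a and hence is V. The a_j v span a space closed
  under L(-1), since L(-1) is a derivation and L(-1)a has multiples of the modes of a as modes;
  skew-symmetry therefore puts every v_s a into it.\<close>

lemma simple_span_modes:
  assumes simple and a: "a \<noteq> 0"
  shows "span {Y a j v | j v. True} = UNIV"
proof -
  let ?J = "span {Y a j v | j v. True}" and ?K = "span {Y v j a | v j. True}"
  have "Y b k x \<in> ?K" if "x \<in> ?K" for b k x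
  proof -
    have "?K \<subseteq> {x. Y b k x \<in> ?K}"
    proof (rule span_minimal)
      show "subspace {x. Y b k x \<in> ?K}"
        by (simp add: subspace_def Y_add_right Y_scale_right span_add span_scale span_zero)
      show "{Y v j a | v j. True} \<subseteq> {x. Y b k x \<in> ?K}"
      proof clarify
        fix v j
        show "Y b k (Y v j a) \<in> ?K" by (rule span_modes_right_closed)
      qed
    qed
    then show ?thesis using that by blast
  qed
  then have ideal: "subspace ?K \<and> (\<forall>u j. \<forall>v\<in>?K. Y u j v \<in> ?K)" by (intro conjI subspace_span allI ballI)
  have "?K = {0} \<or> ?K = UNIV"
    using \<open>simple\<close>[unfolded simple_def, THEN conjunct2, THEN spec, THEN mp, OF ideal] .
  moreover have "a \<in> ?K"
  proof -
    have "a = Y vac (- 1) a" by (simp add: vacuum)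
    then show ?thesis by (intro span_base) blast
  qed
  ultimately have K: "?K = UNIV" using a by auto
  have L: "L (- 1) x \<in> ?J" if "x \<in> ?J" for x
  proof -
    have "?J \<subseteq> {x. L (- 1) x \<in> ?J}"
    proof (rule span_minimal)
      show "subspace {x. L (- 1) x \<in> ?J}"
        by (simp add: subspace_def L_add L_scale span_add span_scale span_zero)
      show "{Y a j v | j v. True} \<subseteq> {x. L (- 1) x \<in> ?J}"
      proof clarify
        fix j v
        have "Y (L (- 1) a) j v \<in> ?J"
          unfolding Y_L_minus_1 by (intro span_neg span_scale span_base) blast
        moreover have "Y a j (L (- 1) v) \<in> ?J" by (intro span_base) blast
        ultimately show "L (- 1) (Y a j v) \<in> ?J" unfolding L_minus_1_derivation by (rule span_add)
      qed
    qed
    then show ?thesis using that by blast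
  qed
  have vac: "Y x (- 1 - int i) vac \<in> ?J" if "x \<in> ?J" for x i
    using that
  proof (induction i arbitrary: x)
    case (Suc i)
    have nz: "(1 + of_nat i :: complex) \<noteq> 0" by (metis of_nat_Suc of_nat_neq_0)
    have "Y (L (- 1) x) (- 1 - int i) vac = (1 + of_nat i) *s Y x (- 1 - int (Suc i)) vac"
      unfolding Y_L_minus_1 scale_minus_left[symmetric] by (simp add: algebra_simps)
    moreover have "Y (L (- 1) x) (- 1 - int i) vac \<in> ?J" by (intro Suc.IH L Suc.prems)
    ultimately have "(1 / (1 + of_nat i)) *s (1 + of_nat i) *s Y x (- 1 - int (Suc i)) vac \<in> ?J"
      by (simp only: span_scale)
    then show ?case using nz by simp
  qed (simp add: creation)
  have "Y v s a \<in> ?J" for v s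
  proof -
    have "- ((- 1) powi s) *s Y v s a \<in> ?J"
      unfolding skew_symmetry[of a s v, symmetric]
      by (intro subspace_Sum_any subspace_span span_scale vac span_base) blast
    from span_scale[OF this, of "- ((- 1) powi s)"] show ?thesis
      by (simp flip: power_int_mult_distrib)
  qed
  then have "?K \<subseteq> ?J" by (intro span_minimal subspace_span) auto
  then show ?thesis using K by blast
qed

end

context zhu_level
begin

lemma star_cong:
  assumes "x - x' \<in> O_n" "y - y' \<in> O_n"
  shows "star x y - star x' y' \<in> O_n"
proof -
  have "star x y - star x' y' = star (x - x') y + star x' (y - y')"
    by (simp add: star_diff_left star_diff_right)
  then show ?thesis using star_right_ideal[OF assms(1)] star_left_ideal[OF assms(2)] by (simp add: O_add)
qed

end

section \<open>Finite groups of automorphisms: the unified product and comaximality\<close>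

locale zhu_group = vertex_operator_algebra scale Y vac om
  for scale :: "complex \<Rightarrow> 'v::ab_group_add \<Rightarrow> 'v" (infixr "*s" 75) and Y vac om +
  fixes G :: "('v \<Rightarrow> 'v) set" and n :: rat
  assumes subgroup_G: "subgroup G aut_group" and finite_G: "finite G"
    and n_nonneg: "n \<ge> 0" and n_T: "of_nat (card G) * n \<in> \<int>"
begin

lemma card_pos: "card G > 0"
  using finite_G subgroup.one_closed[OF subgroup_G] by (auto simp: card_gt_0_iff)

lemma funpow_card:
  assumes "g \<in> G"
  shows "g ^^ card G = id"
proof -
  let ?H = "aut_group\<lparr>carrier := G\<rparr>"
  interpret H: group ?H by (rule subgroup.subgroup_is_group[OF subgroup_G group_aut_group])
  have "g [^]\<^bsub>?H\<^esub> (m::nat) = g ^^ m" for m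
    by (induction m) (simp_all add: aut_group_def funpow_Suc_right del: funpow.simps(2))
  moreover have "g [^]\<^bsub>?H\<^esub> Coset.order ?H = \<one>\<^bsub>?H\<^esub>"
    using assms by (intro H.pow_order_eq_1) simp
  ultimately show ?thesis by (simp add: Coset.order_def aut_group_def)
qed

lemma zhu_level_G: "g \<in> G \<Longrightarrow> zhu_level scale Y vac om (card G) g n"
  using card_pos subgroup.subset[OF subgroup_G] funpow_card n_nonneg n_T
  by unfold_locales auto

lemma obtain_unit: obtains g where "g \<in> G"
  using subgroup.one_closed[OF subgroup_G] by blast

abbreviation "T \<equiv> card G"

text \<open>The conditions \<open>negligible\<close> share a single bound N, so truncation has to be
  uniform over the finitely many components of u for all elements of G.\<close>

lemma common_truncation:
  fixes u v :: 'v
  obtains N where "\<And>g r j. g \<in> G \<Longrightarrow> r < T \<Longrightarrow> j \<ge> N \<Longrightarrow> Y (eigencomponent T g r u) j v = 0"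
proof -
  have "\<forall>p. \<exists>N. \<forall>j\<ge>N. Y (eigencomponent T (fst p) (snd p) u) j v = 0" using truncation by blast
  then obtain N where N: "\<And>p j. j \<ge> N p \<Longrightarrow> Y (eigencomponent T (fst p) (snd p) u) j v = 0" by metis
  have fin: "finite (N ` (G \<times> {..<T}))" using finite_G by simp
  show thesis
  proof (rule that[of "Max (N ` (G \<times> {..<T}))"])
    fix g r j assume "g \<in> G" "r < T" "j \<ge> Max (N ` (G \<times> {..<T}))"
    then have "j \<ge> N (g, r)" using Max_ge[OF fin, of "N (g, r)"] by force
    then show "Y (eigencomponent T g r u) j v = 0" using N[of "(g, r)" j] by simp
  qed
qed

lemma uniform_representative:
  assumes u: "u \<in> wt_space k" and s: "s < T"
  obtains f where "\<And>g. g \<in> G \<Longrightarrow> residue u v f - residue (eigencomponent T g s u) v f0 \<in> zhu_O T n g"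
proof -
  obtain N where N: "\<And>g r j. g \<in> G \<Longrightarrow> r < T \<Longrightarrow> j \<ge> N \<Longrightarrow> Y (eigencomponent T g r u) j v = 0"
    using common_truncation by metis
  \<comment> \<open>Any element of G will do: its interpolating f satisfies conditions that do not
    refer to it.\<close>
  obtain g0 where g0: "g0 \<in> G" by (rule obtain_unit)
  obtain f where f: "\<forall>r<T. zhu_level.negligible T n N k r (f - (if r = s then f0 else 0))"
    using zhu_level.negligible_interpolation[OF zhu_level_G[OF g0] s] by blast
  show thesis
    using zhu_level.residue_eq_eigencomponent[OF zhu_level_G u s, of _ N f f0 v] f N by (intro that) blast
qed

text \<open>The target is the kernel of the product on the component s = 0, weight by weight. The
  function f depends on v through the truncation bound, and \<open>m\<close> is chosen for each pair
  separately, so no bilinearity of \<open>m\<close> is claimed.\<close>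

lemma unified_product_exists: "\<exists>m. unified_product G n m"
proof -
  have "\<exists>w. \<forall>g\<in>G. w - zhu_star T n g u v \<in> zhu_O T n g" for u v
  proof -
    let ?c = "\<lambda>k. component wt_space UNIV k u"
    let ?E = "\<lambda>k. zhu_level.star_kernel n (of_int k)"
    have "\<exists>f. \<forall>g\<in>G. residue (?c k) v f - residue (eigencomponent T g 0 (?c k)) v (?E k) \<in> zhu_O T n g" for k
      by (rule uniform_representative[OF component_in[OF graded_by_wt UNIV_I, of k u] card_pos, of v "?E k"]) blast
    then obtain f where f: "\<And>k g. g \<in> G \<Longrightarrow>
        residue (?c k) v (f k) - residue (eigencomponent T g 0 (?c k)) v (?E k) \<in> zhu_O T n g" by metis
    let ?K = "{k. ?c k \<noteq> 0}"
    have "(\<Sum>k\<in>?K. residue (?c k) v (f k)) - zhu_star T n g u v \<in> zhu_O T n g" if g: "g \<in> G" for g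
    proof -
      interpret zhu_level scale Y vac om T g n by (rule zhu_level_G[OF g])
      have "star u v = (\<Sum>k\<in>?K. residue (eigencomponent T g 0 (?c k)) v (star_kernel (of_int k)))"
        unfolding zhu_star_eq by (rule Sum_any.expand_superset[OF component_finite[OF graded_by_wt] star_support])
      then show ?thesis using f[OF g] by (simp only: sum_subtractf[symmetric]) (intro O_sum)
    qed
    then show ?thesis by blast
  qed
  then obtain m where "\<And>u v g. g \<in> G \<Longrightarrow> m u v - zhu_star T n g u v \<in> zhu_O T n g" by metis
  then show ?thesis unfolding unified_product_def by blast
qed

text \<open>An automorphism can be recovered from its components on weight vectors, because these
  span V. The vector u is taken of pure weight since \<open>uniform_representative\<close> asks for
  one.\<close>

lemma eigencomponents_differ:
  assumes g: "g \<in> G" and h: "h \<in> G" and "g \<noteq> h"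
  obtains u k s where "u \<in> wt_space k" "s < T" "eigencomponent T g s u \<noteq> eigencomponent T h s u"
proof (rule ccontr)
  note differ = that
  assume no: "\<not> thesis"
  interpret g: zhu_level scale Y vac om T g n by (rule zhu_level_G[OF g])
  interpret h: zhu_level scale Y vac om T h n by (rule zhu_level_G[OF h])
  have "g u = h u" if u: "u \<in> wt_space k" for u k
  proof -
    have eq: "eigencomponent T g s u = eigencomponent T h s u" if "s < T" for s
      using differ[OF u that] no by blast
    have "g u = (\<Sum>s<T. phase (of_nat s / of_nat T) *s eigencomponent T g s u)"
    proof -
      have "g u = (\<Sum>s<T. g (eigencomponent T g s u))"
        using sum_component[OF g.graded_by_eigenspace, of u] by (simp flip: g.g.sum)
      then show ?thesis using g.eigencomponent_in_eig by (simp add: g.eig_def)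
    qed
    also have "\<dots> = (\<Sum>s<T. phase (of_nat s / of_nat T) *s eigencomponent T h s u)"
      by (rule sum.cong) (simp_all add: eq)
    also have "\<dots> = h u"
    proof -
      have "h u = (\<Sum>s<T. h (eigencomponent T h s u))"
        using sum_component[OF h.graded_by_eigenspace, of u] by (simp flip: h.g.sum)
      then show ?thesis using h.eigencomponent_in_eig by (simp add: h.eig_def)
    qed
    finally show ?thesis .
  qed
  then have "(\<Union>k. wt_space k) \<subseteq> {u. g u = h u}" by auto
  moreover have "subspace {u. g u = h u}"
    by (simp add: subspace_def g.g.add h.g.add g.g.scale h.g.scale g.g.zero h.g.zero)
  ultimately have "span (\<Union>k. wt_space k) \<subseteq> {u. g u = h u}" by (rule span_minimal)
  moreover have "span (\<Union>k. wt_space k) = UNIV" using grading by (simp add: wt_space_def L_def)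
  ultimately have "g = h" by (auto simp: fun_eq_iff)
  then show False using \<open>g \<noteq> h\<close> by contradiction
qed

lemma zhu_O_comaximal:
  assumes simple and g: "g \<in> G" and h: "h \<in> G" and "g \<noteq> h"
  obtains x y where "x \<in> zhu_O T n g" "y \<in> zhu_O T n h" "vac = x + y"
proof -
  interpret g: zhu_level scale Y vac om T g n by (rule zhu_level_G[OF g])
  interpret h: zhu_level scale Y vac om T h n by (rule zhu_level_G[OF h])
  define I where "I = {x + y | x y. x \<in> zhu_O T n g \<and> y \<in> zhu_O T n h}"
  have I: "subspace I" unfolding I_def by (rule subspace_sums[OF g.subspace_O h.subspace_O])
  obtain u k s where u: "u \<in> wt_space k" and s: "s < T" and ne: "eigencomponent T g s u \<noteq> eigencomponent T h s u"
    using eigencomponents_differ[OF g h \<open>g \<noteq> h\<close>] by metis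
  define a where "a = eigencomponent T g s u - eigencomponent T h s u"
  have "Y a j v \<in> I" for j v
  proof -
    obtain f where f: "\<And>g. g \<in> G \<Longrightarrow>
        residue u v f - residue (eigencomponent T g s u) v (fls_X_intpow j) \<in> zhu_O T n g"
      using uniform_representative[OF u s] by metis
    have "Y a j v = - (residue u v f - Y (eigencomponent T g s u) j v) + (residue u v f - Y (eigencomponent T h s u) j v)"
      by (simp add: a_def Y_diff_left)
    then show ?thesis
      using g.O_minus[OF f[OF g]] f[OF h] unfolding I_def residue_X_intpow by blast
  qed
  then have "span {Y a j v | j v. True} \<subseteq> I" by (intro span_minimal I) auto
  then have "vac \<in> I" using simple_span_modes[OF \<open>simple\<close>, of a] ne by (auto simp: a_def)
  then show thesis using that by (auto simp: I_def)
qed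

text \<open>Adds one h at a time by multiplying with an element y of O_h that is congruent to the
  vacuum modulo O_g. The factors are joined by the unified product, since the products
  \<open>zhu_star\<close> for different automorphisms are different maps.\<close>

lemma idempotent_exists:
  assumes simple and g: "g \<in> G"
  obtains e where "e - vac \<in> zhu_O T n g" "\<And>h. h \<in> G \<Longrightarrow> h \<noteq> g \<Longrightarrow> e \<in> zhu_O T n h"
proof -
  obtain m where m: "\<And>u v g. g \<in> G \<Longrightarrow> m u v - zhu_star T n g u v \<in> zhu_O T n g"
    using unified_product_exists unfolding unified_product_def by blast
  have "\<exists>e. e - vac \<in> zhu_O T n g \<and> (\<forall>h\<in>F. e \<in> zhu_O T n h)" if "finite F" "F \<subseteq> G - {g}" for F
    using that
  proof (induction F)
    case empty
    interpret zhu_level scale Y vac om T g n by (rule zhu_level_G[OF g])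
    show ?case by (intro exI[of _ vac]) (simp add: O_zero)
  next
    case (insert h F)
    then obtain e where e: "e - vac \<in> zhu_O T n g" "\<And>h. h \<in> F \<Longrightarrow> e \<in> zhu_O T n h" by auto
    have h: "h \<in> G" "g \<noteq> h" using insert.prems by auto
    obtain x y where xy: "x \<in> zhu_O T n g" "y \<in> zhu_O T n h" "vac = x + y"
      by (rule zhu_O_comaximal[OF \<open>simple\<close> g h])
    have "m e y - vac \<in> zhu_O T n g"
    proof -
      interpret zhu_level scale Y vac om T g n by (rule zhu_level_G[OF g])
      have "y - vac \<in> O_n" using O_minus[OF xy(1)] xy(3) by simp
      then have "star e y - vac \<in> O_n" using star_cong[OF e(1)] star_vac_left[of vac] by metis
      from O_add[OF m[OF g, of e y] this] show ?thesis by simp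
    qed
    moreover have "m e y \<in> zhu_O T n f" if "f \<in> insert h F" for f
    proof -
      have f: "f \<in> G" using that insert.prems by auto
      interpret zhu_level scale Y vac om T f n by (rule zhu_level_G[OF f])
      have "star e y \<in> O_n"
        using that e(2) xy(2) star_left_ideal star_right_ideal by (cases "f = h") auto
      from O_add[OF m[OF f, of e y] this] show ?thesis by simp
    qed
    ultimately show ?case by blast
  qed
  from this[of "G - {g}"] finite_G that show thesis by auto
qed

text \<open>The solution is the sum over g of e_g times x_g for the unified product; modulo O_h only
  the term of h survives.\<close>

lemma simultaneous_congruence:
  assumes simple
  obtains u where "\<And>g. g \<in> G \<Longrightarrow> u - x g \<in> zhu_O T n g"
proof -
  obtain m where m: "\<And>u v g. g \<in> G \<Longrightarrow> m u v - zhu_star T n g u v \<in> zhu_O T n g"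
    using unified_product_exists unfolding unified_product_def by blast
  have "\<forall>g. \<exists>e. g \<in> G \<longrightarrow> e - vac \<in> zhu_O T n g \<and> (\<forall>h\<in>G. h \<noteq> g \<longrightarrow> e \<in> zhu_O T n h)"
    using idempotent_exists[OF \<open>simple\<close>] by metis
  then obtain e where e: "\<And>g. g \<in> G \<Longrightarrow> e g - vac \<in> zhu_O T n g"
      "\<And>g h. g \<in> G \<Longrightarrow> h \<in> G \<Longrightarrow> h \<noteq> g \<Longrightarrow> e g \<in> zhu_O T n h" by metis
  have "(\<Sum>g\<in>G. m (e g) (x g)) - x h \<in> zhu_O T n h" if h: "h \<in> G" for h
  proof -
    interpret zhu_level scale Y vac om T h n by (rule zhu_level_G[OF h])
    have "m (e g) (x g) \<in> O_n" if "g \<in> G - {h}" for g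
    proof -
      have "e g \<in> O_n" using e(2)[of g h] that h by auto
      from O_add[OF m[OF h, of "e g" "x g"] star_right_ideal[OF this, of "x g"]] show ?thesis by simp
    qed
    then have "(\<Sum>g\<in>G - {h}. m (e g) (x g)) \<in> O_n" by (rule O_sum)
    moreover have "m (e h) (x h) - x h \<in> O_n"
    proof -
      have "star (e h) (x h) - x h \<in> O_n"
        using star_cong[OF e(1)[OF h], of "x h" "x h"] by (simp add: star_vac_left O_zero)
      from O_add[OF m[OF h, of "e h" "x h"] this] show ?thesis by simp
    qed
    ultimately have "m (e h) (x h) - x h + (\<Sum>g\<in>G - {h}. m (e g) (x g)) \<in> O_n" by (intro O_add)
    then show ?thesis by (simp add: sum.remove[OF finite_G h] algebra_simps)
  qed
  then show thesis by (rule that)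
qed

end

section \<open>Change of level and quotient algebras\<close>

locale zhu_descent = zhu_level scale Y vac om T g n
  for scale :: "complex \<Rightarrow> 'v::ab_group_add \<Rightarrow> 'v" (infixr "*s" 75) and Y vac om T g n +
  assumes n_ge: "n \<ge> 1 / of_nat T"
begin

lemma lower_level: "zhu_level scale Y vac om T g (n - 1 / of_nat T)"
proof (unfold_locales)
  have "of_nat T * (n - 1 / of_nat T) = of_nat T * n - 1" using T_pos by (simp add: right_diff_distrib)
  then show "of_nat T * (n - 1 / of_nat T) \<in> \<int>" using n_T by simp
qed (use n_ge in simp)

sublocale lower: zhu_level scale Y vac om T g "n - 1 / of_nat T"
  by (rule lower_level)

lemma lower_less: "n - 1 / of_nat T < n"
  using T_pos by simp

lemma O_descent: "O_n \<subseteq> lower.O_n"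
proof (rule O_subset[OF lower.subspace_O lower.O_L])
  fix u v k a b assume u: "u \<in> homogeneous k a" "of_nat T * a \<in> \<int>" and a: "n < a" "a + of_int b < - n"
  show "residue u v (binomial_laurent (of_int k - 1 + of_rat a) b) \<in> lower.O_n"
    by (rule lower.O_mem[OF u]) (use a lower_less in linarith)+
qed

lemma level_descent:
  "level (n - 1 / of_nat T) = level n \<or>
    level n = Suc (level (n - 1 / of_nat T)) \<and> n = of_nat (level n)"
proof -
  have T: "(1::rat) / of_nat T > 0" "(1::rat) / of_nat T \<le> 1" using T_pos by simp_all
  show ?thesis
  proof (cases "frac_index T n = 0")
    case True
    then have n: "n = of_nat (level n)" using level_index(1) by simp
    have "of_nat (level (n - 1 / of_nat T)) < (of_nat (level n) :: rat)"
      using lower.level_bounds(1) lower_less n by linarith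
    then have "level (n - 1 / of_nat T) < level n" by (simp only: of_nat_less_iff)
    moreover have "(of_nat (level n) :: rat) < of_nat (level (n - 1 / of_nat T) + 2)"
      unfolding of_nat_add of_nat_numeral using lower.level_bounds(2) n T by linarith
    then have "level n < level (n - 1 / of_nat T) + 2" by (simp only: of_nat_less_iff)
    ultimately have "level n = Suc (level (n - 1 / of_nat T))" by linarith
    then show ?thesis using n by blast
  next
    case False
    then have "(1::rat) / of_nat T \<le> of_nat (frac_index T n) / of_nat T"
      using T_pos by (simp add: divide_right_mono)
    then have "of_nat (level n) \<le> n - 1 / of_nat T" using level_index(1) by linarith
    then have "(of_nat (level n) :: rat) < of_nat (level (n - 1 / of_nat T) + 1)"
      "of_nat (level (n - 1 / of_nat T)) < (of_nat (level n + 1) :: rat)"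
      unfolding of_nat_add of_nat_1 using lower.level_bounds level_bounds lower_less by linarith+
    then have "level n < level (n - 1 / of_nat T) + 1" "level (n - 1 / of_nat T) < level n + 1"
      by (simp_all only: of_nat_less_iff)
    then show ?thesis by simp
  qed
qed

text \<open>Only a drop of the level from l + 1 to l matters. Both kernels then come from functions
  with a zero of order l + 1 at w = 0 and equal to 1 up to order l + 1 at infinity, and l + 1
  exceeds n - 1/T. Concretely, Pascal's rule makes the difference telescope to poles beyond the
  lower range.\<close>

lemma star_kernel_descent:
  assumes u: "u \<in> homogeneous k 0"
  shows "residue u v (star_kernel (of_int k)) - residue u v (lower.star_kernel (of_int k)) \<in> lower.O_n"
  using level_descent
proof
  assume "level (n - 1 / of_nat T) = level n"
  then show ?thesis by (simp add: star_kernel_def lower.star_kernel_def lower.O_zero)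
next
  define l where "l = level (n - 1 / of_nat T)"
  assume "level n = Suc (level (n - 1 / of_nat T)) \<and> n = of_nat (level n)"
  then have l: "level n = Suc l" and n: "n = of_nat l + 1" by (simp_all add: l_def) 
  define R where "R j = residue u v (binomial_laurent (of_int k + of_nat l) (- int (l + j + 1)))" for j
  have R: "R j \<in> lower.O_n" if "j > l" for j
  proof -
    let ?a = "of_nat l + 1 :: rat"
    have "residue u v (binomial_laurent (of_int k - 1 + of_rat ?a) (- int (l + j + 1))) \<in> lower.O_n"
    proof (rule lower.O_mem)
      show "u \<in> homogeneous k ?a" using u homogeneous_cong[of ?a 0] by simp
      show "of_nat T * ?a \<in> \<int>" by (rule eig_T_Ints) simp
      show "n - 1 / of_nat T < ?a" using lower_less n by linarith
      have "of_nat j \<ge> ?a" using that by (metis Suc_leI of_nat_Suc of_nat_mono add.commute)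
      moreover have "?a + of_int (- int (l + j + 1)) = - of_nat j" by simp
      ultimately show "?a + of_int (- int (l + j + 1)) < - (n - 1 / of_nat T)"
        using lower_less n by linarith
    qed
    then show ?thesis by (simp add: R_def of_rat_add)
  qed
  let ?e = "\<lambda>m. (- 1) ^ m * of_nat ((m + Suc l) choose Suc l) :: complex"
  let ?e' = "\<lambda>m. (- 1) ^ m * of_nat ((m + l) choose l) :: complex"
  have tele: "(\<Sum>m\<le>M. ?e m *s (R m + R (Suc m))) = (\<Sum>m\<le>M. ?e' m *s R m) + ?e M *s R (Suc M)" for M
  proof (induction M)
    case (Suc M)
    have "?e M + ?e (Suc M) = ?e' (Suc M)" by (simp add: algebra_simps)
    then have e: "?e M *s R (Suc M) + ?e (Suc M) *s R (Suc M) = ?e' (Suc M) *s R (Suc M)"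
      by (simp only: scale_left_distrib[symmetric])
    have "(\<Sum>m\<le>Suc M. ?e m *s (R m + R (Suc m))) =
        (\<Sum>m\<le>M. ?e' m *s R m) + (?e M *s R (Suc M) + ?e (Suc M) *s R (Suc M)) + ?e (Suc M) *s R (Suc (Suc M))"
      unfolding sum.atMost_Suc Suc.IH by (simp only: scale_right_distrib add.assoc)
    then show ?case unfolding e by simp
  qed (simp add: scale_right_distrib)
  have P: "residue u v (binomial_laurent (of_int k + of_nat (Suc l)) (- int (Suc l + m + 1))) = R m + R (Suc m)" for m
    using binomial_laurent_pascal[of "of_int k + of_nat l" "- int (Suc l + m + 1)"]
    by (simp add: R_def residue_add algebra_simps)
  have 1: "residue u v (star_kernel (of_int k)) = (\<Sum>m\<le>Suc l. ?e m *s (R m + R (Suc m)))"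
    unfolding residue_star_kernel l P ..
  have 2: "residue u v (lower.star_kernel (of_int k)) = (\<Sum>m\<le>l. ?e' m *s R m)"
    unfolding lower.residue_star_kernel l_def[symmetric] R_def ..
  have "residue u v (star_kernel (of_int k)) - residue u v (lower.star_kernel (of_int k)) =
      ?e' (Suc l) *s R (Suc l) + ?e (Suc l) *s R (Suc (Suc l))"
    unfolding 1 2 tele sum.atMost_Suc[of _ l] by simp
  also have "\<dots> \<in> lower.O_n" by (intro lower.O_add lower.O_scale R) simp_all
  finally show ?thesis .
qed

lemma star_descent: "star u v - lower.star u v \<in> lower.O_n"
proof (rule homogeneous_induct_0[of "\<lambda>u. star u v - lower.star u v \<in> lower.O_n"])
  have *: "star (x + y) v - lower.star (x + y) v = (star x v - lower.star x v) + (star y v - lower.star y v)"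
    "star (c *s x) v - lower.star (c *s x) v = c *s (star x v - lower.star x v)" for x y c
    by (simp_all add: star_add_left lower.star_add_left star_scale_left lower.star_scale_left scale_right_diff_distrib)
  show "subspace {u. star u v - lower.star u v \<in> lower.O_n}"
    by (simp add: subspace_def * lower.O_add lower.O_scale lower.O_zero star_zero_left lower.star_zero_left)
next
  fix u k assume "u \<in> homogeneous k 0"
  then show "star u v - lower.star u v \<in> lower.O_n"
    using star_kernel_descent by (simp add: star_0 lower.star_0)
next
  fix u k q assume "u \<in> homogeneous k q" "of_nat T * q \<in> \<int>" "q \<notin> \<int>"
  then show "star u v - lower.star u v \<in> lower.O_n"
    by (simp add: star_homogeneous lower.star_homogeneous lower.O_zero)
qed

end

text \<open>A unified product is determined only modulo W, so every law, bilinearity included, is a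
  congruence. \<open>m_cong\<close> makes the unions over representatives in
  \<open>quotient_algebra\<close> single cosets. The locale covers each single automorphism as well
  as the group.\<close>

locale algebra_congruence = vertex_operator_algebra scale Y vac om
  for scale :: "complex \<Rightarrow> 'v::ab_group_add \<Rightarrow> 'v" (infixr "*s" 75) and Y vac om +
  fixes W :: "'v set" and m :: "'v \<Rightarrow> 'v \<Rightarrow> 'v"
  assumes W: "subspace W"
    and m_cong: "\<And>x x' y y'. x - x' \<in> W \<Longrightarrow> y - y' \<in> W \<Longrightarrow> m x y - m x' y' \<in> W"
    and m_add_left: "\<And>x y z. m (x + y) z - (m x z + m y z) \<in> W"
    and m_add_right: "\<And>x y z. m z (x + y) - (m z x + m z y) \<in> W"
    and m_scale_left: "\<And>c x y. m (c *s x) y - c *s m x y \<in> W"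
    and m_scale_right: "\<And>c x y. m x (c *s y) - c *s m x y \<in> W"
    and m_assoc: "\<And>x y z. m (m x y) z - m x (m y z) \<in> W"
    and m_unit_left: "\<And>x. m vac x - x \<in> W"
    and m_unit_right: "\<And>x. m x vac - x \<in> W"
begin

abbreviation "Q \<equiv> quotient_algebra W m"

lemmas W_add = subspace_add[OF W] and W_scale = subspace_scale[OF W]

lemma Q_carrier: "carrier Q = range (coset W)"
  by (simp add: quotient_algebra_def)

lemma Q_mult: "coset W a \<otimes>\<^bsub>Q\<^esub> coset W b = coset W (m a b)"
proof -
  have "coset W (m a' b') = coset W (m a b)" if "a' \<in> coset W a" "b' \<in> coset W b" for a' b'
    using that m_cong by (simp add: coset_eq_iff[OF W] mem_coset_iff)
  moreover have "a \<in> coset W a" "b \<in> coset W b" using W by (rule mem_coset)+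
  ultimately have "(\<Union>a'\<in>coset W a. \<Union>b'\<in>coset W b. coset W (m a' b')) = coset W (m a b)" by blast
  then show ?thesis by (simp add: quotient_algebra_def)
qed

lemma Q_add: "coset W a \<oplus>\<^bsub>Q\<^esub> coset W b = coset W (a + b)"
proof -
  have "coset W (a' + b') = coset W (a + b)" if "a' \<in> coset W a" "b' \<in> coset W b" for a' b'
    using that W_add[of "a' - a" "b' - b"] by (simp add: coset_eq_iff[OF W] mem_coset_iff algebra_simps)
  moreover have "a \<in> coset W a" "b \<in> coset W b" using W by (rule mem_coset)+
  ultimately have "(\<Union>a'\<in>coset W a. \<Union>b'\<in>coset W b. coset W (a' + b')) = coset W (a + b)" by blast
  then show ?thesis by (simp add: quotient_algebra_def)
qed

lemma Q_smult: "c \<odot>\<^bsub>Q\<^esub> coset W a = coset W (c *s a)"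
proof -
  have "coset W (c *s a') = coset W (c *s a)" if "a' \<in> coset W a" for a'
    using that W_scale[of "a' - a" c] by (simp add: coset_eq_iff[OF W] mem_coset_iff scale_right_diff_distrib)
  moreover have "a \<in> coset W a" using W by (rule mem_coset)
  ultimately have "(\<Union>a'\<in>coset W a. coset W (c *s a')) = coset W (c *s a)" by blast
  then show ?thesis by (simp add: quotient_algebra_def)
qed

lemma Q_one: "\<one>\<^bsub>Q\<^esub> = coset W vac" and Q_zero: "\<zero>\<^bsub>Q\<^esub> = coset W 0"
  by (simp_all add: quotient_algebra_def)

lemmas Q_simps = Q_carrier Q_mult Q_add Q_smult Q_one Q_zero

lemma Q_assoc_algebra: "assoc_algebra complex_ring Q"
proof -
  have eq: "u - v \<in> W \<Longrightarrow> coset W u = coset W v" for u v by (simp add: coset_eq_iff[OF W])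
  have ab: "abelian_group Q"
  proof (rule abelian_groupI)
    fix x assume "x \<in> carrier Q"
    then obtain a where "x = coset W a" by (auto simp: Q_carrier)
    then show "\<exists>y\<in>carrier Q. y \<oplus>\<^bsub>Q\<^esub> x = \<zero>\<^bsub>Q\<^esub>"
      by (intro bexI[of _ "coset W (- a)"]) (simp_all add: Q_simps)
  qed (auto simp: Q_simps algebra_simps)
  have mon: "Group.monoid Q"
  proof (rule Group.monoidI)
    fix x y z assume "x \<in> carrier Q" "y \<in> carrier Q" "z \<in> carrier Q"
    then obtain a b c where "x = coset W a" "y = coset W b" "z = coset W c" by (auto simp: Q_carrier)
    then show "x \<otimes>\<^bsub>Q\<^esub> y \<otimes>\<^bsub>Q\<^esub> z = x \<otimes>\<^bsub>Q\<^esub> (y \<otimes>\<^bsub>Q\<^esub> z)"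
      by (simp only: Q_mult eq[OF m_assoc])
  next
    fix x assume "x \<in> carrier Q"
    then obtain a where x: "x = coset W a" by (auto simp: Q_carrier)
    show "\<one>\<^bsub>Q\<^esub> \<otimes>\<^bsub>Q\<^esub> x = x" "x \<otimes>\<^bsub>Q\<^esub> \<one>\<^bsub>Q\<^esub> = x"
      unfolding x Q_one Q_mult by (rule eq, rule m_unit_left, rule eq, rule m_unit_right)
  qed (auto simp: Q_simps)
  have ring: "Ring.ring Q"
    by (rule Ring.ringI[OF ab mon]; unfold Q_carrier; elim imageE; simp only: Q_mult Q_add;
        rule eq; rule m_add_left m_add_right)
  have C: "cring complex_ring" by (rule cring_from_type_algebra)
  have "Module.module complex_ring Q"
    by (rule Module.moduleI[OF C ab])
       (auto simp: Q_simps ring_of_type_algebra_def scale_left_distrib scale_right_distrib)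
  then show ?thesis
  proof (intro assoc_algebra.intro ring assoc_algebra_axioms.intro)
    fix c x y assume "x \<in> carrier Q" "y \<in> carrier Q"
    then show "(c \<odot>\<^bsub>Q\<^esub> x) \<otimes>\<^bsub>Q\<^esub> y = c \<odot>\<^bsub>Q\<^esub> (x \<otimes>\<^bsub>Q\<^esub> y)"
      and "x \<otimes>\<^bsub>Q\<^esub> (c \<odot>\<^bsub>Q\<^esub> y) = c \<odot>\<^bsub>Q\<^esub> (x \<otimes>\<^bsub>Q\<^esub> y)"
      unfolding Q_carrier
      by (elim imageE, simp only: Q_mult Q_smult, intro eq m_scale_left m_scale_right)+
  qed
qed

end

context zhu_level
begin

lemma star_congruence: "algebra_congruence scale Y vac om O_n star"
  by unfold_locales
     (simp_all add: subspace_O star_cong star_add_left star_add_right star_scale_left star_scale_right O_zero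
       star_assoc star_vac_left star_vac_right)

end

text \<open>Well-definedness of the maps between quotients below, which are defined by choosing a
  representative of a coset.\<close>

lemma (in vertex_operator_algebra) coset_some:
  assumes "subspace W" "subspace W'" "W \<subseteq> W'"
  shows "coset W' (SOME a. a \<in> coset W u) = coset W' u"
proof -
  have "(SOME a. a \<in> coset W u) \<in> coset W u" using mem_coset[OF assms(1)] by (rule someI)
  then show ?thesis using assms(3) by (auto simp: coset_eq_iff[OF assms(2)] mem_coset_iff)
qed

section \<open>The quotient by the intersection and the maps out of it\<close>

context zhu_group
begin

lemma zhu_O_group_iff: "x \<in> zhu_O_group G n \<longleftrightarrow> (\<forall>g\<in>G. x \<in> zhu_O T n g)"
  by (simp add: zhu_O_group_def)

text \<open>Membership in the intersection is tested for one g at a time, where \<open>m\<close> may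
  be exchanged for \<open>star\<close>. For associativity the exchange also happens inside a
  product, which is justified by \<open>star_cong\<close>.\<close>

lemma unified_congruence:
  assumes m: "unified_product G n m"
  shows "algebra_congruence scale Y vac om (zhu_O_group G n) m"
proof -
  have sub: "subspace (zhu_O T n g)" if "g \<in> G" for g
    using zhu_level.subspace_O[OF zhu_level_G[OF that]] .
  have via: "x \<in> zhu_O T n g" if "g \<in> G" "x - y \<in> zhu_O T n g" "y \<in> zhu_O T n g" for x y g
    using subspace_add[OF sub[OF that(1)] that(2,3)] by simp
  have mg: "m u v - zhu_star T n g u v \<in> zhu_O T n g" if "g \<in> G" for g u v
    using m that by (simp add: unified_product_def)
  show ?thesis
  proof (unfold_locales, unfold zhu_O_group_iff)
    show "subspace (zhu_O_group G n)"
      using sub by (auto simp: zhu_O_group_def subspace_def)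
  next
    fix x x' y y' assume xy: "\<forall>g\<in>G. x - x' \<in> zhu_O T n g" "\<forall>g\<in>G. y - y' \<in> zhu_O T n g"
    show "\<forall>g\<in>G. m x y - m x' y' \<in> zhu_O T n g"
    proof
      fix g assume g: "g \<in> G"
      interpret zhu_level scale Y vac om T g n by (rule zhu_level_G[OF g])
      have "star x y - star x' y' \<in> O_n" using xy g by (intro star_cong) auto
      from O_add[OF O_diff[OF mg[OF g] mg[OF g]] this]
      have "(m x y - star x y) - (m x' y' - star x' y') + (star x y - star x' y') \<in> O_n" .
      then show "m x y - m x' y' \<in> O_n" by simp
    qed
  next
    fix x y z
    show "\<forall>g\<in>G. m (x + y) z - (m x z + m y z) \<in> zhu_O T n g"
    proof
      fix g assume g: "g \<in> G"
      interpret zhu_level scale Y vac om T g n by (rule zhu_level_G[OF g])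
      have "(m (x + y) z - star (x + y) z) - ((m x z - star x z) + (m y z - star y z)) \<in> O_n"
        by (rule O_diff[OF mg[OF g] O_add[OF mg[OF g] mg[OF g]]])
      then show "m (x + y) z - (m x z + m y z) \<in> O_n" by (simp add: star_add_left algebra_simps)
    qed
  next
    fix x y z
    show "\<forall>g\<in>G. m z (x + y) - (m z x + m z y) \<in> zhu_O T n g"
    proof
      fix g assume g: "g \<in> G"
      interpret zhu_level scale Y vac om T g n by (rule zhu_level_G[OF g])
      have "(m z (x + y) - star z (x + y)) - ((m z x - star z x) + (m z y - star z y)) \<in> O_n"
        by (rule O_diff[OF mg[OF g] O_add[OF mg[OF g] mg[OF g]]])
      then show "m z (x + y) - (m z x + m z y) \<in> O_n" by (simp add: star_add_right algebra_simps)
    qed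
  next
    fix c x y
    show "\<forall>g\<in>G. m (c *s x) y - c *s m x y \<in> zhu_O T n g"
    proof
      fix g assume g: "g \<in> G"
      interpret zhu_level scale Y vac om T g n by (rule zhu_level_G[OF g])
      have "(m (c *s x) y - star (c *s x) y) - c *s (m x y - star x y) \<in> O_n"
        by (rule O_diff[OF mg[OF g] O_scale[OF mg[OF g]]])
      then show "m (c *s x) y - c *s m x y \<in> O_n"
        by (simp add: star_scale_left scale_right_diff_distrib)
    qed
  next
    fix c x y
    show "\<forall>g\<in>G. m x (c *s y) - c *s m x y \<in> zhu_O T n g"
    proof
      fix g assume g: "g \<in> G"
      interpret zhu_level scale Y vac om T g n by (rule zhu_level_G[OF g])
      have "(m x (c *s y) - star x (c *s y)) - c *s (m x y - star x y) \<in> O_n"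
        by (rule O_diff[OF mg[OF g] O_scale[OF mg[OF g]]])
      then show "m x (c *s y) - c *s m x y \<in> O_n"
        by (simp add: star_scale_right scale_right_diff_distrib)
    qed
  next
    fix x y z
    show "\<forall>g\<in>G. m (m x y) z - m x (m y z) \<in> zhu_O T n g"
    proof
      fix g assume g: "g \<in> G"
      interpret zhu_level scale Y vac om T g n by (rule zhu_level_G[OF g])
      have 1: "star (m x y) z - star (star x y) z \<in> O_n"
        by (rule star_cong[OF mg[OF g]]) (simp add: O_zero)
      have 2: "star x (m y z) - star x (star y z) \<in> O_n"
        by (rule star_cong[OF _ mg[OF g]]) (simp add: O_zero)
      have "(m (m x y) z - star (m x y) z) - (m x (m y z) - star x (m y z)) +
          ((star (m x y) z - star (star x y) z) - (star x (m y z) - star x (star y z)) +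
          (star (star x y) z - star x (star y z))) \<in> O_n"
        by (rule O_add[OF O_diff[OF mg[OF g] mg[OF g]] O_add[OF O_diff[OF 1 2] star_assoc]])
      then show "m (m x y) z - m x (m y z) \<in> O_n" by simp
    qed
  next
    fix x
    show "\<forall>g\<in>G. m vac x - x \<in> zhu_O T n g"
    proof
      fix g assume g: "g \<in> G"
      interpret zhu_level scale Y vac om T g n by (rule zhu_level_G[OF g])
      show "m vac x - x \<in> O_n" using mg[OF g, of vac x] by (simp add: star_vac_left)
    qed
  next
    fix x
    show "\<forall>g\<in>G. m x vac - x \<in> zhu_O T n g"
    proof
      fix g assume g: "g \<in> G"
      interpret zhu_level scale Y vac om T g n by (rule zhu_level_G[OF g])
      show "m x vac - x \<in> O_n" using O_add[OF mg[OF g, of x vac] star_vac_right[of x]] by simp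
    qed
  qed
qed

lemma subspace_O_group: "subspace (zhu_O_group G n)"
  using zhu_level.subspace_O[OF zhu_level_G] by (auto simp: zhu_O_group_def subspace_def)

definition diagonal_map :: "'v set \<Rightarrow> ('v \<Rightarrow> 'v) \<Rightarrow> 'v set"
  where "diagonal_map A = (\<lambda>g\<in>G. coset (zhu_O T n g) (SOME a. a \<in> A))"

lemma diagonal_map_coset: "diagonal_map (coset (zhu_O_group G n) u) = (\<lambda>g\<in>G. coset (zhu_O T n g) u)"
  unfolding diagonal_map_def
  by (rule restrict_ext, rule coset_some[OF subspace_O_group zhu_level.subspace_O[OF zhu_level_G]])
     (auto simp: zhu_O_group_def)

lemma diagonal_map_inj: "inj_on diagonal_map (range (coset (zhu_O_group G n)))"
proof (rule inj_onI, clarify)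
  fix u v assume "diagonal_map (coset (zhu_O_group G n) u) = diagonal_map (coset (zhu_O_group G n) v)"
  then have eq: "(\<lambda>g\<in>G. coset (zhu_O T n g) u) = (\<lambda>g\<in>G. coset (zhu_O T n g) v)" by (simp only: diagonal_map_coset)
  have "u - v \<in> zhu_O T n g" if g: "g \<in> G" for g
    using fun_cong[OF eq, of g] g coset_eq_iff[OF zhu_level.subspace_O[OF zhu_level_G[OF g]]] by simp
  then show "coset (zhu_O_group G n) u = coset (zhu_O_group G n) v"
    by (simp add: coset_eq_iff[OF subspace_O_group] zhu_O_group_iff)
qed

lemma diagonal_map_hom:
  assumes m: "unified_product G n m"
  shows "diagonal_map \<in> algebra_hom complex_ring (zhu_algebra_group G n m) (direct_sum_algebra G (zhu_algebra T n))"
proof -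
  interpret algebra_congruence scale Y vac om "zhu_O_group G n" m by (rule unified_congruence[OF m])
  have sub: "subspace (zhu_O T n g)" if "g \<in> G" for g
    using zhu_level.subspace_O[OF zhu_level_G[OF that]] .
  note g_simps = algebra_congruence.Q_simps[OF zhu_level.star_congruence[OF zhu_level_G]]
  have mg: "coset (zhu_O T n g) (m u v) = coset (zhu_O T n g) (zhu_star T n g u v)" if "g \<in> G" for g u v
    using m that by (simp add: coset_eq_iff[OF sub] unified_product_def)
  show ?thesis
    unfolding algebra_hom_def ring_hom_def zhu_algebra_group_def zhu_algebra_def
    by (auto simp: Q_simps diagonal_map_coset direct_sum_algebra_def g_simps mg intro!: restrict_ext)
qed

lemma diagonal_map_surj:
  assumes simple
  shows "diagonal_map ` range (coset (zhu_O_group G n)) = carrier (direct_sum_algebra G (zhu_algebra T n))"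
proof
  show "diagonal_map ` range (coset (zhu_O_group G n)) \<subseteq> carrier (direct_sum_algebra G (zhu_algebra T n))"
    by (auto simp: diagonal_map_coset direct_sum_algebra_def zhu_algebra_def quotient_algebra_def)
  show "carrier (direct_sum_algebra G (zhu_algebra T n)) \<subseteq> diagonal_map ` range (coset (zhu_O_group G n))"
  proof
    fix F assume "F \<in> carrier (direct_sum_algebra G (zhu_algebra T n))"
    then have F: "F \<in> (\<Pi>\<^sub>E g\<in>G. range (coset (zhu_O T n g)))"
      by (simp add: direct_sum_algebra_def zhu_algebra_def quotient_algebra_def)
    then have "\<forall>g\<in>G. \<exists>x. F g = coset (zhu_O T n g) x" by (auto simp: PiE_iff)
    then obtain x where x: "\<And>g. g \<in> G \<Longrightarrow> F g = coset (zhu_O T n g) (x g)" by metis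
    obtain u where u: "\<And>g. g \<in> G \<Longrightarrow> u - x g \<in> zhu_O T n g"
      using simultaneous_congruence[OF \<open>simple\<close>, of x] by blast
    have "F = diagonal_map (coset (zhu_O_group G n) u)"
      unfolding diagonal_map_coset
    proof (rule ext)
      fix g show "F g = (\<lambda>g\<in>G. coset (zhu_O T n g) u) g"
      proof (cases "g \<in> G")
        case True
        then show ?thesis
          using u[OF True] coset_eq_iff[OF zhu_level.subspace_O[OF zhu_level_G[OF True]], of u "x g"] x by simp
      next
        case False
        then show ?thesis using PiE_arb[OF F] by simp
      qed
    qed
    then show "F \<in> diagonal_map ` range (coset (zhu_O_group G n))" by blast
  qed
qed

text \<open>The unified products \<open>m\<close> and \<open>m'\<close> are chosen independently at
  the two levels. At the lower level they agree because each is compared with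
  \<open>zhu_star\<close> of its own level, and these two are linked by
  \<open>star_descent\<close>.\<close>

lemma descent_hom:
  assumes n1: "n \<ge> 1 / of_nat T" and m: "unified_product G n m" and m': "unified_product G (n - 1 / of_nat T) m'"
  defines "n' \<equiv> n - 1 / of_nat T"
  defines "\<psi> \<equiv> \<lambda>A. coset (zhu_O_group G n') (SOME a. a \<in> A)"
  shows "\<psi> (coset (zhu_O_group G n) u) = coset (zhu_O_group G n') u"
    and "\<psi> \<in> algebra_hom complex_ring (zhu_algebra_group G n m) (zhu_algebra_group G n' m')"
    and "\<psi> ` carrier (zhu_algebra_group G n m) = carrier (zhu_algebra_group G n' m')"
proof -
  have desc: "zhu_descent scale Y vac om T g n" if "g \<in> G" for g
    by (intro zhu_descent.intro zhu_level_G[OF that] zhu_descent_axioms.intro n1)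
  obtain g0 where g0: "g0 \<in> G" by (rule obtain_unit)
  interpret l0: zhu_level scale Y vac om T g0 n'
    unfolding n'_def by (rule zhu_descent.lower_level[OF desc[OF g0]])
  interpret lower: zhu_group scale Y vac om G n'
    by (intro zhu_group.intro zhu_group_axioms.intro vertex_operator_algebra_axioms subgroup_G finite_G l0.n_nonneg l0.n_T)
  interpret A: algebra_congruence scale Y vac om "zhu_O_group G n" m by (rule unified_congruence[OF m])
  interpret B: algebra_congruence scale Y vac om "zhu_O_group G n'" m'
    using lower.unified_congruence m' by (simp add: n'_def)
  have O: "zhu_O T n g \<subseteq> zhu_O T n' g" if "g \<in> G" for g
    unfolding n'_def by (rule zhu_descent.O_descent[OF desc[OF that]])
  then have sub: "zhu_O_group G n \<subseteq> zhu_O_group G n'" unfolding zhu_O_group_def by blast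
  have psi: "\<psi> (coset (zhu_O_group G n) u) = coset (zhu_O_group G n') u" for u
    unfolding \<psi>_def by (rule coset_some[OF subspace_O_group lower.subspace_O_group sub])
  then show "\<psi> (coset (zhu_O_group G n) u) = coset (zhu_O_group G n') u" .
  have "m u v - m' u v \<in> zhu_O T n' g" if g: "g \<in> G" for g u v
  proof -
    interpret zhu_level scale Y vac om T g n' by (rule lower.zhu_level_G[OF g])
    have 1: "m u v - zhu_star T n g u v \<in> O_n" using m g O[OF g] unfolding unified_product_def by blast
    have 2: "m' u v - zhu_star T n' g u v \<in> O_n" using m' g unfolding unified_product_def n'_def by blast
    have 3: "zhu_star T n g u v - zhu_star T n' g u v \<in> O_n"
      unfolding n'_def by (rule zhu_descent.star_descent[OF desc[OF g]])
    have "(m u v - zhu_star T n g u v) - (m' u v - zhu_star T n' g u v) +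
        (zhu_star T n g u v - zhu_star T n' g u v) \<in> O_n"
      by (rule O_add[OF O_diff[OF 1 2] 3])
    then show ?thesis by simp
  qed
  then have mm: "coset (zhu_O_group G n') (m u v) = coset (zhu_O_group G n') (m' u v)" for u v
    by (simp add: coset_eq_iff[OF lower.subspace_O_group] zhu_O_group_iff lower.zhu_O_group_iff)
  show "\<psi> \<in> algebra_hom complex_ring (zhu_algebra_group G n m) (zhu_algebra_group G n' m')"
    unfolding algebra_hom_def ring_hom_def zhu_algebra_group_def
    by (auto simp: A.Q_simps B.Q_simps psi mm)
  show "\<psi> ` carrier (zhu_algebra_group G n m) = carrier (zhu_algebra_group G n' m')"
    unfolding zhu_algebra_group_def A.Q_carrier B.Q_carrier image_image psi ..
qed

end

text \<open>The quantifier over all unified \<open>m\<close> does not introduce a choice: two of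
  them differ by elements of the intersection and so induce the same operations on the
  quotient.\<close>

theorem theorem1:
  fixes scale :: "complex \<Rightarrow> 'v::ab_group_add \<Rightarrow> 'v"
    and Y :: "'v \<Rightarrow> int \<Rightarrow> 'v \<Rightarrow> 'v"
    and vac om :: 'v
    and G :: "('v \<Rightarrow> 'v) set"
    and n :: rat
  defines "T \<equiv> card G"
    and "unified \<equiv> vertex_operator_algebra.unified_product scale Y om G"
    and "A_G \<equiv> vertex_operator_algebra.zhu_algebra_group scale Y vac om G"
    and "O_G \<equiv> vertex_operator_algebra.zhu_O_group scale Y om G"
    and "A \<equiv> vertex_operator_algebra.zhu_algebra scale Y vac om (card G)"
    and "O_g \<equiv> vertex_operator_algebra.zhu_O scale Y om (card G)"
  assumes voa: "vertex_operator_algebra scale Y vac om"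
    and G: "subgroup G (vertex_operator_algebra.aut_group scale Y vac om)" "finite G"
    and n: "n \<ge> 0" "of_nat T * n \<in> \<int>"
  shows "(\<exists>m. unified n m) \<and>
    (\<forall>m. unified n m \<longrightarrow>
      assoc_algebra complex_ring (A_G n m) \<and>
      (\<exists>\<phi>. (\<forall>u. \<phi> (coset (O_G n) u) = (\<lambda>g\<in>G. coset (O_g n g) u)) \<and>
           inj_on \<phi> (carrier (A_G n m)) \<and>
           (vertex_operator_algebra.simple scale Y \<longrightarrow>
             \<phi> \<in> algebra_hom complex_ring (A_G n m) (direct_sum_algebra G (A n)) \<and>
             \<phi> ` carrier (A_G n m) = carrier (direct_sum_algebra G (A n))))) \<and>
    (n \<ge> 1 / of_nat T \<longrightarrow>
      (\<forall>m m'. unified n m \<longrightarrow> unified (n - 1 / of_nat T) m' \<longrightarrow>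
        (\<exists>\<psi>. (\<forall>u. \<psi> (coset (O_G n) u) = coset (O_G (n - 1 / of_nat T)) u) \<and>
             \<psi> \<in> algebra_hom complex_ring (A_G n m) (A_G (n - 1 / of_nat T) m') \<and>
             \<psi> ` carrier (A_G n m) = carrier (A_G (n - 1 / of_nat T) m'))))"
proof -
  interpret vertex_operator_algebra scale Y vac om by (fact voa)
  interpret zhu_group scale Y vac om G n
    using G n voa unfolding T_def by (intro zhu_group.intro zhu_group_axioms.intro)
  have carrier: "carrier (zhu_algebra_group G n m) = range (coset (zhu_O_group G n))" for m
    by (simp add: zhu_algebra_group_def quotient_algebra_def)
  show ?thesis
    unfolding T_def unified_def A_G_def O_G_def A_def O_g_def
  proof (intro conjI allI impI)
    show "\<exists>m. unified_product G n m" by (rule unified_product_exists)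
  next
    fix m assume m: "unified_product G n m"
    show "assoc_algebra complex_ring (zhu_algebra_group G n m)"
      unfolding zhu_algebra_group_def by (rule algebra_congruence.Q_assoc_algebra[OF unified_congruence[OF m]])
  next
    fix m assume m: "unified_product G n m"
    show "\<exists>\<phi>. (\<forall>u. \<phi> (coset (zhu_O_group G n) u) = (\<lambda>g\<in>G. coset (zhu_O (card G) n g) u)) \<and>
         inj_on \<phi> (carrier (zhu_algebra_group G n m)) \<and>
         (simple \<longrightarrow>
           \<phi> \<in> algebra_hom complex_ring (zhu_algebra_group G n m) (direct_sum_algebra G (zhu_algebra (card G) n)) \<and>
           \<phi> ` carrier (zhu_algebra_group G n m) = carrier (direct_sum_algebra G (zhu_algebra (card G) n)))"
      using diagonal_map_coset diagonal_map_inj diagonal_map_hom[OF m] diagonal_map_surj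
      unfolding carrier by (intro exI[of _ diagonal_map]) simp
  next
    fix m m' assume "1 / of_nat (card G) \<le> n" "unified_product G n m" "unified_product G (n - 1 / of_nat (card G)) m'"
    from descent_hom[OF this]
    show "\<exists>\<psi>. (\<forall>u. \<psi> (coset (zhu_O_group G n) u) = coset (zhu_O_group G (n - 1 / of_nat (card G))) u) \<and>
         \<psi> \<in> algebra_hom complex_ring (zhu_algebra_group G n m) (zhu_algebra_group G (n - 1 / of_nat (card G)) m') \<and>
         \<psi> ` carrier (zhu_algebra_group G n m) = carrier (zhu_algebra_group G (n - 1 / of_nat (card G)) m')"
      by (intro exI conjI allI)
  qed
qed

end
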